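(* Let $X=(X_n)$ be a time-homogeneous discrete-time Markov chain with transition kernel $P$ on a measurable state space $\mathcal{X}$, and let $V:\mathcal{X}\to[1,\infty)$ be measurable. Suppose that $X$ satisfies the weak drift condition $$PV \leq V + b\,\mathbf{1}_C$$ for some measurable set $C\subseteq\mathcal{X}$ and some constant $b<\infty$. Suppose also that $X$ is tamed with respect to $V$ by the function $F:[1,\infty)\to\{1,2,\dots\}$, $$F(z) = \begin{cases} \lceil \lambda z^\delta \rceil, & z > d', \\ 1, & z \leq d', \end{cases}$$ where $\lambda>0$, $\delta\in(0,1)$ and $d'\ge 1$ are constants, with the resulting subsampled chain $X'$ satisfying, for some constants $\beta\in(0,1)$ and $b'<\infty$, the drift condition $PV\le \beta V+b'\mathbf{1}_{[V\le d']}$, where here $P$ denotes the transition kernel of $X'$; that is, $$\mathbb{E}_x\big[V(X_{F(V(x))})\big] \leq \beta V(x) + b'\,\mathbf{1}_{[V(x) \leq d']}\qquad\text{for all }x\in\mathcal{X},$$ and with $$\log \beta < \delta^{-1} \log(1-\delta).$$ Then there exists a stationary ergodic process $D$ (a Markov chain paused using $F$, in the sense defined in the context) which dominates $V(X)$ at the times $\{\sigma_n\}$ when $D$ moves.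
   Context: Notation: $PV(x)=\mathbb{E}_x[V(X_1)]=\mathbb{E}[V(X_1)\mid X_0=x]$, $\mathbf{1}_A$ is the indicator function of $A$, and $[V\le d']=\{x\in\mathcal{X}: V(x)\le d'\}$. Subsampled chain. Given $F:[1,\infty)\to\{1,2,\dots\}$, the subsampled chain $X'$ is $X'_n = X_{\theta_n}$, where $\theta_0=0$ and $\theta_{n+1}=\theta_n+F(V(X_{\theta_n}))$. In particular, started from $x$, $X'_1 = X_{F(V(x))}$. Saying that $X$ is tamed with respect to $V$ by $F$ means that, for $F$ of the form displayed in the claim, the chain $X'$ satisfies the drift condition displayed in the claim with $\log\beta<\delta^{-1}\log(1-\delta)$. Paused process and times of moves. Let $Y$ be a time-homogeneous Markov chain with transition kernel $Q$ on a Borel subset of $[1,\infty)$. The process $D$ obtained by pausing $Y$ using $F$ visits successively the states of a chain with kernel $Q$ and, on arriving at a state $z$, remains there for exactly $F(z)$ time units before making its next transition. Thus, if $\sigma_n$ denotes the successive (integer) times at which $D$ moves (i.e. at which a transition of the underlying chain is made, even if the value happens not to change), then $\sigma_{n+1}=\sigma_n+F(D_{\sigma_n})$, $D$ is constant on $\{\sigma_n,\sigma_n+1,\dots,\sigma_{n+1}-1\}$, and, conditionally on the past of $D$ up to time $\sigma_n$ with $D_{\sigma_n}=z$, the value $D_{\sigma_{n+1}}$ has law $Q(z,\cdot)$. "Stationary ergodic" means that $D$, indexed by integer time, is run in statistical equilibrium as a stationary and ergodic process with a proper (probability) equilibrium distribution. Domination at the times when $D$ moves. $D$ dominates $V(X)$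 at the times $\{\sigma_n\}$ if $D$ and $X$ can be coupled so that, almost surely, for every move time $\sigma_n$ (at or after the start of $X$), $$V(X_{\sigma_n})\le D_{\sigma_n}\ \Longrightarrow\ V(X_{\sigma_{n+1}})\le D_{\sigma_{n+1}}.$$ Here the coupling is such that, conditionally on the joint history of $(X,D)$ up to time $\sigma_n$ with $X_{\sigma_n}=x$ and $D_{\sigma_n}=z$, the segment $(X_{\sigma_n},\dots,X_{\sigma_n+F(z)})$ has the law of $F(z)$ steps of the chain $X$ started at $x$, and $D_{\sigma_{n+1}}=D_{\sigma_n+F(z)}$ has law $Q(z,\cdot)$. (Between move times no domination is required.) *)

theory Defs
  imports "HOL-Probability.Probability"
begin

text \<open>
  A Markov kernel on \<open>M\<close> is a measurable map \<^term>\<open>P \<in> M \<rightarrow>\<^sub>M prob_algebra M\<close>.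
  The measure \<open>chain_path M P n x\<close> on \<open>{..n} \<rightarrow> M\<close> is the law of \<open>(X\<^sub>0, \<dots>, X\<^sub>n)\<close> for the
  chain with kernel \<open>P\<close> and \<open>X\<^sub>0 = x\<close>.
\<close>

primrec chain_path :: "'a measure \<Rightarrow> ('a \<Rightarrow> 'a measure) \<Rightarrow> nat \<Rightarrow> 'a \<Rightarrow> (nat \<Rightarrow> 'a) measure" where
  "chain_path M P 0 x = return (Pi\<^sub>M {..0} (\<lambda>_. M)) (\<lambda>i\<in>{..0}. x)"
| "chain_path M P (Suc n) x =
     chain_path M P n x \<bind>
       (\<lambda>\<omega>. distr (P (\<omega> n)) (Pi\<^sub>M {..Suc n} (\<lambda>_. M)) (\<lambda>y. fun_upd \<omega> (Suc n) y))"

text \<open>The kernel of the chain subsampled by \<open>F\<close>: from \<open>x\<close>, the law of \<open>X\<close> at time \<open>F (V x)\<close>.\<close>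

definition subsampled_kernel ::
  "'a measure \<Rightarrow> ('a \<Rightarrow> 'a measure) \<Rightarrow> ('a \<Rightarrow> real) \<Rightarrow> (real \<Rightarrow> nat) \<Rightarrow> 'a \<Rightarrow> 'a measure" where
  "subsampled_kernel M P V F x = distr (chain_path M P (F (V x)) x) M (\<lambda>\<omega>. \<omega> (F (V x)))"

text \<open>
  The inequality \<open>PV \<le> a V + b 1\<^sub>C\<close>. The mean is a nonnegative Lebesgue integral, so the
  inequality includes finiteness of \<open>PV\<close>.
\<close>

definition drift_condition ::
  "'a measure \<Rightarrow> ('a \<Rightarrow> 'a measure) \<Rightarrow> ('a \<Rightarrow> real) \<Rightarrow> real \<Rightarrow> real \<Rightarrow> 'a set \<Rightarrow> bool" where
  "drift_condition M P V a b C \<longleftrightarrow>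
     (\<forall>x\<in>space M. (\<integral>\<^sup>+ y. ennreal (V y) \<partial>P x) \<le> ennreal (a * V x + b * indicator C x))"

definition taming_function :: "real \<Rightarrow> real \<Rightarrow> real \<Rightarrow> real \<Rightarrow> nat" where
  "taming_function lam \<delta> d z = (if z > d then nat \<lceil>lam * z powr \<delta>\<rceil> else 1)"

text \<open>
  On the event \<open>E\<close>, the conditional law of \<open>Y\<close> given (the sigma-algebra generated by) the
  random element \<open>H\<close> is the random measure \<open>\<kappa>\<close>. In the uses below \<open>E\<close> is determined by \<open>H\<close>.
\<close>

definition cond_law ::
  "'w measure \<Rightarrow> ('w \<Rightarrow> 'h) \<Rightarrow> 'h measure \<Rightarrow> 'w set \<Rightarrow> ('w \<Rightarrow> 'b) \<Rightarrow> 'b measure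
    \<Rightarrow> ('w \<Rightarrow> 'b measure) \<Rightarrow> bool" where
  "cond_law \<Omega> H HS E Y N \<kappa> \<longleftrightarrow>
     (\<forall>B\<in>sets N. AE \<omega> in \<Omega>. \<omega> \<in> E \<longrightarrow>
        real_cond_exp \<Omega> (vimage_algebra (space \<Omega>) H HS) (indicator (Y -` B \<inter> space \<Omega>)) \<omega>
          = measure (\<kappa> \<omega>) B)"

definition markov_chain ::
  "'w measure \<Rightarrow> 'a measure \<Rightarrow> 'a measure \<Rightarrow> ('a \<Rightarrow> 'a measure) \<Rightarrow> (nat \<Rightarrow> 'w \<Rightarrow> 'a) \<Rightarrow> bool" where
  "markov_chain \<Omega> M \<mu> P X \<longleftrightarrow>
     (\<forall>n. X n \<in> \<Omega> \<rightarrow>\<^sub>M M) \<and> distr \<Omega> M (X 0) = \<mu> \<and>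
     (\<forall>n. cond_law \<Omega> (\<lambda>\<omega>. \<lambda>i\<in>{..n}. X i \<omega>) (Pi\<^sub>M {..n} (\<lambda>_. M)) (space \<Omega>)
            (X (Suc n)) M (\<lambda>\<omega>. P (X n \<omega>)))"

definition path_law :: "'w measure \<Rightarrow> 's measure \<Rightarrow> (int \<Rightarrow> 'w \<Rightarrow> 's) \<Rightarrow> (int \<Rightarrow> 's) measure" where
  "path_law \<Omega> N Z = distr \<Omega> (Pi\<^sub>M UNIV (\<lambda>_. N)) (\<lambda>\<omega> n. Z n \<omega>)"

definition stationary_process :: "'w measure \<Rightarrow> 's measure \<Rightarrow> (int \<Rightarrow> 'w \<Rightarrow> 's) \<Rightarrow> bool" where
  "stationary_process \<Omega> N Z \<longleftrightarrow> path_law \<Omega> N (\<lambda>n. Z (n + 1)) = path_law \<Omega> N Z"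

definition ergodic_process :: "'w measure \<Rightarrow> 's measure \<Rightarrow> (int \<Rightarrow> 'w \<Rightarrow> 's) \<Rightarrow> bool" where
  "ergodic_process \<Omega> N Z \<longleftrightarrow>
     (\<forall>A\<in>sets (Pi\<^sub>M UNIV (\<lambda>_::int. N)).
        (\<lambda>z n. z (n + 1)) -` A \<inter> space (Pi\<^sub>M UNIV (\<lambda>_::int. N)) = A \<longrightarrow>
        measure (path_law \<Omega> N Z) A \<in> {0, 1})"

text \<open>
  A paused chain is carried as a pair: \<open>D n\<close> is its value at time \<open>n\<close>, and \<open>J n\<close> says that
  \<open>n\<close> is one of the times at which it moves. The marks \<open>J\<close> are needed because a transition
  need not change the value of \<open>D\<close>, so that \<open>D\<close> alone does not determine the move times.
\<close>

abbreviation marked_space :: "real set \<Rightarrow> (real \<times> bool) measure" where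
  "marked_space S \<equiv> restrict_space borel S \<Otimes>\<^sub>M count_space UNIV"

abbreviation marked :: "(int \<Rightarrow> 'w \<Rightarrow> real) \<Rightarrow> (int \<Rightarrow> 'w \<Rightarrow> bool) \<Rightarrow> int \<Rightarrow> 'w \<Rightarrow> real \<times> bool" where
  "marked D J n \<omega> \<equiv> (D n \<omega>, J n \<omega>)"

definition marked_process ::
  "'w measure \<Rightarrow> real set \<Rightarrow> (int \<Rightarrow> 'w \<Rightarrow> real) \<Rightarrow> (int \<Rightarrow> 'w \<Rightarrow> bool) \<Rightarrow> bool" where
  "marked_process \<Omega> S D J \<longleftrightarrow>
     prob_space \<Omega> \<and> (\<forall>n. D n \<in> \<Omega> \<rightarrow>\<^sub>M restrict_space borel S) \<and>
     (\<forall>n. J n \<in> \<Omega> \<rightarrow>\<^sub>M count_space UNIV)"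

text \<open>
  The process, indexed by all integer times, which is obtained by pausing the chain on \<open>S\<close> with
  kernel \<open>Q\<close> using \<open>F\<close>. The first clause on paths says that every time belongs to some sojourn;
  the second one describes the sojourn begun at a move time \<open>m\<close>. The conditional law at the
  (random) move times is expressed at each fixed time \<open>m\<close>, on the event that \<open>m\<close> is a move time.
\<close>

definition paused_chain ::
  "'w measure \<Rightarrow> real set \<Rightarrow> (real \<Rightarrow> real measure) \<Rightarrow> (real \<Rightarrow> nat)
    \<Rightarrow> (int \<Rightarrow> 'w \<Rightarrow> real) \<Rightarrow> (int \<Rightarrow> 'w \<Rightarrow> bool) \<Rightarrow> bool" where
  "paused_chain \<Omega> S Q F D J \<longleftrightarrow>
     marked_process \<Omega> S D J \<and>
     (AE \<omega> in \<Omega>. \<forall>n. \<exists>m\<le>n. J m \<omega>) \<and>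
     (AE \<omega> in \<Omega>. \<forall>m. J m \<omega> \<longrightarrow>
        (\<forall>n. m < n \<and> n < m + int (F (D m \<omega>)) \<longrightarrow> D n \<omega> = D m \<omega> \<and> \<not> J n \<omega>) \<and>
        J (m + int (F (D m \<omega>))) \<omega>) \<and>
     (\<forall>m. cond_law \<Omega> (\<lambda>\<omega>. \<lambda>i\<in>{..m}. marked D J i \<omega>) (Pi\<^sub>M {..m} (\<lambda>_. marked_space S))
            {\<omega>\<in>space \<Omega>. J m \<omega>}
            (\<lambda>\<omega>. D (m + int (F (D m \<omega>))) \<omega>) (restrict_space borel S) (\<lambda>\<omega>. Q (D m \<omega>)))"

text \<open>
  A coupling of the chain \<open>X\<close>, started at time \<open>0\<close> with law \<open>\<mu>\<close>, with a paused chain \<open>(D, J)\<close>,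
  in which moves of \<open>D\<close> and the accompanying segments of \<open>X\<close> have the right conditional laws
  given the joint history. Since the length of a segment is random, its conditional law is
  specified separately on each event that the length is \<open>k\<close>.
\<close>

definition joint_history ::
  "(nat \<Rightarrow> 'w \<Rightarrow> 'a) \<Rightarrow> (int \<Rightarrow> 'w \<Rightarrow> real) \<Rightarrow> (int \<Rightarrow> 'w \<Rightarrow> bool) \<Rightarrow> nat \<Rightarrow> 'w
    \<Rightarrow> (nat \<Rightarrow> 'a) \<times> (int \<Rightarrow> real \<times> bool)" where
  "joint_history X D J m \<omega> = (\<lambda>i\<in>{..m}. X i \<omega>, \<lambda>i\<in>{..int m}. marked D J i \<omega>)"

definition joint_history_space ::
  "'a measure \<Rightarrow> real set \<Rightarrow> nat \<Rightarrow> ((nat \<Rightarrow> 'a) \<times> (int \<Rightarrow> real \<times> bool)) measure" where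
  "joint_history_space M S m =
     Pi\<^sub>M {..m} (\<lambda>_. M) \<Otimes>\<^sub>M Pi\<^sub>M {..int m} (\<lambda>_. marked_space S)"

definition move_coupling ::
  "'w measure \<Rightarrow> 'a measure \<Rightarrow> 'a measure \<Rightarrow> ('a \<Rightarrow> 'a measure)
    \<Rightarrow> real set \<Rightarrow> (real \<Rightarrow> real measure) \<Rightarrow> (real \<Rightarrow> nat)
    \<Rightarrow> (nat \<Rightarrow> 'w \<Rightarrow> 'a) \<Rightarrow> (int \<Rightarrow> 'w \<Rightarrow> real) \<Rightarrow> (int \<Rightarrow> 'w \<Rightarrow> bool) \<Rightarrow> bool" where
  "move_coupling \<Omega> M \<mu> P S Q F X D J \<longleftrightarrow>
     markov_chain \<Omega> M \<mu> P X \<and> paused_chain \<Omega> S Q F D J \<and>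
     (\<forall>m. cond_law \<Omega> (joint_history X D J m) (joint_history_space M S m)
            {\<omega>\<in>space \<Omega>. J (int m) \<omega>}
            (\<lambda>\<omega>. D (int m + int (F (D (int m) \<omega>))) \<omega>) (restrict_space borel S)
            (\<lambda>\<omega>. Q (D (int m) \<omega>))) \<and>
     (\<forall>m k. cond_law \<Omega> (joint_history X D J m) (joint_history_space M S m)
            {\<omega>\<in>space \<Omega>. J (int m) \<omega> \<and> F (D (int m) \<omega>) = k}
            (\<lambda>\<omega>. \<lambda>i\<in>{..k}. X (m + i) \<omega>) (Pi\<^sub>M {..k} (\<lambda>_. M))
            (\<lambda>\<omega>. chain_path M P k (X m \<omega>)))"

text \<open>
  The paused chain \<open>(D, J)\<close> on \<open>\<Omega>\<close> dominates \<open>V(X)\<close> at its move times: for every initial law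
  \<open>\<mu>\<close> of \<open>X\<close> there is a coupling of \<open>X\<close> with a copy \<open>(D', J')\<close> of \<open>(D, J)\<close> in which every move
  preserves domination. Being a property of joint laws, this may be tested on a sample space that
  has the type of the product of the two path spaces.
\<close>

definition dominates_at_moves ::
  "'w measure \<Rightarrow> 'a measure \<Rightarrow> ('a \<Rightarrow> 'a measure) \<Rightarrow> ('a \<Rightarrow> real)
    \<Rightarrow> real set \<Rightarrow> (real \<Rightarrow> real measure) \<Rightarrow> (real \<Rightarrow> nat)
    \<Rightarrow> (int \<Rightarrow> 'w \<Rightarrow> real) \<Rightarrow> (int \<Rightarrow> 'w \<Rightarrow> bool) \<Rightarrow> bool" where
  "dominates_at_moves \<Omega> M P V S Q F D J \<longleftrightarrow>
     (\<forall>\<mu>\<in>space (prob_algebra M).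
        \<exists>(\<Omega>' :: ((nat \<Rightarrow> 'a) \<times> (int \<Rightarrow> real \<times> bool)) measure) X D' J'.
          move_coupling \<Omega>' M \<mu> P S Q F X D' J' \<and>
          path_law \<Omega>' (marked_space S) (marked D' J') = path_law \<Omega> (marked_space S) (marked D J) \<and>
          (AE \<omega> in \<Omega>'. \<forall>m. J' (int m) \<omega> \<and> V (X m \<omega>) \<le> D' (int m) \<omega> \<longrightarrow>
             V (X (m + F (D' (int m) \<omega>)) \<omega>) \<le> D' (int (m + F (D' (int m) \<omega>))) \<omega>))"

end

theory Submission
  imports Defs "HOL-Real_Asymp.Real_Asymp"
begin

text \<open>
  The dominating chain lives on a geometric grid \<open>val k = r ^ (k0 + k)\<close> and moves by
  \<open>k \<mapsto> (k - c) + G\<close> with \<open>G\<close> geometric, \<open>P (G \<ge> j) = r ^ (- j)\<close>. The two drift conditions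
  give \<open>E\<^sub>x V(X\<^sub>F\<^sub>(\<^sub>z\<^sub>)) \<le> \<beta> z + O(z powr \<delta>) \<le> r ^ (- c - 1) z\<close> whenever \<open>V x \<le> z\<close> and \<open>z\<close> is in the grid,
  so by Markov's inequality \<open>V(X\<^sub>F\<^sub>(\<^sub>z\<^sub>))\<close> is stochastically smaller than the next value of the chain.
  The condition on \<open>\<beta>\<close> allows a choice of \<open>r\<close> and \<open>c\<close> for which \<open>z powr \<delta>\<close>, and with it the length
  \<open>F z\<close> of a sojourn, contracts in mean. As all \<open>k \<le> c\<close> form an atom, the occupation measure of a
  cycle is invariant, and weighted by the length of the sojourns it has finite mass. It yields a
  stationary chain of values and ages, which Kolmogorov's theorem extends to all integer times. An
  invariant event is approximated both by events of the past and of the future, which are conditionally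
  independent given a regeneration; hence ergodicity. For the coupling, \<open>X\<close> is run on its own, and each
  move of the dominating process is a function of the value of \<open>X\<close> at the end of the sojourn and an independent
  uniform variable, by a quantile transform.
\<close>

section \<open>Conditional laws\<close>

text \<open>Taming controls \<open>V(X)\<close> only at time \<open>F(V x)\<close>, whereas a
  sojourn of the dominating process lasts \<open>F z\<close> for its own value \<open>z\<close>,
  which may be much larger than \<open>V x\<close>. The weak drift condition bridges the gap: each
  additional step costs at most \<open>|b|\<close> in mean, altogether a term of order
  \<open>z powr \<delta>\<close>, negligible against \<open>z\<close> if the grid starts high
  enough. A countable grid lets finite trajectories be handled as pmfs on lists; its price is one
  factor \<open>1 / r\<close>, lost when \<open>V\<close> is rounded up to the grid. The continuous
  analogue of a jump is a Pareto factor with tail \<open>1 / y\<close>, the shape of the bound in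
  Markov's inequality; its moment of order \<delta> is \<open>1 / (1 - \<delta>)\<close>, and
  \<open>\<beta> powr \<delta> / (1 - \<delta>) < 1\<close> is the condition on \<beta>. In the
  coupling, a move is computed from the end of a segment of \<open>X\<close>, yet must have the jump
  law conditionally on the joint history; hence the transform is taken relative to the law of the
  segment given its starting point. A sojourn in progress at time 0 may have begun before
  \<open>X\<close> did; its end is then drawn from an independent variable, and domination says
  nothing about that move.\<close>

lemma cond_lawI:
  assumes \<Omega>: "prob_space \<Omega>" and H [measurable]: "H \<in> \<Omega> \<rightarrow>\<^sub>M HS" and Y [measurable]: "Y \<in> \<Omega> \<rightarrow>\<^sub>M N"
    and E' [measurable]: "E' \<in> sets HS" and E: "E = H -` E' \<inter> space \<Omega>"
    and \<kappa>' [measurable]: "\<And>B. B \<in> sets N \<Longrightarrow> (\<lambda>h. measure (\<kappa>' h) B) \<in> borel_measurable HS"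
    and \<kappa>: "\<And>\<omega>. \<omega> \<in> E \<Longrightarrow> \<kappa> \<omega> = \<kappa>' (H \<omega>)" "\<And>\<omega>. \<omega> \<in> E \<Longrightarrow> prob_space (\<kappa> \<omega>)"
    and eq: "\<And>A B. A \<in> sets HS \<Longrightarrow> A \<subseteq> E' \<Longrightarrow> B \<in> sets N \<Longrightarrow>
      emeasure \<Omega> {\<omega>\<in>space \<Omega>. H \<omega> \<in> A \<and> Y \<omega> \<in> B} = (\<integral>\<^sup>+\<omega>. indicator A (H \<omega>) * emeasure (\<kappa> \<omega>) B \<partial>\<Omega>)"
  shows "cond_law \<Omega> H HS E Y N \<kappa>"
  unfolding cond_law_def
proof
  fix B assume B [measurable]: "B \<in> sets N"
  interpret prob_space \<Omega> by fact
  let ?F = "vimage_algebra (space \<Omega>) H HS"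
  have space_H: "H \<in> space \<Omega> \<rightarrow> space HS"
    using measurable_space[OF H] by auto
  interpret finite_measure_subalgebra \<Omega> ?F
    by unfold_locales (auto simp: subalgebra_def sets_vimage_algebra2[OF space_H])
  have HF [measurable]: "H \<in> ?F \<rightarrow>\<^sub>M HS"
    using space_H by (rule measurable_vimage_algebra1)
  define g where "g = (\<lambda>h. indicator E' h * measure (\<kappa>' h) B)"
  have [measurable]: "g \<in> borel_measurable HS"
    unfolding g_def by measurable
  have E_iff: "\<omega> \<in> E \<longleftrightarrow> H \<omega> \<in> E'" if "\<omega> \<in> space \<Omega>" for \<omega>
    using that by (auto simp: E)
  have [measurable]: "E \<in> sets \<Omega>" "E \<in> sets ?F"
    unfolding E using measurable_sets[OF H E'] by (auto simp: sets_vimage_algebra2[OF space_H])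
  let ?Y = "indicator (Y -` B \<inter> space \<Omega>) :: _ \<Rightarrow> real"
  have g_bound: "0 \<le> g (H \<omega>) \<and> g (H \<omega>) \<le> 1" if "\<omega> \<in> space \<Omega>" for \<omega>
    using \<kappa>[of \<omega>] prob_space.prob_le_1[of "\<kappa> \<omega>" B] E_iff[OF that]
    by (auto simp: g_def split: split_indicator)
  \<comment> \<open>Only the values on \<open>E\<close> are prescribed, so the conditional
    expectation is first identified for the product with the indicator of \<open>E\<close>; as
    \<open>E\<close> belongs to the history, the indicator then factors out.\<close>
  have "AE \<omega> in \<Omega>. real_cond_exp \<Omega> ?F (\<lambda>\<omega>. indicator E \<omega> * ?Y \<omega>) \<omega> = g (H \<omega>)"
  proof (rule real_cond_exp_charact)
    fix A' assume "A' \<in> sets ?F"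
    then obtain A where A [measurable]: "A \<in> sets HS" and A': "A' = H -` A \<inter> space \<Omega>"
      by (auto simp: sets_vimage_algebra2[OF space_H])
    have "(\<integral>\<omega>\<in>A'. indicator E \<omega> * ?Y \<omega> \<partial>\<Omega>) =
        (\<integral>\<omega>. indicator {\<omega>\<in>space \<Omega>. H \<omega> \<in> A \<inter> E' \<and> Y \<omega> \<in> B} \<omega> \<partial>\<Omega>)"
      unfolding set_lebesgue_integral_def
      by (intro Bochner_Integration.integral_cong refl) (auto simp: A' E split: split_indicator)
    also have "\<dots> = measure \<Omega> {\<omega>\<in>space \<Omega>. H \<omega> \<in> A \<inter> E' \<and> Y \<omega> \<in> B}"
      by (subst Bochner_Integration.integral_indicator) (auto intro!: arg_cong2[where f=measure])
    also have "\<dots> = enn2real (\<integral>\<^sup>+\<omega>. indicator (A \<inter> E') (H \<omega>) * emeasure (\<kappa> \<omega>) B \<partial>\<Omega>)"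
      by (simp only: measure_def) (subst eq, auto)
    also have "(\<integral>\<^sup>+\<omega>. indicator (A \<inter> E') (H \<omega>) * emeasure (\<kappa> \<omega>) B \<partial>\<Omega>) = (\<integral>\<^sup>+\<omega>. ennreal (indicator A' \<omega> * g (H \<omega>)) \<partial>\<Omega>)"
    proof (intro nn_integral_cong)
      fix \<omega> assume \<omega>: "\<omega> \<in> space \<Omega>"
      show "indicator (A \<inter> E') (H \<omega>) * emeasure (\<kappa> \<omega>) B = ennreal (indicator A' \<omega> * g (H \<omega>))"
      proof (cases "\<omega> \<in> E")
        case True
        then interpret k: prob_space "\<kappa> \<omega>" using \<kappa> by auto
        show ?thesis
          using True \<omega> \<kappa>(1)[OF True] k.emeasure_eq_measure[of B]
          by (auto simp: A' g_def E split: split_indicator)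
      qed (use \<omega> in \<open>auto simp: E g_def split: split_indicator\<close>)
    qed
    also have "enn2real \<dots> = (\<integral>\<omega>. indicator A' \<omega> * g (H \<omega>) \<partial>\<Omega>)"
      using g_bound by (intro integral_eq_nn_integral[symmetric])
        (auto simp: A' split: split_indicator)
    finally show "(\<integral>\<omega>\<in>A'. indicator E \<omega> * ?Y \<omega> \<partial>\<Omega>) = (\<integral>\<omega>\<in>A'. g (H \<omega>) \<partial>\<Omega>)"
      by (simp add: set_lebesgue_integral_def)
  next
    show "integrable \<Omega> (\<lambda>\<omega>. indicator E \<omega> * ?Y \<omega>)"
      by (intro integrable_const_bound[where B=1]) (auto split: split_indicator)
    show "integrable \<Omega> (\<lambda>\<omega>. g (H \<omega>))"
      using g_bound by (intro integrable_const_bound[where B=1]) auto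
    show "(\<lambda>\<omega>. g (H \<omega>)) \<in> borel_measurable ?F"
      by measurable
  qed
  moreover have "AE \<omega> in \<Omega>. real_cond_exp \<Omega> ?F (\<lambda>\<omega>. indicator E \<omega> * ?Y \<omega>) \<omega> =
      indicator E \<omega> * real_cond_exp \<Omega> ?F ?Y \<omega>"
    by (intro real_cond_exp_mult integrable_const_bound[where B=1]) (auto split: split_indicator)
  ultimately show "AE \<omega> in \<Omega>. \<omega> \<in> E \<longrightarrow> real_cond_exp \<Omega> ?F ?Y \<omega> = measure (\<kappa> \<omega>) B"
  proof eventually_elim
    case (elim \<omega>)
    then show ?case
      using \<kappa>(1)[of \<omega>] by (auto simp: g_def E)
  qed
qed

text \<open>The exceptional null set depends on the piece, so the pieces must be countably many.
  This lets a conditional law be checked separately for each current state, where the length of the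
  sojourn is constant.\<close>

lemma cond_law_UN:
  assumes "\<And>i :: nat. cond_law \<Omega> H HS (E i) Y N \<kappa>"
  shows "cond_law \<Omega> H HS (\<Union>i. E i) Y N \<kappa>"
  unfolding cond_law_def
proof
  fix B assume "B \<in> sets N"
  then have "\<forall>i. AE \<omega> in \<Omega>. \<omega> \<in> E i \<longrightarrow> real_cond_exp \<Omega> (vimage_algebra (space \<Omega>) H HS) (indicator (Y -` B \<inter> space \<Omega>)) \<omega>
      = measure (\<kappa> \<omega>) B"
    using assms by (simp add: cond_law_def)
  from AE_all_countable[THEN iffD2, OF this] show "AE \<omega> in \<Omega>. \<omega> \<in> (\<Union>i. E i) \<longrightarrow> real_cond_exp \<Omega> (vimage_algebra (space \<Omega>) H HS) (indicator (Y -` B \<inter> space \<Omega>)) \<omega>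
      = measure (\<kappa> \<omega>) B"
    by eventually_elim auto
qed

section \<open>Stationary law of a chain with an atom\<close>

text \<open>\<open>W\<close> is a Lyapunov function that contracts in mean off the atom. Since it
  also bounds the sojourn lengths \<open>f\<close>, the contraction controls a cycle in real time
  and not only in the number of its moves.\<close>

locale atomic_chain =
  fixes q :: "nat \<Rightarrow> nat pmf" and f :: "nat \<Rightarrow> nat" and W :: "nat \<Rightarrow> ennreal"
    and At :: "nat set" and q0 :: "nat pmf" and \<gamma> K :: real
  assumes f_pos: "0 < f k"
    and atom: "k \<in> At \<Longrightarrow> q k = q0"
    and W_finite: "W k < \<infinity>"
    and f_le: "of_nat (f k) \<le> ennreal K * W k"
    and \<gamma>: "0 < \<gamma>" "\<gamma> < 1" and K: "0 < K"
    and drift: "k \<notin> At \<Longrightarrow> (\<integral>\<^sup>+j. W j \<partial>q k) \<le> ennreal \<gamma> * W k"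
    and atom_finite: "(\<integral>\<^sup>+j. W j \<partial>q0) < \<infinity>"
begin

lemma f_ge_1: "(1 :: ennreal) \<le> of_nat (f k)"
  using of_nat_mono[of "Suc 0" "f k", where 'a = ennreal] Suc_leI[OF f_pos[of k]] by auto

text \<open>The chain is killed (\<open>None\<close>) when it leaves the atom \<open>At\<close>, that is, at the end of a cycle.\<close>

definition taboo :: "nat option \<Rightarrow> nat option pmf" where
  "taboo x = (case x of None \<Rightarrow> return_pmf None
     | Some k \<Rightarrow> if k \<in> At then return_pmf None else map_pmf Some (q k))"

primrec taboo_law :: "nat \<Rightarrow> nat option pmf" where
  "taboo_law 0 = map_pmf Some q0"
| "taboo_law (Suc n) = bind_pmf (taboo_law n) taboo"

section \<open>Occupation measure of a cycle\<close>

abbreviation lift :: "(nat \<Rightarrow> ennreal) \<Rightarrow> nat option \<Rightarrow> ennreal" where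
  "lift g x \<equiv> (case x of None \<Rightarrow> 0 | Some k \<Rightarrow> g k)"

text \<open>The integral of \<open>g\<close> against the expected number of visits during a cycle. A
  cycle begins with law \<open>q0\<close>, just after the atom has been left, and includes the next
  visit to the atom.\<close>

definition \<Psi> :: "(nat \<Rightarrow> ennreal) \<Rightarrow> ennreal" where
  "\<Psi> g = (\<Sum>n. \<integral>\<^sup>+x. lift g x \<partial>taboo_law n)"

lemma lift_taboo: "(\<integral>\<^sup>+y. lift g y \<partial>taboo x) = lift (\<lambda>k. if k \<in> At then 0 else \<integral>\<^sup>+j. g j \<partial>q k) x"
  by (auto simp: taboo_def split: option.split)

lemma lift_taboo_law_Suc:
  "(\<integral>\<^sup>+x. lift g x \<partial>taboo_law (Suc n)) = (\<integral>\<^sup>+x. lift (\<lambda>k. if k \<in> At then 0 else \<integral>\<^sup>+j. g j \<partial>q k) x \<partial>taboo_law n)"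
  by (simp add: lift_taboo)

text \<open>Mass in the atom is killed at the next step, so the drift inequality applies to
  everything that survives, and every step contributes a factor \<gamma>.\<close>

lemma taboo_law_W: "(\<integral>\<^sup>+x. lift W x \<partial>taboo_law n) \<le> ennreal (\<gamma> ^ n) * (\<integral>\<^sup>+j. W j \<partial>q0)"
proof (induction n)
  case (Suc n)
  have "(\<integral>\<^sup>+x. lift W x \<partial>taboo_law (Suc n)) \<le> (\<integral>\<^sup>+x. ennreal \<gamma> * lift W x \<partial>taboo_law n)"
    unfolding lift_taboo_law_Suc by (intro nn_integral_mono) (auto split: option.split simp: drift)
  also have "\<dots> = ennreal \<gamma> * (\<integral>\<^sup>+x. lift W x \<partial>taboo_law n)"
    by (simp add: nn_integral_cmult)
  also have "\<dots> \<le> ennreal \<gamma> * (ennreal (\<gamma> ^ n) * (\<integral>\<^sup>+j. W j \<partial>q0))"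
    by (intro mult_left_mono Suc) auto
  also have "\<dots> = ennreal (\<gamma> ^ Suc n) * (\<integral>\<^sup>+j. W j \<partial>q0)"
    using \<gamma> by (simp add: ennreal_mult mult.assoc)
  finally show ?case .
qed simp

lemma \<Psi>_W: "\<Psi> W < \<infinity>"
proof -
  have "\<Psi> W \<le> (\<Sum>n. ennreal (\<gamma> ^ n) * (\<integral>\<^sup>+j. W j \<partial>q0))"
    unfolding \<Psi>_def by (intro suminf_le taboo_law_W) auto
  also have "\<dots> = (\<Sum>n. ennreal (\<gamma> ^ n)) * (\<integral>\<^sup>+j. W j \<partial>q0)"
    by simp
  also have "(\<Sum>n. ennreal (\<gamma> ^ n)) = ennreal (1 / (1 - \<gamma>))"
    using \<gamma> by (intro suminf_ennreal_eq geometric_sums) auto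
  also have "ennreal (1 / (1 - \<gamma>)) * (\<integral>\<^sup>+j. W j \<partial>q0) < \<infinity>"
    using atom_finite by (simp add: ennreal_mult_less_top)
  finally show ?thesis .
qed

text \<open>The mean length of a cycle in real time; its finiteness is what makes the equilibrium of
  the paused chain a probability law.\<close>

lemma \<Psi>_f: "\<Psi> (\<lambda>k. of_nat (f k)) < \<infinity>"
proof -
  have "\<Psi> (\<lambda>k. of_nat (f k)) \<le> (\<Sum>n. ennreal K * (\<integral>\<^sup>+x. lift W x \<partial>taboo_law n))"
    unfolding \<Psi>_def
    by (intro suminf_le)
       (auto simp: nn_integral_cmult[symmetric] f_le intro!: nn_integral_mono split: option.split)
  also have "\<dots> = ennreal K * \<Psi> W"
    unfolding \<Psi>_def by simp
  also have "\<dots> < \<infinity>"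
    using \<Psi>_W by (simp add: ennreal_mult_less_top)
  finally show ?thesis .
qed

lemma \<Psi>_add: "\<Psi> (\<lambda>k. g k + h k) = \<Psi> g + \<Psi> h"
proof -
  have "(\<integral>\<^sup>+x. lift (\<lambda>k. g k + h k) x \<partial>taboo_law n) = (\<integral>\<^sup>+x. lift g x \<partial>taboo_law n) + (\<integral>\<^sup>+x. lift h x \<partial>taboo_law n)" for n
    by (subst nn_integral_add[symmetric]) (auto intro!: nn_integral_cong split: option.split)
  then show ?thesis
    unfolding \<Psi>_def by (simp add: suminf_add)
qed

lemma taboo_law_None_Suc: "emeasure (taboo_law (Suc n)) {None} = emeasure (taboo_law n) {None} + emeasure (taboo_law n) (Some ` At)"
proof -
  have "emeasure (taboo_law (Suc n)) {None} = (\<integral>\<^sup>+x. emeasure (taboo x) {None} \<partial>taboo_law n)"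
    by simp
  also have "\<dots> = (\<integral>\<^sup>+x. indicator ({None} \<union> Some ` At) x \<partial>taboo_law n)"
    by (intro nn_integral_cong)
       (auto simp: taboo_def vimage_def split: option.split split_indicator)
  also have "\<dots> = emeasure (taboo_law n) {None} + emeasure (taboo_law n) (Some ` At)"
    by (subst nn_integral_indicator, simp, subst plus_emeasure) auto
  finally show ?thesis .
qed

text \<open>A cycle visits the atom exactly once, at its end, and it does end: the partial sums are
  the probabilities of having been killed, while the mass still alive is at most of order
  \<open>\<gamma> ^ n\<close> because \<open>1 \<le> K * W\<close>.\<close>

lemma sum_taboo_law_At: "(\<Sum>n. emeasure (taboo_law n) (Some ` At)) = 1"
proof -
  have partial: "(\<Sum>i<n. emeasure (taboo_law i) (Some ` At)) = emeasure (taboo_law n) {None}" for n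
  proof (induction n)
    case 0
    have "emeasure (taboo_law 0) {None} = 0"
      by (simp add: vimage_def)
    then show ?case by simp
  next
    case (Suc n)
    then show ?case
      by (simp only: taboo_law_None_Suc sum.lessThan_Suc)
  qed
  have lim: "(\<lambda>n. ennreal (K * enn2real (\<integral>\<^sup>+j. W j \<partial>q0) * \<gamma> ^ n)) \<longlonglongrightarrow> ennreal (K * enn2real (\<integral>\<^sup>+j. W j \<partial>q0) * 0)"
    using \<gamma> by (intro tendsto_ennrealI tendsto_mult_left LIMSEQ_power_zero) auto
  have bound: "emeasure (taboo_law n) (- {None}) \<le> ennreal (K * enn2real (\<integral>\<^sup>+j. W j \<partial>q0) * \<gamma> ^ n)" for n
  proof -
    have "emeasure (taboo_law n) (- {None}) = (\<integral>\<^sup>+x. indicator (- {None}) x \<partial>taboo_law n)"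
      by simp
    also have "\<dots> \<le> (\<integral>\<^sup>+x. ennreal K * lift W x \<partial>taboo_law n)"
    proof (intro nn_integral_mono)
      fix x show "indicator (- {None}) x \<le> ennreal K * lift W x"
        using order_trans[OF f_ge_1 f_le] by (cases x) auto
    qed
    also have "\<dots> = ennreal K * (\<integral>\<^sup>+x. lift W x \<partial>taboo_law n)"
      by (simp add: nn_integral_cmult)
    also have "\<dots> \<le> ennreal K * (ennreal (\<gamma> ^ n) * (\<integral>\<^sup>+j. W j \<partial>q0))"
      by (intro mult_left_mono taboo_law_W) auto
    also have "\<dots> = ennreal (K * (\<gamma> ^ n * enn2real (\<integral>\<^sup>+j. W j \<partial>q0)))"
    proof -
      have "(\<integral>\<^sup>+j. W j \<partial>q0) = ennreal (enn2real (\<integral>\<^sup>+j. W j \<partial>q0))"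
        using atom_finite by simp
      then show ?thesis
        using K \<gamma> by (metis ennreal_mult enn2real_nonneg less_imp_le mult_nonneg_nonneg zero_le_power)
    qed
    also have "K * (\<gamma> ^ n * enn2real (\<integral>\<^sup>+j. W j \<partial>q0)) = K * enn2real (\<integral>\<^sup>+j. W j \<partial>q0) * \<gamma> ^ n"
      by simp
    finally show ?thesis .
  qed
  have "(\<lambda>n. emeasure (taboo_law n) (- {None})) \<longlonglongrightarrow> ennreal (K * enn2real (\<integral>\<^sup>+j. W j \<partial>q0) * 0)"
  proof (rule tendsto_sandwich[OF _ _ tendsto_const lim])
    show "\<forall>\<^sub>F n in sequentially. ennreal (K * enn2real (\<integral>\<^sup>+j. W j \<partial>q0) * 0) \<le> emeasure (taboo_law n) (- {None})"
      by (simp only: mult_zero_right ennreal_0 zero_le eventually_True)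
    show "\<forall>\<^sub>F n in sequentially. emeasure (taboo_law n) (- {None}) \<le> ennreal (K * enn2real (\<integral>\<^sup>+j. W j \<partial>q0) * \<gamma> ^ n)"
      by (intro always_eventually allI bound)
  qed
  then have "(\<lambda>n. emeasure (taboo_law n) (- {None})) \<longlonglongrightarrow> 0"
    by (simp only: mult_zero_right ennreal_0)
  then have "(\<lambda>n. 1 - emeasure (taboo_law n) (- {None})) \<longlonglongrightarrow> 1 - 0"
    by (rule tendsto_diff_ennreal_general[OF tendsto_const]) simp
  moreover have "1 - emeasure (taboo_law n) (- {None}) = emeasure (taboo_law n) {None}" for n
    using emeasure_compl[of "- {None}" "taboo_law n"]
    by (simp add: Compl_eq_Diff_UNIV[symmetric] measure_pmf.emeasure_space_1[simplified])
  ultimately have "(\<lambda>n. \<Sum>i<n. emeasure (taboo_law i) (Some ` At)) \<longlonglongrightarrow> 1"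
    by (simp add: partial)
  then show ?thesis
    by (intro sums_unique[symmetric]) (simp add: sums_def)
qed

text \<open>One application of the kernel shifts the cycle by one step. The term at time 0 is lost,
  but the visits to the atom, of total mass 1, jump with law \<open>q0\<close> and restore
  it.\<close>

lemma \<Psi>_invariant: "\<Psi> (\<lambda>k. \<integral>\<^sup>+j. g j \<partial>q k) = \<Psi> g"
proof -
  have *: "(\<integral>\<^sup>+x. lift (\<lambda>k. \<integral>\<^sup>+j. g j \<partial>q k) x \<partial>taboo_law n) =
      (\<integral>\<^sup>+j. g j \<partial>q0) * emeasure (taboo_law n) (Some ` At) + (\<integral>\<^sup>+x. lift g x \<partial>taboo_law (Suc n))" for n
    unfolding lift_taboo_law_Suc
    by (subst nn_integral_cmult_indicator[symmetric], simp, subst nn_integral_add[symmetric])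
       (auto intro!: nn_integral_cong simp: atom split: option.split split_indicator)
  have "\<Psi> (\<lambda>k. \<integral>\<^sup>+j. g j \<partial>q k) = (\<integral>\<^sup>+j. g j \<partial>q0) * (\<Sum>n. emeasure (taboo_law n) (Some ` At))
      + (\<Sum>n. \<integral>\<^sup>+x. lift g x \<partial>taboo_law (Suc n))"
    unfolding \<Psi>_def * by (subst suminf_add[symmetric]) auto
  also have "\<dots> = (\<Sum>n<1. \<integral>\<^sup>+x. lift g x \<partial>taboo_law n) + (\<Sum>n. \<integral>\<^sup>+x. lift g x \<partial>taboo_law (n + 1))"
    by (simp add: sum_taboo_law_At del: taboo_law.simps) (simp)
  also have "\<dots> = \<Psi> g"
    unfolding \<Psi>_def by (subst add.commute, subst suminf_offset[symmetric]) auto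
  finally show ?thesis .
qed

definition \<psi> :: "nat \<Rightarrow> ennreal" where
  "\<psi> k = (\<Sum>n. ennreal (pmf (taboo_law n) (Some k)))"

lemma \<Psi>_eq: "\<Psi> g = (\<integral>\<^sup>+k. \<psi> k * g k \<partial>count_space UNIV)"
proof -
  have "(\<integral>\<^sup>+x. lift g x \<partial>taboo_law n) = (\<integral>\<^sup>+k. ennreal (pmf (taboo_law n) (Some k)) * g k \<partial>count_space UNIV)" for n
  proof -
    have "(\<integral>\<^sup>+x. lift g x \<partial>taboo_law n) = (\<integral>\<^sup>+x. ennreal (pmf (taboo_law n) x) * lift g x \<partial>count_space UNIV)"
      by (rule nn_integral_measure_pmf)
    also have "\<dots> = (\<integral>\<^sup>+x. ennreal (pmf (taboo_law n) x) * lift g x \<partial>count_space (range Some))"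
      by (rule nn_integral_count_space_eq) (auto split: option.split simp: notin_range_Some)
    also have "\<dots> = (\<integral>\<^sup>+k. ennreal (pmf (taboo_law n) (Some k)) * g k \<partial>count_space UNIV)"
      by (subst nn_integral_bij_count_space[symmetric, of Some UNIV]) (auto simp: bij_betw_def)
    finally show ?thesis .
  qed
  then show ?thesis
    unfolding \<Psi>_def \<psi>_def
    by (simp add: ennreal_suminf_multc[symmetric] nn_integral_suminf del: ennreal_suminf_multc)
qed

section \<open>Equilibrium law of values and ages\<close>

definition Z\<^sub>0 :: ennreal where "Z\<^sub>0 = \<Psi> (\<lambda>k. of_nat (f k))"

lemma Z\<^sub>0_finite: "Z\<^sub>0 < \<infinity>" and Z\<^sub>0_pos: "Z\<^sub>0 > 0"
proof -
  show "Z\<^sub>0 < \<infinity>"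
    using \<Psi>_f by (simp add: Z\<^sub>0_def)
  have "1 = (\<integral>\<^sup>+x. lift (\<lambda>k. 1) x \<partial>taboo_law 0)"
    by (simp add: measure_pmf.emeasure_space_1[simplified])
  also have "\<dots> \<le> (\<integral>\<^sup>+x. lift (\<lambda>k. of_nat (f k)) x \<partial>taboo_law 0)"
  proof (rule nn_integral_mono)
    fix x show "lift (\<lambda>k. 1) x \<le> lift (\<lambda>k. of_nat (f k)) x"
      by (cases x) (simp_all only: option.case f_ge_1 order_refl)
  qed
  also have "\<dots> = (\<Sum>n<1. \<integral>\<^sup>+x. lift (\<lambda>k. of_nat (f k)) x \<partial>taboo_law n)"
    by (simp)
  also have "\<dots> \<le> Z\<^sub>0"
    unfolding Z\<^sub>0_def \<Psi>_def by (intro sum_le_suminf) auto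
  finally show "Z\<^sub>0 > 0"
    using zero_less_one by (metis less_le_trans)
qed

text \<open>Each of the \<open>f k\<close> ages of a sojourn in \<open>k\<close> gets the same
  weight, so the occupation measure is weighted by sojourn lengths: this turns an equilibrium
  counted per move into one counted per unit of time.\<close>

definition \<pi>w :: "nat \<times> nat \<Rightarrow> real" where
  "\<pi>w s = (if snd s < f (fst s) then enn2real (\<psi> (fst s) / Z\<^sub>0) else 0)"

lemma \<psi>_finite: "\<psi> k < \<infinity>"
proof -
  have "\<psi> k * of_nat (f k) \<le> Z\<^sub>0"
    unfolding Z\<^sub>0_def \<Psi>_eq
    using nn_integral_ge_point[of k UNIV "\<lambda>k. \<psi> k * of_nat (f k)"] by simp
  then show ?thesis
    using Z\<^sub>0_finite f_pos[of k] by (auto simp: ennreal_mult_less_top less_top[symmetric] top_unique ennreal_top_mult)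
qed

lemma ennreal_\<pi>w: "ennreal (\<pi>w (k, a)) = (if a < f k then \<psi> k / Z\<^sub>0 else 0)"
proof -
  have "\<psi> k / Z\<^sub>0 < top"
    using \<psi>_finite[of k] Z\<^sub>0_pos by (metis ennreal_divide_eq_top_iff infinity_ennreal_def less_irrefl less_top)
  then show ?thesis
    by (simp add: \<pi>w_def)
qed

lemma integral_\<pi>w:
  "(\<integral>\<^sup>+s. ennreal (\<pi>w s) * h s \<partial>count_space UNIV) = \<Psi> (\<lambda>k. \<Sum>a<f k. h (k, a)) / Z\<^sub>0"
proof -
  have "(\<integral>\<^sup>+s. ennreal (\<pi>w s) * h s \<partial>count_space UNIV) =
      (\<integral>\<^sup>+k. \<integral>\<^sup>+a. ennreal (\<pi>w (k, a)) * h (k, a) \<partial>count_space UNIV \<partial>count_space UNIV)"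
    by (rule nn_integral_fst_count_space[symmetric])
  also have "\<dots> = (\<integral>\<^sup>+k. \<psi> k * (\<Sum>a<f k. h (k, a)) / Z\<^sub>0 \<partial>count_space UNIV)"
  proof (rule nn_integral_cong)
    fix k
    have "(\<integral>\<^sup>+a. ennreal (\<pi>w (k, a)) * h (k, a) \<partial>count_space UNIV) =
        (\<integral>\<^sup>+a. \<psi> k / Z\<^sub>0 * h (k, a) \<partial>count_space {..<f k})"
      unfolding ennreal_\<pi>w
      by (subst (2) nn_integral_count_space_indicator)
         (auto intro!: nn_integral_cong split: split_indicator)
    then show "(\<integral>\<^sup>+a. ennreal (\<pi>w (k, a)) * h (k, a) \<partial>count_space UNIV) = \<psi> k * (\<Sum>a<f k. h (k, a)) / Z\<^sub>0"
      by (simp add: nn_integral_count_space_finite sum_distrib_left[symmetric])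
         (simp add: divide_ennreal_def sum_distrib_right[symmetric] mult_ac)
  qed
  also have "\<dots> = \<Psi> (\<lambda>k. \<Sum>a<f k. h (k, a)) / Z\<^sub>0"
    unfolding \<Psi>_eq by (rule nn_integral_divide) simp
  finally show ?thesis .
qed

definition \<pi> :: "(nat \<times> nat) pmf" where "\<pi> = embed_pmf \<pi>w"

lemma pmf_\<pi>: "pmf \<pi> s = \<pi>w s"
  unfolding \<pi>_def
proof (rule pmf_embed_pmf)
  show "0 \<le> \<pi>w x" for x by (simp add: \<pi>w_def)
  show "(\<integral>\<^sup>+x. ennreal (\<pi>w x) \<partial>count_space UNIV) = 1"
    using integral_\<pi>w[of "\<lambda>_. 1"] Z\<^sub>0_pos Z\<^sub>0_finite by (simp add: Z\<^sub>0_def[symmetric] ennreal_divide_self)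
qed

lemma integral_\<pi>: "(\<integral>\<^sup>+s. h s \<partial>\<pi>) = \<Psi> (\<lambda>k. \<Sum>a<f k. h (k, a)) / Z\<^sub>0"
  by (simp add: nn_integral_measure_pmf pmf_\<pi> integral_\<pi>w)

text \<open>
  A state of the paused chain is a pair \<open>(k, a)\<close>: the index \<open>k\<close> of the current value and the time \<open>a\<close>
  elapsed since the last move.
\<close>

definition step :: "nat \<times> nat \<Rightarrow> (nat \<times> nat) pmf" where
  "step s = (if Suc (snd s) < f (fst s) then return_pmf (fst s, Suc (snd s))
     else map_pmf (\<lambda>k. (k, 0)) (q (fst s)))"

text \<open>A step raises every age but the last by one. What is then missing, the mass at age 0, is
  supplied by the completed sojourns; the two agree because the occupation measure is invariant
  under \<open>q\<close>.\<close>

lemma \<pi>_invariant: "bind_pmf \<pi> step = \<pi>"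
proof -
  have *: "(\<Sum>a<f k. \<integral>\<^sup>+s. h s \<partial>step (k, a)) = (\<Sum>a\<in>{1..<f k}. h (k, a)) + (\<integral>\<^sup>+j. h (j, 0) \<partial>q k)" for h k
  proof -
    obtain n where n: "f k = Suc n"
      using f_pos[of k] by (cases "f k") auto
    have "(\<Sum>a<f k. \<integral>\<^sup>+s. h s \<partial>step (k, a)) = (\<Sum>a<n. h (k, Suc a)) + (\<integral>\<^sup>+j. h (j, 0) \<partial>q k)"
      by (simp add: n step_def)
    also have "(\<Sum>a<n. h (k, Suc a)) = (\<Sum>a\<in>{1..<f k}. h (k, a))"
      unfolding n by (rule sum.reindex_bij_witness[of _ "\<lambda>a. a - 1" Suc]) auto
    finally show ?thesis .
  qed
  have **: "(\<Sum>a<f k. h (k, a)) = (\<Sum>a\<in>{1..<f k}. h (k, a)) + h (k, 0)" for h :: "nat \<times> nat \<Rightarrow> ennreal" and k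
    using f_pos[of k] by (subst add.commute, subst lessThan_atLeast0, subst sum.atLeast_Suc_lessThan) auto
  have "(\<integral>\<^sup>+s. h s \<partial>bind_pmf \<pi> step) = (\<integral>\<^sup>+s. h s \<partial>\<pi>)" for h
    by (simp add: integral_\<pi> * ** \<Psi>_add \<Psi>_invariant)
  from this[of "indicator {s}" for s] show ?thesis
    by (intro pmf_eqI) (simp del: nn_integral_bind_pmf emeasure_bind_pmf add: emeasure_pmf_single)
qed

end

section \<open>Trajectories\<close>

context atomic_chain begin

text \<open>The starting state is left out of the list, so that successive walks are joined by plain
  concatenation.\<close>

primrec walk :: "nat \<Rightarrow> nat \<times> nat \<Rightarrow> (nat \<times> nat) list pmf" where
  "walk 0 s = return_pmf []"
| "walk (Suc n) s = bind_pmf (step s) (\<lambda>s'. map_pmf ((#) s') (walk n s'))"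

definition traj :: "nat \<Rightarrow> (nat \<times> nat) list pmf" where
  "traj n = bind_pmf \<pi> (\<lambda>s. map_pmf ((#) s) (walk n s))"

lemma append_Cons_fun: "(@) (x # xs) = (\<lambda>l. x # xs @ l)" and append_Nil_fun: "(@) [] = (\<lambda>l. l)"
  by (auto simp: fun_eq_iff)

lemma walk_add:
  "walk (m + n) s = bind_pmf (walk m s) (\<lambda>l. map_pmf ((@) l) (walk n (last (s # l))))"
  by (induction m arbitrary: s)
     (simp_all add: bind_return_pmf map_bind_pmf bind_map_pmf bind_assoc_pmf map_pmf_comp append_Cons_fun append_Nil_fun)

lemma length_walk: "l \<in> set_pmf (walk n s) \<Longrightarrow> length l = n"
  by (induction n arbitrary: s l) auto

lemma length_traj: "l \<in> set_pmf (traj n) \<Longrightarrow> length l = Suc n"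
  using length_walk by (auto simp: traj_def)

lemma traj_add:
  "traj (m + n) = bind_pmf (traj m) (\<lambda>l. map_pmf ((@) l) (walk n (last l)))"
  by (simp add: traj_def walk_add map_bind_pmf bind_map_pmf bind_assoc_pmf map_pmf_comp append_Cons_fun)

lemma traj_Suc: "traj (Suc n) = bind_pmf (traj n) (\<lambda>l. map_pmf (\<lambda>s. l @ [s]) (step (last l)))"
  using traj_add[of n 1] by (simp add: map_pmf_comp map_pmf_def[symmetric])

lemma take_traj: "map_pmf (take (Suc m)) (traj (m + n)) = traj m"
proof -
  have "map_pmf (take (Suc m)) (traj (m + n)) = bind_pmf (traj m) (\<lambda>l. map_pmf (\<lambda>l'. take (Suc m) (l @ l')) (walk n (last l)))"
    by (simp add: traj_add map_bind_pmf map_pmf_comp)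
  also have "\<dots> = bind_pmf (traj m) (\<lambda>l. map_pmf (\<lambda>l'. l) (walk n (last l)))"
    by (intro bind_pmf_cong refl) (simp add: length_traj)
  finally show ?thesis
    by (simp add: map_pmf_const bind_return_pmf')
qed

text \<open>Stationarity of \<open>\<pi>\<close> enters the path laws here: without its first state,
  a trajectory starts from \<open>bind_pmf \<pi> step\<close>, which is \<open>\<pi>\<close>
  again.\<close>

lemma tl_traj: "map_pmf tl (traj (Suc n)) = traj n"
proof -
  have "map_pmf tl (traj (Suc n)) = bind_pmf \<pi> (\<lambda>s. walk (Suc n) s)"
    by (simp add: traj_def map_bind_pmf map_pmf_comp del: walk.simps)
  also have "\<dots> = bind_pmf (bind_pmf \<pi> step) (\<lambda>s. map_pmf ((#) s) (walk n s))"
    by (simp add: bind_assoc_pmf)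
  finally show ?thesis
    by (simp add: \<pi>_invariant traj_def)
qed

lemma drop_traj: "map_pmf (drop m) (traj (m + n)) = traj n"
proof (induction m)
  case 0
  then show ?case by (simp add: pmf.map_id id_def[symmetric])
next
  case (Suc m)
  have "map_pmf (drop (Suc m)) (traj (Suc m + n)) = map_pmf (drop m) (map_pmf tl (traj (Suc (m + n))))"
    by (simp add: map_pmf_comp drop_Suc[abs_def] del: walk.simps)
  then show ?case
    by (simp add: tl_traj Suc)
qed

section \<open>Processes all of whose windows are stationary trajectories\<close>

definition window :: "(int \<Rightarrow> 'w \<Rightarrow> nat \<times> nat) \<Rightarrow> int \<Rightarrow> nat \<Rightarrow> 'w \<Rightarrow> (nat \<times> nat) list" where
  "window Z lo n \<omega> = map (\<lambda>i. Z (lo + int i) \<omega>) [0..<Suc n]"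

text \<open>All that is ever needed of the two-sided process. Stating it for an arbitrary sample
  space lets the same results serve the extension of the finite-dimensional laws and the process
  built in the coupling.\<close>

definition runs :: "'w measure \<Rightarrow> (int \<Rightarrow> 'w \<Rightarrow> nat \<times> nat) \<Rightarrow> bool" where
  "runs \<Omega> Z \<longleftrightarrow> prob_space \<Omega> \<and> (\<forall>n. Z n \<in> \<Omega> \<rightarrow>\<^sub>M count_space UNIV) \<and>
     (\<forall>lo n. distr \<Omega> (count_space UNIV) (window Z lo n) = measure_pmf (traj n))"

lemma length_window [simp]: "length (window Z lo n \<omega>) = Suc n"
  by (simp add: window_def)

lemma nth_window: "i \<le> n \<Longrightarrow> window Z lo n \<omega> ! i = Z (lo + int i) \<omega>"
  by (simp add: window_def del: upt_Suc)

lemma window_eq_iff: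
  "window Z lo n \<omega> = l \<longleftrightarrow> length l = Suc n \<and> (\<forall>i\<le>n. Z (lo + int i) \<omega> = l ! i)"
  by (auto simp: list_eq_iff_nth_eq nth_window less_Suc_eq_le)

lemma measurable_window [measurable]:
  assumes [measurable]: "\<And>n. Z n \<in> \<Omega> \<rightarrow>\<^sub>M count_space UNIV"
  shows "window Z lo n \<in> \<Omega> \<rightarrow>\<^sub>M count_space UNIV"
proof (rule measurable_count_space_eq2_countable[THEN iffD2], intro conjI ballI)
  fix l :: "(nat \<times> nat) list"
  have "window Z lo n -` {l} \<inter> space \<Omega> = {\<omega>\<in>space \<Omega>. length l = Suc n \<and> (\<forall>i\<le>n. Z (lo + int i) \<omega> = l ! i)}"
    by (simp add: vimage_def window_eq_iff Int_def conj_commute)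
  also have "\<dots> \<in> sets \<Omega>" by measurable
  finally show "window Z lo n -` {l} \<inter> space \<Omega> \<in> sets \<Omega>" .
qed auto

lemma drop_window: "drop m (window Z lo (m + n) \<omega>) = window Z (lo + int m) n \<omega>"
  by (rule nth_equalityI) (auto simp: nth_window ac_simps)

lemma take_window: "take (Suc m) (window Z lo (m + n) \<omega>) = window Z lo m \<omega>"
  by (rule nth_equalityI) (auto simp: nth_window)

lemma last_window: "last (window Z lo n \<omega>) = Z (lo + int n) \<omega>"
  by (subst last_conv_nth) (auto simp: nth_window simp flip: length_0_conv)

text \<open>Any window is cut out of one that contains time 0, and the laws of trajectories are
  consistent under cutting at either end. Windows of this special form can be extended to the right
  by induction.\<close>

lemma runsI:
  assumes "prob_space \<Omega>" and Z [measurable]: "\<And>n. Z n \<in> \<Omega> \<rightarrow>\<^sub>M count_space UNIV"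
    and windows: "\<And>m n. distr \<Omega> (count_space UNIV) (window Z (- int m) (m + n)) = measure_pmf (traj (m + n))"
  shows "runs \<Omega> Z"
  unfolding runs_def
proof (intro conjI allI)
  fix lo :: int and n :: nat
  define m where "m = nat \<bar>lo\<bar>"
  define d where "d = nat (lo + int m)"
  have lo: "lo = - int m + int d"
    by (simp add: m_def d_def)
  have "distr \<Omega> (count_space UNIV) (window Z lo n) =
      distr (distr \<Omega> (count_space UNIV) (window Z (- int m) (m + (d + n)))) (count_space UNIV)
        (\<lambda>l. drop d (take (Suc (d + n)) l))"
    using take_window[of "d + n" Z "- int m" m] drop_window[of d Z "- int m" n]
    by (subst distr_distr) (auto simp: comp_def lo ac_simps)
  also have "\<dots> = measure_pmf (map_pmf (\<lambda>l. drop d (take (Suc (d + n)) l)) (traj (m + (d + n))))"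
    by (simp add: windows map_pmf_rep_eq)
  also have "map_pmf (\<lambda>l. drop d (take (Suc (d + n)) l)) (traj (m + (d + n))) = traj n"
    using take_traj[of "d + n" m] by (simp add: map_pmf_comp[symmetric] drop_traj ac_simps)
  finally show "distr \<Omega> (count_space UNIV) (window Z lo n) = measure_pmf (traj n)" .
qed (use assms in auto)

lemma runs_prob_window:
  assumes "runs \<Omega> Z"
  shows "emeasure \<Omega> {\<omega>\<in>space \<Omega>. window Z lo n \<omega> \<in> B} = emeasure (traj n) B"
proof -
  have [measurable]: "Z n \<in> \<Omega> \<rightarrow>\<^sub>M count_space UNIV" for n
    using assms by (auto simp: runs_def)
  have "emeasure (traj n) B = emeasure (distr \<Omega> (count_space UNIV) (window Z lo n)) B"
    using assms by (simp add: runs_def)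
  also have "\<dots> = emeasure \<Omega> {\<omega>\<in>space \<Omega>. window Z lo n \<omega> \<in> B}"
    by (subst emeasure_distr) (auto simp: vimage_def Int_def conj_commute)
  finally show ?thesis ..
qed

lemma runs_shift: "runs \<Omega> Z \<Longrightarrow> runs \<Omega> (\<lambda>n. Z (n + m))"
proof -
  have "window (\<lambda>n. Z (n + m)) lo n = window Z (lo + m) n" for lo n
    by (simp add: window_def fun_eq_iff ac_simps)
  moreover assume "runs \<Omega> Z"
  ultimately show ?thesis
    by (simp add: runs_def)
qed

lemma runs_pullback:
  assumes "runs \<Omega> Z" and T: "T \<in> \<Omega>' \<rightarrow>\<^sub>M \<Omega>" and "distr \<Omega>' \<Omega> T = \<Omega>"
  shows "runs \<Omega>' (\<lambda>n \<omega>. Z n (T \<omega>))"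
proof -
  have [measurable]: "Z n \<in> \<Omega> \<rightarrow>\<^sub>M count_space UNIV" for n
    using assms by (auto simp: runs_def)
  note [measurable] = T
  have "distr \<Omega>' (count_space UNIV) (window (\<lambda>n \<omega>. Z n (T \<omega>)) lo n) = measure_pmf (traj n)" for lo n
  proof -
    have "window (\<lambda>n \<omega>. Z n (T \<omega>)) lo n = window Z lo n \<circ> T"
      by (auto simp: window_def)
    then have "distr \<Omega>' (count_space UNIV) (window (\<lambda>n \<omega>. Z n (T \<omega>)) lo n) =
        distr (distr \<Omega>' \<Omega> T) (count_space UNIV) (window Z lo n)"
      by (subst distr_distr) auto
    then show ?thesis
      using assms by (simp add: runs_def)
  qed
  then show ?thesis
    using assms by (auto simp: runs_def intro: prob_space_distrD[OF T])
qed

text \<open>Finitely many times fit into a symmetric window, so \<open>traj\<close> determines all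
  cylinder probabilities. It identifies the copy inside the coupling with the original process, and
  yields stationarity.\<close>

lemma runs_path_unique:
  assumes "runs \<Omega> Z" and "runs \<Omega>' Z'"
  shows "distr \<Omega> (Pi\<^sub>M UNIV (\<lambda>_. count_space UNIV)) (\<lambda>\<omega> n. Z n \<omega>) =
    distr \<Omega>' (Pi\<^sub>M UNIV (\<lambda>_. count_space UNIV)) (\<lambda>\<omega> n. Z' n \<omega>)" (is "?l = ?r")
proof (rule measure_eqI_PiM_infinite)
  have cyl: "emeasure (distr \<Omega> (Pi\<^sub>M UNIV (\<lambda>_. count_space UNIV)) (\<lambda>\<omega> n. Z n \<omega>))
      (prod_emb UNIV (\<lambda>_. count_space UNIV) J (Pi\<^sub>E J A)) =
      emeasure (traj (2 * N)) {l. \<forall>i\<in>J. l ! nat (i + int N) \<in> A i}"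
    if "runs \<Omega> Z" "finite J" "J \<subseteq> {- int N..int N}" for \<Omega> and Z :: "int \<Rightarrow> 'x \<Rightarrow> nat \<times> nat" and J A N
  proof -
    have [measurable]: "Z n \<in> \<Omega> \<rightarrow>\<^sub>M count_space UNIV" for n
      using that by (auto simp: runs_def)
    have [measurable]: "prod_emb UNIV (\<lambda>_. count_space UNIV) J (Pi\<^sub>E J A) \<in> sets (Pi\<^sub>M UNIV (\<lambda>_. count_space UNIV))"
      using that by (intro sets_PiM_I) auto
    have "emeasure (distr \<Omega> (Pi\<^sub>M UNIV (\<lambda>_. count_space UNIV)) (\<lambda>\<omega> n. Z n \<omega>))
        (prod_emb UNIV (\<lambda>_. count_space UNIV) J (Pi\<^sub>E J A)) = emeasure \<Omega> {\<omega>\<in>space \<Omega>. \<forall>i\<in>J. Z i \<omega> \<in> A i}"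
      using that by (subst emeasure_distr)
        (simp_all add: measurable_PiM_single', auto intro!: arg_cong2[where f=emeasure]
          simp: prod_emb_def PiE_iff)
    also have "\<dots> = emeasure \<Omega> {\<omega>\<in>space \<Omega>. window Z (- int N) (2 * N) \<omega> \<in> {l. \<forall>i\<in>J. l ! nat (i + int N) \<in> A i}}"
    proof -
      have "window Z (- int N) (2 * N) \<omega> ! nat (i + int N) = Z i \<omega>" if "i \<in> J" for i \<omega>
      proof -
        have "- int N \<le> i" "i \<le> int N"
          using \<open>i \<in> J\<close> \<open>J \<subseteq> _\<close> by auto
        then show ?thesis
          by (subst nth_window) auto
      qed
      then show ?thesis
        by (intro arg_cong2[where f=emeasure] refl) auto
    qed
    also have "\<dots> = emeasure (traj (2 * N)) {l. \<forall>i\<in>J. l ! nat (i + int N) \<in> A i}"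
      by (rule runs_prob_window) fact
    finally show ?thesis .
  qed
  fix A :: "int \<Rightarrow> (nat \<times> nat) set" and J :: "int set"
  assume J: "finite J"
  then obtain N where N: "J \<subseteq> {- int N..int N}"
  proof -
    have "J \<subseteq> {- int (nat (Max (abs ` J)))..int (nat (Max (abs ` J)))}"
    proof
      fix i assume "i \<in> J"
      then have "\<bar>i\<bar> \<le> Max (abs ` J)" using J by auto
      then show "i \<in> {- int (nat (Max (abs ` J)))..int (nat (Max (abs ` J)))}" by auto
    qed
    then show ?thesis ..
  qed
  show "emeasure ?l (prod_emb UNIV (\<lambda>_. count_space UNIV) J (Pi\<^sub>E J A)) =
      emeasure ?r (prod_emb UNIV (\<lambda>_. count_space UNIV) J (Pi\<^sub>E J A))"
    using cyl[OF assms(1) J N, of A] cyl[OF assms(2) J N, of A] by simp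
next
  have "prob_space \<Omega>" "(\<lambda>\<omega> n. Z n \<omega>) \<in> \<Omega> \<rightarrow>\<^sub>M Pi\<^sub>M UNIV (\<lambda>_. count_space UNIV)"
    using assms(1) by (auto simp: runs_def intro!: measurable_PiM_single')
  then show "finite_measure ?l"
    by (intro prob_space.finite_measure prob_space.prob_space_distr)
qed auto

end

section \<open>Sojourns and moves along a trajectory\<close>

context atomic_chain begin

lemma runs_measurable: "runs \<Omega> Z \<Longrightarrow> Z n \<in> \<Omega> \<rightarrow>\<^sub>M count_space UNIV"
  by (simp add: runs_def)

lemma runs_AE_step:
  assumes "runs \<Omega> Z"
  shows "AE \<omega> in \<Omega>. \<forall>n. Z (n + 1) \<omega> \<in> set_pmf (step (Z n \<omega>)) \<and> snd (Z n \<omega>) < f (fst (Z n \<omega>))"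
  unfolding AE_all_countable
proof
  fix n
  note [measurable] = runs_measurable[OF assms]
  have "set_pmf \<pi> \<subseteq> {s. snd s < f (fst s)}"
    by (auto simp: set_pmf_eq pmf_\<pi> \<pi>w_def split: if_splits)
  then have "AE l in traj 1. l ! 1 \<in> set_pmf (step (l ! 0)) \<and> snd (l ! 0) < f (fst (l ! 0))"
    by (auto simp: AE_measure_pmf_iff traj_def)
  moreover have "distr \<Omega> (count_space UNIV) (window Z n 1) = measure_pmf (traj 1)"
    using assms by (simp add: runs_def)
  ultimately have "AE l in distr \<Omega> (count_space UNIV) (window Z n 1). l ! 1 \<in> set_pmf (step (l ! 0)) \<and> snd (l ! 0) < f (fst (l ! 0))"
    by (simp only:)
  from AE_distrD[OF _ this]
  show "AE \<omega> in \<Omega>. Z (n + 1) \<omega> \<in> set_pmf (step (Z n \<omega>)) \<and> snd (Z n \<omega>) < f (fst (Z n \<omega>))"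
    by (simp add: nth_window)
qed

text \<open>A move resets the age to 0, so a positive age can only come from the preceding age in
  the same sojourn. With two-sided time one can go back \<open>a\<close> steps from any time and
  find the start of the sojourn.\<close>

lemma step_age:
  assumes "\<And>n. z (n + 1) \<in> set_pmf (step (z n))" and "z n = (k, a)"
  shows "z (n - int a) = (k, 0)"
  using assms(2)
proof (induction a arbitrary: n)
  case (Suc a)
  then have "z (n - 1) = (k, a)"
    using assms(1)[of "n - 1"] by (cases "z (n - 1)") (auto simp: step_def split: if_splits)
  from Suc.IH[OF this] show ?case by (simp add: algebra_simps)
qed simp

lemma step_pause:
  assumes "\<And>n. z (n + 1) \<in> set_pmf (step (z n))" and "z m = (k, 0)" and "i < f k"
  shows "z (m + int i) = (k, i)"
  using assms(3)
proof (induction i)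
  case (Suc i)
  then show ?case
    using assms(1)[of "m + int i"] by (simp add: step_def ac_simps)
qed (use assms in simp)

lemma step_move:
  assumes "\<And>n. z (n + 1) \<in> set_pmf (step (z n))" and "z m = (k, 0)"
  shows "snd (z (m + int (f k))) = 0"
proof -
  have "z (m + int (f k - 1)) = (k, f k - 1)"
    using step_pause[of z m k "f k - 1"] assms f_pos[of k] by simp
  moreover have "m + int (f k - 1) + 1 = m + int (f k)"
    using f_pos[of k] by simp
  ultimately show ?thesis
    using assms(1)[of "m + int (f k - 1)"] f_pos[of k] by (auto simp: step_def split: if_splits)
qed

lemma walk_nonempty: "l \<in> set_pmf (walk n s) \<Longrightarrow> 0 < n \<Longrightarrow> l \<noteq> []"
  using length_walk[of l n s] by auto

text \<open>Up to its last step the rest of a sojourn is deterministic, hence the next value has law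
  \<open>q k\<close> whatever age has been reached.\<close>

lemma walk_pause:
  assumes "a < f k"
  shows "map_pmf last (walk (f k - a) (k, a)) = map_pmf (\<lambda>j. (j, 0)) (q k)"
  using assms
proof (induction "f k - a" arbitrary: a)
  case (Suc n)
  show ?case
  proof (cases "Suc a < f k")
    case True
    have n: "f k - a = Suc n" "n = f k - Suc a" using Suc by auto
    have "map_pmf last (walk (f k - a) (k, a)) = map_pmf (\<lambda>l. last ((k, Suc a) # l)) (walk n (k, Suc a))"
      unfolding n(1) using True by (simp add: step_def bind_return_pmf map_pmf_comp)
    also have "\<dots> = map_pmf last (walk (f k - Suc a) (k, Suc a))"
      unfolding n(2) using True by (intro map_pmf_cong refl) (simp add: walk_nonempty)
    finally show ?thesis
      using Suc(1)[of "Suc a"] n True by simp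
  next
    case False
    then have "f k - a = 1" using Suc by auto
    then show ?thesis using False
      by (simp add: step_def map_pmf_def[symmetric]) (simp add: map_pmf_comp)
  qed
qed simp

text \<open>The Markov property at a move time, for the part of the past seen by a window: the mass
  at the next move factors, since the sojourn in between adds no randomness.\<close>

lemma runs_block:
  assumes "runs \<Omega> Z"
  shows "emeasure \<Omega> {\<omega>\<in>space \<Omega>. window Z lo n \<omega> \<in> B \<and> Z (lo + int n) \<omega> = (k, 0) \<and> Z (lo + int n + int (f k)) \<omega> \<in> B'} =
    emeasure (q k) {j. (j, 0) \<in> B'} * emeasure \<Omega> {\<omega>\<in>space \<Omega>. window Z lo n \<omega> \<in> B \<and> Z (lo + int n) \<omega> = (k, 0)}"
proof -
  let ?B = "{l. take (Suc n) l \<in> B \<and> l ! n = (k, 0) \<and> last l \<in> B'}"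
  have 1: "{\<omega>\<in>space \<Omega>. window Z lo n \<omega> \<in> B \<and> Z (lo + int n) \<omega> = (k, 0) \<and> Z (lo + int n + int (f k)) \<omega> \<in> B'} =
      {\<omega>\<in>space \<Omega>. window Z lo (n + f k) \<omega> \<in> ?B}"
    by (auto simp: nth_window last_window take_window ac_simps)
  have 2: "{\<omega>\<in>space \<Omega>. window Z lo n \<omega> \<in> B \<and> Z (lo + int n) \<omega> = (k, 0)} =
      {\<omega>\<in>space \<Omega>. window Z lo n \<omega> \<in> {l. l \<in> B \<and> last l = (k, 0)}}"
    by (auto simp: last_window)
  have "emeasure (traj (n + f k)) ?B =
      (\<integral>\<^sup>+l. emeasure (walk (f k) (last l)) {l'. l @ l' \<in> ?B} \<partial>traj n)"
    by (simp add: traj_add vimage_def)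
  also have "\<dots> = (\<integral>\<^sup>+l. emeasure (q k) {j. (j, 0) \<in> B'} * indicator {l. l \<in> B \<and> last l = (k, 0)} l \<partial>traj n)"
  proof (rule nn_integral_cong_AE, unfold AE_measure_pmf_iff, intro ballI)
    fix l assume "l \<in> set_pmf (traj n)"
    then have l: "length l = Suc n" by (rule length_traj)
    then have nth: "l ! n = last l" by (subst last_conv_nth) auto
    have "emeasure (walk (f k) (last l)) {l'. l @ l' \<in> ?B} =
        emeasure (walk (f k) (last l)) (if l \<in> B \<and> last l = (k, 0) then last -` B' else {})"
      using l nth walk_nonempty[OF _ f_pos] by (intro emeasure_eq_AE) (auto simp: AE_measure_pmf_iff nth_append)
    also have "\<dots> = emeasure (q k) {j. (j, 0) \<in> B'} * indicator {l. l \<in> B \<and> last l = (k, 0)} l"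
    proof (cases "l \<in> B \<and> last l = (k, 0)")
      case True
      have "emeasure (walk (f k) (k, 0)) (last -` B') = emeasure (map_pmf last (walk (f k - 0) (k, 0))) B'"
        by simp
      also have "\<dots> = emeasure (q k) {j. (j, 0) \<in> B'}"
        using f_pos[of k] by (subst walk_pause) (auto simp: vimage_def)
      finally show ?thesis using True by simp
    qed auto
    finally show "emeasure (walk (f k) (last l)) {l'. l @ l' \<in> ?B} =
        emeasure (q k) {j. (j, 0) \<in> B'} * indicator {l. l \<in> B \<and> last l = (k, 0)} l" .
  qed
  also have "\<dots> = emeasure (q k) {j. (j, 0) \<in> B'} * emeasure (traj n) {l. l \<in> B \<and> last l = (k, 0)}"
    by (subst nn_integral_cmult_indicator) auto
  finally show ?thesis
    unfolding 1 2 runs_prob_window[OF assms] .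
qed

end

text \<open>Histories are indexed by infinitely many past times, whereas a window sees finitely
  many. The two weighted laws of the history are finite measures that agree on a generating class of
  cylinders stable under intersection, hence everywhere.\<close>

lemma weighted_cylinder_eq:
  fixes w :: "'w \<Rightarrow> ennreal"
  assumes [measurable]: "H \<in> \<Omega> \<rightarrow>\<^sub>M Pi\<^sub>M I M" "v \<in> borel_measurable \<Omega>" "w \<in> borel_measurable \<Omega>"
    and fin: "(\<integral>\<^sup>+\<omega>. v \<omega> \<partial>\<Omega>) < \<infinity>"
    and eq: "\<And>J A. finite J \<Longrightarrow> J \<subseteq> I \<Longrightarrow> (\<And>i. i \<in> J \<Longrightarrow> A i \<in> sets (M i)) \<Longrightarrow>
      (\<integral>\<^sup>+\<omega>. v \<omega> * indicator {\<omega>. \<forall>i\<in>J. H \<omega> i \<in> A i} \<omega> \<partial>\<Omega>) = (\<integral>\<^sup>+\<omega>. w \<omega> * indicator {\<omega>. \<forall>i\<in>J. H \<omega> i \<in> A i} \<omega> \<partial>\<Omega>)"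
    and B [measurable]: "B \<in> sets (Pi\<^sub>M I M)"
  shows "(\<integral>\<^sup>+\<omega>. v \<omega> * indicator B (H \<omega>) \<partial>\<Omega>) = (\<integral>\<^sup>+\<omega>. w \<omega> * indicator B (H \<omega>) \<partial>\<Omega>)"
proof -
  have *: "emeasure (distr (density \<Omega> u) (Pi\<^sub>M I M) H) B = (\<integral>\<^sup>+\<omega>. u \<omega> * indicator B (H \<omega>) \<partial>\<Omega>)"
    if [measurable]: "u \<in> borel_measurable \<Omega>" "B \<in> sets (Pi\<^sub>M I M)" for u B
    by (subst emeasure_distr) (auto simp: emeasure_density intro!: nn_integral_cong split: split_indicator)
  have "distr (density \<Omega> v) (Pi\<^sub>M I M) H = distr (density \<Omega> w) (Pi\<^sub>M I M) H"
  proof (rule measure_eqI_PiM_infinite)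
    fix A J assume J: "finite J" "J \<subseteq> I" "\<And>i. i \<in> J \<Longrightarrow> A i \<in> sets (M i)"
    let ?X = "prod_emb I M J (Pi\<^sub>E J A)"
    have X [measurable]: "?X \<in> sets (Pi\<^sub>M I M)"
      using J by (intro sets_PiM_I) auto
    have ind: "indicator ?X (H \<omega>) = (indicator {\<omega>. \<forall>i\<in>J. H \<omega> i \<in> A i} \<omega> :: ennreal)" if "\<omega> \<in> space \<Omega>" for \<omega>
      using measurable_space[OF assms(1) that] J(2)
      by (auto simp: prod_emb_def space_PiM PiE_iff split: split_indicator)
    show "emeasure (distr (density \<Omega> v) (Pi\<^sub>M I M) H) ?X = emeasure (distr (density \<Omega> w) (Pi\<^sub>M I M) H) ?X"
      using eq[OF J] by (simp add: * ind cong: nn_integral_cong)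
  next
    have "(\<integral>\<^sup>+\<omega>. v \<omega> * indicator (space (Pi\<^sub>M I M)) (H \<omega>) \<partial>\<Omega>) = (\<integral>\<^sup>+\<omega>. v \<omega> \<partial>\<Omega>)"
      using measurable_space[OF assms(1)] by (intro nn_integral_cong) auto
    then show "finite_measure (distr (density \<Omega> v) (Pi\<^sub>M I M) H)"
      using fin *[OF assms(2) sets.top] by (intro finite_measureI) simp
  qed auto
  then show ?thesis
    using *[OF assms(2) B] *[OF assms(3) B] by simp
qed

section \<open>The paused chain\<close>

locale paused_grid = atomic_chain +
  fixes val :: "nat \<Rightarrow> real" and F :: "real \<Rightarrow> nat"
  assumes inj_val: "inj val" and F_val: "F (val k) = f k"
begin

abbreviation S :: "real set" where "S \<equiv> range val"

definition Q :: "real \<Rightarrow> real measure" where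
  "Q z = distr (q (inv val z)) (restrict_space borel S) val"

definition value_at :: "(int \<Rightarrow> 'w \<Rightarrow> nat \<times> nat) \<Rightarrow> int \<Rightarrow> 'w \<Rightarrow> real" where
  "value_at Z n \<omega> = val (fst (Z n \<omega>))"

definition moves :: "(int \<Rightarrow> 'w \<Rightarrow> nat \<times> nat) \<Rightarrow> int \<Rightarrow> 'w \<Rightarrow> bool" where
  "moves Z n \<omega> \<longleftrightarrow> snd (Z n \<omega>) = 0"

text \<open>The grid is countable, so every subset is Borel and any map out of it is
  measurable.\<close>

lemma sets_S: "sets (restrict_space borel S) = Pow S"
proof -
  have "A \<in> (\<inter>) S ` sets borel" if "A \<subseteq> S" for A
  proof (rule image_eqI)
    have "countable A"
      by (rule countable_subset[OF that]) simp
    then show "A \<in> sets borel"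
      by (rule sets.countable[rotated]) simp
    show "A = S \<inter> A" using that by blast
  qed
  then show ?thesis
    unfolding sets_restrict_space by blast
qed

lemma S_borel: "S \<in> sets borel"
  by (rule sets.countable) auto

lemma val_measurable: "val \<in> count_space UNIV \<rightarrow>\<^sub>M restrict_space borel S"
  by (auto simp: space_restrict_space)

lemma prob_space_Q: "prob_space (Q z)"
  unfolding Q_def by (intro measure_pmf.prob_space_distr) (use val_measurable in simp)

lemma Q_measurable: "Q \<in> restrict_space borel S \<rightarrow>\<^sub>M prob_algebra (restrict_space borel S)"
proof -
  have "Q \<in> count_space S \<rightarrow>\<^sub>M prob_algebra (restrict_space borel S)"
    using prob_space_Q by (auto simp: space_prob_algebra Q_def)
  then show ?thesis
    by (subst measurable_cong_sets[of _ "count_space S"]) (simp_all add: sets_S)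
qed

lemma emeasure_Q_val:
  assumes "B \<in> sets (restrict_space borel S)"
  shows "emeasure (Q (val k)) B = emeasure (q k) {j. val j \<in> B}"
  unfolding Q_def using assms val_measurable inj_val
  by (subst emeasure_distr) (auto simp: vimage_def)

lemma mark_measurable:
  "(\<lambda>s. (val (fst s), snd s = (0::nat))) \<in> count_space UNIV \<rightarrow>\<^sub>M marked_space S"
  by (auto simp: space_pair_measure space_restrict_space)

lemma value_at_measurable:
  "Z n \<in> \<Omega> \<rightarrow>\<^sub>M count_space UNIV \<Longrightarrow> value_at Z n \<in> \<Omega> \<rightarrow>\<^sub>M restrict_space borel S"
  unfolding value_at_def[abs_def]
  by (erule measurable_compose) (rule measurable_compose[OF _ val_measurable], simp)

lemma moves_measurable:
  "Z n \<in> \<Omega> \<rightarrow>\<^sub>M count_space UNIV \<Longrightarrow> moves Z n \<in> \<Omega> \<rightarrow>\<^sub>M count_space UNIV"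
  unfolding moves_def[abs_def] by (erule measurable_compose) simp

lemma marked_measurable:
  "Z n \<in> \<Omega> \<rightarrow>\<^sub>M count_space UNIV \<Longrightarrow> marked (value_at Z) (moves Z) n \<in> \<Omega> \<rightarrow>\<^sub>M marked_space S"
  using measurable_compose[OF _ mark_measurable] by (simp add: value_at_def[abs_def] moves_def[abs_def])

lemma marked_process: "runs \<Omega> Z \<Longrightarrow> marked_process \<Omega> S (value_at Z) (moves Z)"
  by (auto simp: marked_process_def runs_def intro: value_at_measurable moves_measurable)

lemma state_iff: "Z n \<omega> = (k, 0) \<longleftrightarrow> value_at Z n \<omega> = val k \<and> moves Z n \<omega>"
  using inj_val by (auto simp: value_at_def moves_def inj_eq prod_eq_iff)

text \<open>Splitting by the index \<open>k\<close> at time \<open>m\<close> makes both the sojourn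
  length and the conditional law constant. On each piece the identity comes from
  \<open>runs_block\<close> for cylinders and is then extended to the whole infinite past.\<close>

lemma cond_law_moves:
  assumes runs: "runs \<Omega> Z"
  shows "cond_law \<Omega> (\<lambda>\<omega>. \<lambda>i\<in>{..m}. marked (value_at Z) (moves Z) i \<omega>) (Pi\<^sub>M {..m} (\<lambda>_. marked_space S))
    {\<omega>\<in>space \<Omega>. moves Z m \<omega>} (\<lambda>\<omega>. value_at Z (m + int (F (value_at Z m \<omega>))) \<omega>) (restrict_space borel S)
    (\<lambda>\<omega>. Q (value_at Z m \<omega>))"
proof -
  note Z [measurable] = runs_measurable[OF runs]
  note [measurable] = value_at_measurable[OF Z] moves_measurable[OF Z]
  interpret prob_space \<Omega> using runs by (simp add: runs_def)
  let ?H = "\<lambda>\<omega>. \<lambda>i\<in>{..m}. marked (value_at Z) (moves Z) i \<omega>"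
  let ?Y = "\<lambda>\<omega>. value_at Z (m + int (F (value_at Z m \<omega>))) \<omega>"
  have H [measurable]: "?H \<in> \<Omega> \<rightarrow>\<^sub>M Pi\<^sub>M {..m} (\<lambda>_. marked_space S)"
    by (intro measurable_restrict marked_measurable Z)
  have Y [measurable]: "?Y \<in> \<Omega> \<rightarrow>\<^sub>M restrict_space borel S"
  proof -
    have "(\<lambda>\<omega>. (\<lambda>k \<omega>. value_at Z (m + int (f k)) \<omega>) (fst (Z m \<omega>)) \<omega>) \<in> \<Omega> \<rightarrow>\<^sub>M restrict_space borel S"
      by (rule measurable_compose_countable[where f="\<lambda>k \<omega>. value_at Z (m + int (f k)) \<omega>" and g="\<lambda>\<omega>. fst (Z m \<omega>)"])
         (rule value_at_measurable[OF Z], rule measurable_compose[OF Z], simp)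
    then show ?thesis
      by (simp add: value_at_def F_val)
  qed
  have "cond_law \<Omega> ?H (Pi\<^sub>M {..m} (\<lambda>_. marked_space S)) {\<omega>\<in>space \<Omega>. Z m \<omega> = (k, 0)} ?Y
      (restrict_space borel S) (\<lambda>\<omega>. Q (value_at Z m \<omega>))" for k
  proof (rule cond_lawI[where E'="{h\<in>space (Pi\<^sub>M {..m} (\<lambda>_. marked_space S)). h m = (val k, True)}" and \<kappa>'="\<lambda>_. Q (val k)"])
    have [measurable]: "{(val k, True)} \<in> sets (marked_space S)"
      using pair_measureI[of "{val k}" "restrict_space borel S" "{True}" "count_space UNIV"] by (simp add: sets_S)
    have "{h\<in>space (Pi\<^sub>M {..m} (\<lambda>_. marked_space S)). h m \<in> {(val k, True)}} \<in> sets (Pi\<^sub>M {..m} (\<lambda>_. marked_space S))"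
      by measurable
    then show "{h\<in>space (Pi\<^sub>M {..m} (\<lambda>_. marked_space S)). h m = (val k, True)} \<in> sets (Pi\<^sub>M {..m} (\<lambda>_. marked_space S))"
      by simp
    show "{\<omega>\<in>space \<Omega>. Z m \<omega> = (k, 0)} = ?H -` {h\<in>space (Pi\<^sub>M {..m} (\<lambda>_. marked_space S)). h m = (val k, True)} \<inter> space \<Omega>"
      using measurable_space[OF H] by (auto simp: state_iff)
    fix A B assume A [measurable]: "A \<in> sets (Pi\<^sub>M {..m} (\<lambda>_. marked_space S))"
      and A_sub: "A \<subseteq> {h\<in>space (Pi\<^sub>M {..m} (\<lambda>_. marked_space S)). h m = (val k, True)}"
      and B [measurable]: "B \<in> sets (restrict_space borel S)"
    let ?v = "indicator {\<omega>\<in>space \<Omega>. Z m \<omega> = (k, 0) \<and> value_at Z (m + int (f k)) \<omega> \<in> B} :: _ \<Rightarrow> ennreal"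
    let ?w = "\<lambda>\<omega>. emeasure (q k) {j. val j \<in> B} * indicator {\<omega>\<in>space \<Omega>. Z m \<omega> = (k, 0)} \<omega>"
    have A_D: "Z m \<omega> = (k, 0)" if "?H \<omega> \<in> A" for \<omega>
      using A_sub that by (auto simp: state_iff)
    have "emeasure \<Omega> {\<omega>\<in>space \<Omega>. ?H \<omega> \<in> A \<and> ?Y \<omega> \<in> B} = (\<integral>\<^sup>+\<omega>. ?v \<omega> * indicator A (?H \<omega>) \<partial>\<Omega>)"
    proof (subst nn_integral_indicator[symmetric])
      show "(\<integral>\<^sup>+\<omega>. indicator {\<omega>\<in>space \<Omega>. ?H \<omega> \<in> A \<and> ?Y \<omega> \<in> B} \<omega> \<partial>\<Omega>) = (\<integral>\<^sup>+\<omega>. ?v \<omega> * indicator A (?H \<omega>) \<partial>\<Omega>)"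
        using A_D by (intro nn_integral_cong) (auto split: split_indicator simp: value_at_def F_val)
    qed measurable
    also have "\<dots> = (\<integral>\<^sup>+\<omega>. ?w \<omega> * indicator A (?H \<omega>) \<partial>\<Omega>)"
    proof (rule weighted_cylinder_eq[OF H])
      have "(\<integral>\<^sup>+\<omega>. ?v \<omega> \<partial>\<Omega>) \<le> (\<integral>\<^sup>+\<omega>. 1 \<partial>\<Omega>)"
        by (intro nn_integral_mono) (auto split: split_indicator)
      then show "(\<integral>\<^sup>+\<omega>. ?v \<omega> \<partial>\<Omega>) < \<infinity>"
        by (auto simp: emeasure_space_1 intro: le_less_trans)
      fix J :: "int set" and C assume J: "finite J" "J \<subseteq> {..m}" and C [measurable]: "\<And>i. i \<in> J \<Longrightarrow> C i \<in> sets (marked_space S)"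
      obtain b where b: "\<And>i. i \<in> J \<Longrightarrow> b \<le> i"
        using bdd_below_finite[OF J(1)] by (auto simp: bdd_below_def)
      \<comment> \<open>The window must reach back to a lower bound of the finitely many times in
        \<open>J\<close>.\<close>
      define n where "n = nat (m - b)"
      have n: "J \<subseteq> {m - int n..m}"
        using b J(2) by (force simp: n_def)
      define L where "L = {l. \<forall>i\<in>J. (\<lambda>s. (val (fst s), snd s = (0::nat))) (l ! nat (i - (m - int n))) \<in> C i}"
      have L: "window Z (m - int n) n \<omega> \<in> L \<longleftrightarrow> (\<forall>i\<in>J. ?H \<omega> i \<in> C i)" for \<omega>
      proof -
        have "window Z (m - int n) n \<omega> ! nat (i - (m - int n)) = Z i \<omega>" if "i \<in> J" for i
        proof -
          have "m - int n \<le> i" "i \<le> m" using that n by auto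
          then show ?thesis by (subst nth_window) auto
        qed
        then show ?thesis
          using J(2) by (auto simp: L_def value_at_def moves_def subset_eq)
      qed
      define B2 where "B2 = {s :: nat \<times> nat. val (fst s) \<in> B}"
      have "(\<integral>\<^sup>+\<omega>. ?v \<omega> * indicator {\<omega>. \<forall>i\<in>J. ?H \<omega> i \<in> C i} \<omega> \<partial>\<Omega>) =
          (\<integral>\<^sup>+\<omega>. indicator {\<omega>\<in>space \<Omega>. window Z (m - int n) n \<omega> \<in> L \<and> Z m \<omega> = (k, 0) \<and> Z (m + int (f k)) \<omega> \<in> B2} \<omega> \<partial>\<Omega>)"
        by (intro nn_integral_cong) (auto simp: L value_at_def B2_def split: split_indicator)
      also have "\<dots> = emeasure \<Omega> {\<omega>\<in>space \<Omega>. window Z (m - int n) n \<omega> \<in> L \<and> Z m \<omega> = (k, 0) \<and> Z (m + int (f k)) \<omega> \<in> B2}"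
        by (rule nn_integral_indicator) measurable
      also have "\<dots> = emeasure (q k) {j. val j \<in> B} * emeasure \<Omega> {\<omega>\<in>space \<Omega>. window Z (m - int n) n \<omega> \<in> L \<and> Z m \<omega> = (k, 0)}"
        using runs_block[OF runs, of "m - int n" n L k "B2"] by (simp add: B2_def)
      also have "\<dots> = (\<integral>\<^sup>+\<omega>. emeasure (q k) {j. val j \<in> B} * indicator {\<omega>\<in>space \<Omega>. window Z (m - int n) n \<omega> \<in> L \<and> Z m \<omega> = (k, 0)} \<omega> \<partial>\<Omega>)"
        by (rule nn_integral_cmult_indicator[symmetric]) measurable
      also have "\<dots> = (\<integral>\<^sup>+\<omega>. ?w \<omega> * indicator {\<omega>. \<forall>i\<in>J. ?H \<omega> i \<in> C i} \<omega> \<partial>\<Omega>)"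
        by (intro nn_integral_cong) (auto simp: L split: split_indicator)
      finally show "(\<integral>\<^sup>+\<omega>. ?v \<omega> * indicator {\<omega>. \<forall>i\<in>J. ?H \<omega> i \<in> C i} \<omega> \<partial>\<Omega>) =
        (\<integral>\<^sup>+\<omega>. ?w \<omega> * indicator {\<omega>. \<forall>i\<in>J. ?H \<omega> i \<in> C i} \<omega> \<partial>\<Omega>)" .
    qed measurable
    also have "\<dots> = (\<integral>\<^sup>+\<omega>. indicator A (?H \<omega>) * emeasure (Q (value_at Z m \<omega>)) B \<partial>\<Omega>)"
      using A_D emeasure_Q_val[OF B, of k] by (intro nn_integral_cong) (auto split: split_indicator simp: value_at_def)
    finally show "emeasure \<Omega> {\<omega>\<in>space \<Omega>. ?H \<omega> \<in> A \<and> ?Y \<omega> \<in> B} =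
      (\<integral>\<^sup>+\<omega>. indicator A (?H \<omega>) * emeasure (Q (value_at Z m \<omega>)) B \<partial>\<Omega>)" .
  qed (use prob_space_axioms H Y prob_space_Q in \<open>auto simp: state_iff\<close>)
  from cond_law_UN[of \<Omega> ?H _ _ ?Y, OF this]
  have "cond_law \<Omega> ?H (Pi\<^sub>M {..m} (\<lambda>_. marked_space S)) (\<Union>k. {\<omega>\<in>space \<Omega>. Z m \<omega> = (k, 0)}) ?Y
      (restrict_space borel S) (\<lambda>\<omega>. Q (value_at Z m \<omega>))" .
  also have "(\<Union>k. {\<omega>\<in>space \<Omega>. Z m \<omega> = (k, 0)}) = {\<omega>\<in>space \<Omega>. moves Z m \<omega>}"
    by (auto simp: moves_def prod_eq_iff)
  finally show ?thesis .
qed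

lemma paused_chain:
  assumes runs: "runs \<Omega> Z"
  shows "paused_chain \<Omega> S Q F (value_at Z) (moves Z)"
  unfolding paused_chain_def
proof (intro conjI allI)
  show "marked_process \<Omega> S (value_at Z) (moves Z)"
    using runs by (rule marked_process)
  show "AE \<omega> in \<Omega>. \<forall>n. \<exists>m\<le>n. moves Z m \<omega>"
    using runs_AE_step[OF runs]
  proof eventually_elim
    case (elim \<omega>)
    \<comment> \<open>The age tells how long ago the last move happened.\<close>
    then have "moves Z (n - int (snd (Z n \<omega>))) \<omega>" for n
      using step_age[of "\<lambda>n. Z n \<omega>" n "fst (Z n \<omega>)" "snd (Z n \<omega>)"] by (simp add: moves_def)
    then show ?case
      by (meson diff_le_self of_nat_0_le_iff diff_le_eq le_add_same_cancel1)
  qed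
  show "AE \<omega> in \<Omega>. \<forall>m. moves Z m \<omega> \<longrightarrow>
      (\<forall>n. m < n \<and> n < m + int (F (value_at Z m \<omega>)) \<longrightarrow> value_at Z n \<omega> = value_at Z m \<omega> \<and> \<not> moves Z n \<omega>) \<and>
      moves Z (m + int (F (value_at Z m \<omega>))) \<omega>"
    using runs_AE_step[OF runs]
  proof eventually_elim
    case (elim \<omega>)
    show ?case
    proof (intro allI impI conjI)
      fix m assume "moves Z m \<omega>"
      then obtain k where k: "Z m \<omega> = (k, 0)"
        by (cases "Z m \<omega>") (simp add: moves_def)
      show "moves Z (m + int (F (value_at Z m \<omega>))) \<omega>"
        using step_move[of "\<lambda>n. Z n \<omega>" m k] elim k by (simp add: value_at_def moves_def F_val)
      fix n assume n: "m < n \<and> n < m + int (F (value_at Z m \<omega>))"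
      then have "Z n \<omega> = (k, nat (n - m))"
        using step_pause[of "\<lambda>n. Z n \<omega>" m k "nat (n - m)"] elim k n
        by (simp add: value_at_def F_val nat_less_iff)
      then show "value_at Z n \<omega> = value_at Z m \<omega>" "\<not> moves Z n \<omega>"
        using n k by (auto simp: value_at_def moves_def)
    qed
  qed
qed (rule cond_law_moves[OF runs])

lemma path_law_marked:
  assumes "runs \<Omega> Z"
  shows "path_law \<Omega> (marked_space S) (marked (value_at Z) (moves Z)) =
    distr (distr \<Omega> (Pi\<^sub>M UNIV (\<lambda>_. count_space UNIV)) (\<lambda>\<omega> n. Z n \<omega>)) (Pi\<^sub>M UNIV (\<lambda>_. marked_space S))
      (\<lambda>z n. (val (fst (z n)), snd (z n) = 0))"
proof -
  note [measurable] = runs_measurable[OF assms]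
  have "(\<lambda>z n. (val (fst (z n)), snd (z n) = (0::nat))) \<in> Pi\<^sub>M UNIV (\<lambda>_. count_space UNIV) \<rightarrow>\<^sub>M Pi\<^sub>M (UNIV :: int set) (\<lambda>_. marked_space S)"
    by (rule measurable_PiM_single', rule measurable_compose[OF _ mark_measurable])
       (auto simp: space_pair_measure space_restrict_space)
  then show ?thesis
    unfolding path_law_def
    by (subst distr_distr) (auto intro!: measurable_PiM_single' simp: comp_def value_at_def moves_def)
qed

lemma path_law_unique:
  assumes "runs \<Omega> Z" and "runs \<Omega>' Z'"
  shows "path_law \<Omega> (marked_space S) (marked (value_at Z) (moves Z)) =
    path_law \<Omega>' (marked_space S) (marked (value_at Z') (moves Z'))"
  using assms by (simp add: path_law_marked runs_path_unique[OF assms])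

lemma stationary: "runs \<Omega> Z \<Longrightarrow> stationary_process \<Omega> (marked_space S) (marked (value_at Z) (moves Z))"
  unfolding stationary_process_def
  using path_law_unique[OF runs_shift[of \<Omega> Z 1]] by (simp add: value_at_def[abs_def] moves_def[abs_def])

end

section \<open>Ergodicity\<close>

context atomic_chain begin

text \<open>The last time unit of a sojourn in the atom: the next state is drawn from
  \<open>q0\<close>, whatever the past.\<close>

definition regen :: "(nat \<times> nat) set" where
  "regen = {s. fst s \<in> At \<and> \<not> Suc (snd s) < f (fst s)}"

definition avoid :: "nat \<Rightarrow> nat \<times> nat \<Rightarrow> ennreal" where
  "avoid n s = emeasure (walk n s) {l. set (s # l) \<inter> regen = {}}"

lemma avoid_0: "avoid 0 s = indicator (- regen) s"
  by (auto simp: avoid_def split: split_indicator)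

lemma avoid_Suc: "avoid (Suc n) s = indicator (- regen) s * (\<integral>\<^sup>+s'. avoid n s' \<partial>step s)"
  by (auto simp: avoid_def vimage_def split: split_indicator)

text \<open>Large enough for \<open>K + (C\<^sub>h + K) * \<gamma> \<le> C\<^sub>h\<close>. At a
  move off the atom this pays for the elapsed time unit, bounded by \<open>K * W\<close>, for the
  new sojourn, and for the new value of the Lyapunov function.\<close>

definition C\<^sub>h :: real where "C\<^sub>h = K + (K + K * \<gamma>) / (1 - \<gamma>)"

text \<open>A Lyapunov function in real time: off \<open>regen\<close> its mean decreases by at least 1 in each time unit.\<close>

definition hit_bound :: "nat \<times> nat \<Rightarrow> ennreal" where
  "hit_bound s = ennreal C\<^sub>h * W (fst s) + of_nat (f (fst s) - snd s)"

lemma KW: "1 \<le> ennreal K * W k"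
  by (rule order_trans[OF f_ge_1 f_le])

text \<open>Within a sojourn the remaining time falls by exactly 1. When it ends off the atom, the
  contraction of \<open>W\<close> outweighs the mean length of the next sojourn by the choice of
  \<open>C\<^sub>h\<close>.\<close>

lemma hit_bound_step:
  assumes "s \<notin> regen"
  shows "1 + (\<integral>\<^sup>+s'. hit_bound s' \<partial>step s) \<le> hit_bound s"
proof -
  obtain k a where s: "s = (k, a)" by (cases s)
  show ?thesis
  proof (cases "Suc a < f k")
    case True
    then have "f k - a = Suc (f k - Suc a)" by simp
    then show ?thesis
      using True by (simp add: s step_def hit_bound_def ac_simps)
  next
    case False
    then have k: "k \<notin> At" using assms by (auto simp: s regen_def)
    have C: "0 \<le> C\<^sub>h" and CK: "K + (C\<^sub>h + K) * \<gamma> \<le> C\<^sub>h"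
    proof -
      show "0 \<le> C\<^sub>h" using K \<gamma> by (simp add: C\<^sub>h_def)
      have "C\<^sub>h * (1 - \<gamma>) = K * (1 - \<gamma>) + (K + K * \<gamma>) / (1 - \<gamma>) * (1 - \<gamma>)"
        by (simp only: C\<^sub>h_def distrib_right)
      also have "(K + K * \<gamma>) / (1 - \<gamma>) * (1 - \<gamma>) = K + K * \<gamma>"
        using \<gamma> by simp
      finally have "C\<^sub>h * (1 - \<gamma>) = K * (1 - \<gamma>) + (K + K * \<gamma>)" .
      moreover have "0 \<le> K * (1 - \<gamma>)" using K \<gamma> by simp
      ultimately show "K + (C\<^sub>h + K) * \<gamma> \<le> C\<^sub>h"
        by (simp add: algebra_simps)
    qed
    have "(\<integral>\<^sup>+s'. hit_bound s' \<partial>step s) = (\<integral>\<^sup>+j. ennreal C\<^sub>h * W j + of_nat (f j) \<partial>q k)"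
      using False by (simp add: s step_def hit_bound_def)
    also have "\<dots> \<le> (\<integral>\<^sup>+j. ennreal (C\<^sub>h + K) * W j \<partial>q k)"
      using f_le K C by (intro nn_integral_mono) (simp add: distrib_right add_left_mono)
    also have "\<dots> = ennreal (C\<^sub>h + K) * (\<integral>\<^sup>+j. W j \<partial>q k)"
      by (rule nn_integral_cmult) simp
    also have "\<dots> \<le> ennreal (C\<^sub>h + K) * (ennreal \<gamma> * W k)"
      by (intro mult_left_mono drift k) simp
    also have "\<dots> = ennreal ((C\<^sub>h + K) * \<gamma>) * W k"
      using K C \<gamma> by (simp only: ennreal_mult add_nonneg_nonneg less_imp_le mult.assoc)
    finally have "1 + (\<integral>\<^sup>+s'. hit_bound s' \<partial>step s) \<le> ennreal K * W k + ennreal ((C\<^sub>h + K) * \<gamma>) * W k"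
      by (intro add_mono KW)
    also have "\<dots> = ennreal (K + (C\<^sub>h + K) * \<gamma>) * W k"
      using K C \<gamma> by (subst ennreal_plus) (simp_all add: distrib_right)
    also have "\<dots> \<le> ennreal C\<^sub>h * W k"
      by (intro mult_right_mono ennreal_leI CK) simp
    also have "\<dots> \<le> hit_bound s"
      by (simp add: hit_bound_def s)
    finally show ?thesis .
  qed
qed

text \<open>Foster's criterion: the sum of the tails of the hitting time of \<open>regen\<close>
  tends to its mean, and each step spent off \<open>regen\<close> is paid for by a decrease of
  \<open>hit_bound\<close>.\<close>

lemma sum_avoid_le: "(\<Sum>i\<le>n. avoid i s) \<le> hit_bound s"
proof (induction n arbitrary: s)
  case 0
  have "1 \<le> ennreal K * W (fst s)" by (rule KW)
  also have "\<dots> \<le> ennreal C\<^sub>h * W (fst s)"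
    using K \<gamma> by (intro mult_right_mono ennreal_leI) (simp_all add: C\<^sub>h_def)
  finally show ?case
    by (simp add: avoid_0 hit_bound_def add_increasing2 split: split_indicator)
next
  case (Suc n)
  have "(\<Sum>i\<le>Suc n. avoid i s) = indicator (- regen) s * (1 + (\<integral>\<^sup>+s'. (\<Sum>i\<le>n. avoid i s') \<partial>step s))"
    by (subst sum.atMost_Suc_shift)
       (auto simp: avoid_0 avoid_Suc nn_integral_sum sum_distrib_left[symmetric] split: split_indicator)
  also have "\<dots> \<le> indicator (- regen) s * (1 + (\<integral>\<^sup>+s'. hit_bound s' \<partial>step s))"
    by (intro mult_left_mono add_left_mono nn_integral_mono Suc) auto
  also have "\<dots> \<le> hit_bound s"
    using hit_bound_step[of s] by (auto split: split_indicator)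
  finally show ?case .
qed

lemma hit_bound_finite: "hit_bound s < \<infinity>"
  using W_finite[of "fst s"] by (simp add: hit_bound_def ennreal_mult_less_top of_nat_less_top)

text \<open>From a fixed state, the probability of never hitting is below every
  \<open>avoid n s\<close>. Their partial sums stay below a finite bound, so it must vanish; there
  are only countably many states.\<close>

lemma runs_hits_regen:
  assumes runs: "runs \<Omega> Z"
  shows "AE \<omega> in \<Omega>. \<exists>n\<ge>0. Z n \<omega> \<in> regen"
proof -
  note [measurable] = runs_measurable[OF runs]
  have "AE \<omega> in \<Omega>. \<not> (Z 0 \<omega> = s \<and> (\<forall>n\<ge>0. Z n \<omega> \<notin> regen))" for s
  proof -
    let ?E = "{\<omega>\<in>space \<Omega>. Z 0 \<omega> = s \<and> (\<forall>n\<ge>0. Z n \<omega> \<notin> regen)}"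
    have E: "?E \<in> sets \<Omega>" by measurable
    have "emeasure \<Omega> ?E \<le> avoid n s" for n
    proof -
      have "emeasure \<Omega> ?E \<le> emeasure \<Omega> {\<omega>\<in>space \<Omega>. window Z 0 n \<omega> \<in> {l. l ! 0 = s \<and> set l \<inter> regen = {}}}"
      proof (rule emeasure_mono)
        show "?E \<subseteq> {\<omega>\<in>space \<Omega>. window Z 0 n \<omega> \<in> {l. l ! 0 = s \<and> set l \<inter> regen = {}}}"
          by (auto simp: nth_window) (auto simp: window_def)
      qed measurable
      also have "\<dots> = emeasure (traj n) {l. l ! 0 = s \<and> set l \<inter> regen = {}}"
        by (rule runs_prob_window) fact
      also have "\<dots> = (\<integral>\<^sup>+s'. emeasure (walk n s') {l. s' = s \<and> set (s' # l) \<inter> regen = {}} \<partial>\<pi>)"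
        by (simp add: traj_def vimage_def)
      also have "\<dots> \<le> (\<integral>\<^sup>+s'. avoid n s \<partial>\<pi>)"
      proof (intro nn_integral_mono)
        fix s' show "emeasure (walk n s') {l. s' = s \<and> set (s' # l) \<inter> regen = {}} \<le> avoid n s"
          by (cases "s' = s") (simp_all add: avoid_def)
      qed
      also have "\<dots> = avoid n s"
        by (simp add: measure_pmf.emeasure_space_1[simplified])
      finally show ?thesis .
    qed
    then have le: "of_nat (Suc n) * emeasure \<Omega> ?E \<le> hit_bound s" for n
      using order_trans[OF sum_mono[of "{..n}" "\<lambda>_. emeasure \<Omega> ?E"] sum_avoid_le[of s n]] by simp
    have "emeasure \<Omega> ?E = 0"
    proof (rule ccontr)
      assume "emeasure \<Omega> ?E \<noteq> 0"
      moreover obtain e where e: "0 \<le> e" "emeasure \<Omega> ?E = ennreal e"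
        using le[of 0] hit_bound_finite[of s] by (cases "emeasure \<Omega> ?E") (auto simp: top_unique)
      moreover obtain h where h: "0 \<le> h" "hit_bound s = ennreal h"
        using hit_bound_finite[of s] by (cases "hit_bound s") auto
      ultimately have "e > 0" by auto
      obtain n where "h < real n * e"
        using reals_Archimedean3[OF \<open>e > 0\<close>] by blast
      also have "real n * e \<le> real (Suc n) * e" using e by (intro mult_right_mono) auto
      finally have "h < real (Suc n) * e" .
      then show False
        using le[of n] e h by (simp add: ennreal_of_nat_eq_real_of_nat ennreal_mult[symmetric] del: of_nat_Suc)
    qed
    with E show ?thesis
      by (subst AE_iff_measurable[OF _ refl]) (auto simp: Collect_conj_eq[symmetric])
  qed
  then have "AE \<omega> in \<Omega>. \<forall>s. \<not> (Z 0 \<omega> = s \<and> (\<forall>n\<ge>0. Z n \<omega> \<notin> regen))"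
    by (subst AE_all_countable) blast
  then show ?thesis by eventually_elim blast
qed

text \<open>The factor \<open>c\<close> is the probability of \<open>B'\<close> for a trajectory
  restarted with law \<open>q0\<close>. That one \<open>c\<close> serves all \<open>n\<close> and
  \<open>B\<close> is the point: past and future are independent given a regeneration at
  \<open>lo\<close>.\<close>

lemma runs_regen_split:
  assumes runs: "runs \<Omega> Z"
  obtains c where "\<And>n B. measure \<Omega> {\<omega>\<in>space \<Omega>. window Z (lo - int n) n \<omega> \<in> B \<and> Z lo \<omega> \<in> regen \<and> window Z (lo + 1) m \<omega> \<in> B'} =
    c * measure \<Omega> {\<omega>\<in>space \<Omega>. window Z (lo - int n) n \<omega> \<in> B \<and> Z lo \<omega> \<in> regen}"
proof
  define c where "c = emeasure (bind_pmf q0 (\<lambda>k. map_pmf ((#) (k, 0)) (walk m (k, 0)))) B'"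
  fix n B
  note [measurable] = runs_measurable[OF runs]
  let ?B = "{l. take (Suc n) l \<in> B \<and> l ! n \<in> regen \<and> drop (Suc n) l \<in> B'}"
  have 1: "{\<omega>\<in>space \<Omega>. window Z (lo - int n) n \<omega> \<in> B \<and> Z lo \<omega> \<in> regen \<and> window Z (lo + 1) m \<omega> \<in> B'} =
      {\<omega>\<in>space \<Omega>. window Z (lo - int n) (n + Suc m) \<omega> \<in> ?B}"
    using drop_window[of "Suc n" Z "lo - int n" m] take_window[of n Z "lo - int n" "Suc m"]
    by (auto simp: nth_window)
  have 2: "{\<omega>\<in>space \<Omega>. window Z (lo - int n) n \<omega> \<in> B \<and> Z lo \<omega> \<in> regen} =
      {\<omega>\<in>space \<Omega>. window Z (lo - int n) n \<omega> \<in> {l. l \<in> B \<and> last l \<in> regen}}"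
    by (auto simp: last_window)
  have "emeasure (traj (n + Suc m)) ?B = (\<integral>\<^sup>+l. emeasure (walk (Suc m) (last l)) {l'. l @ l' \<in> ?B} \<partial>traj n)"
    by (simp only: traj_add emeasure_bind_pmf emeasure_map_pmf vimage_def)
  also have "\<dots> = (\<integral>\<^sup>+l. c * indicator {l. l \<in> B \<and> last l \<in> regen} l \<partial>traj n)"
  proof (rule nn_integral_cong_AE, unfold AE_measure_pmf_iff, intro ballI)
    fix l assume "l \<in> set_pmf (traj n)"
    then have l: "length l = Suc n" by (rule length_traj)
    then have nth: "l ! n = last l" by (subst last_conv_nth) auto
    have walk_regen: "walk (Suc m) s = bind_pmf q0 (\<lambda>k. map_pmf ((#) (k, 0)) (walk m (k, 0)))" if "s \<in> regen" for s
      using that by (simp add: step_def regen_def bind_map_pmf atom)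
    show "emeasure (walk (Suc m) (last l)) {l'. l @ l' \<in> ?B} = c * indicator {l. l \<in> B \<and> last l \<in> regen} l"
    proof (cases "l \<in> B \<and> last l \<in> regen")
      case True
      then have "{l'. l @ l' \<in> ?B} = B'"
        using l nth by (auto simp: nth_append)
      then show ?thesis
        using True by (simp add: walk_regen c_def del: walk.simps)
    next
      case False
      then have eq: "{l'. l @ l' \<in> ?B} = {}"
        using l nth by (auto simp: nth_append)
      show ?thesis
        unfolding eq using False by auto
    qed
  qed
  also have "\<dots> = c * emeasure (traj n) {l. l \<in> B \<and> last l \<in> regen}"
    by (subst nn_integral_cmult_indicator) auto
  finally show "measure \<Omega> {\<omega>\<in>space \<Omega>. window Z (lo - int n) n \<omega> \<in> B \<and> Z lo \<omega> \<in> regen \<and> window Z (lo + 1) m \<omega> \<in> B'} =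
    enn2real c * measure \<Omega> {\<omega>\<in>space \<Omega>. window Z (lo - int n) n \<omega> \<in> B \<and> Z lo \<omega> \<in> regen}"
    unfolding measure_def 1 2 runs_prob_window[OF runs] by (simp add: enn2real_mult)
qed

end

section \<open>Zero-one law for invariant events\<close>

context atomic_chain begin

text \<open>In the distance given by the mass of the symmetric difference, the events that can be
  approximated by symmetric windows form a sigma-algebra containing the coordinate events.\<close>

lemma window_approx:
  assumes \<Omega>: "prob_space \<Omega>" and Z [measurable]: "\<And>n. Z n \<in> \<Omega> \<rightarrow>\<^sub>M count_space UNIV"
    and "A \<in> sets (Pi\<^sub>M UNIV (\<lambda>_. count_space UNIV))" and "0 < \<epsilon>"
  shows "\<exists>N B. measure \<Omega> {\<omega>\<in>space \<Omega>. ((\<lambda>n. Z n \<omega>) \<in> A) \<noteq> (window Z (- int N) (2 * N) \<omega> \<in> B)} < \<epsilon>"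
proof -
  interpret prob_space \<Omega> by fact
  define cyl where "cyl N B = {\<omega>\<in>space \<Omega>. window Z (- int N) (2 * N) \<omega> \<in> B}" for N B
  have cyl [measurable]: "cyl N B \<in> sets \<Omega>" for N B
    unfolding cyl_def by measurable
  \<comment> \<open>Enlarging a window loses nothing, which allows two approximations to be compared
    in a common window.\<close>
  have cyl_mono: "\<exists>B'. cyl N B = cyl N' B'" if "N \<le> N'" for N N' B
  proof
    have eq: "take (Suc (2 * N)) (drop (N' - N) (window Z (- int N') (2 * N') \<omega>)) = window Z (- int N) (2 * N) \<omega>" for \<omega>
      using that by (intro nth_equalityI) (auto simp: nth_window)
    show "cyl N B = cyl N' {l. take (Suc (2 * N)) (drop (N' - N) l) \<in> B}"
      by (simp add: cyl_def eq)
  qed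
  define dist where "dist E E' = measure \<Omega> {\<omega>\<in>space \<Omega>. (\<omega> \<in> E) \<noteq> (\<omega> \<in> E')}" for E E'
  define approx where "approx E \<longleftrightarrow> E \<in> sets \<Omega> \<and> (\<forall>\<epsilon>>0. \<exists>N B. dist E (cyl N B) < \<epsilon>)" for E
  have approx_cyl: "approx (cyl N B)" for N B
    unfolding approx_def
  proof (intro conjI allI impI exI)
    fix \<epsilon> :: real assume "\<epsilon> > 0"
    then show "dist (cyl N B) (cyl N B) < \<epsilon>" by (simp add: dist_def)
  qed simp
  have cyl_empty: "cyl 0 {} = {}" by (simp add: cyl_def)
  have approx_Un: "approx (E \<union> E')" if E: "approx E" and E': "approx E'" for E E'
    unfolding approx_def
  proof (intro conjI allI impI)
    have [measurable]: "E \<in> sets \<Omega>" "E' \<in> sets \<Omega>"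
      using E E' by (auto simp: approx_def)
    show "E \<union> E' \<in> sets \<Omega>" by measurable
    fix \<epsilon> :: real assume "\<epsilon> > 0"
    then have "\<epsilon> / 2 > 0" by simp
    then obtain N B N' B' where *: "dist E (cyl N B) < \<epsilon> / 2" "dist E' (cyl N' B') < \<epsilon> / 2"
      using E E' unfolding approx_def by blast
    obtain B2 B2' where B2: "cyl N B = cyl (max N N') B2" "cyl N' B' = cyl (max N N') B2'"
      using cyl_mono[of N "max N N'" B] cyl_mono[of N' "max N N'" B'] by auto
    have "dist (E \<union> E') (cyl (max N N') (B2 \<union> B2')) \<le>
        measure \<Omega> ({\<omega>\<in>space \<Omega>. (\<omega> \<in> E) \<noteq> (\<omega> \<in> cyl (max N N') B2)} \<union> {\<omega>\<in>space \<Omega>. (\<omega> \<in> E') \<noteq> (\<omega> \<in> cyl (max N N') B2')})"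
      unfolding dist_def by (intro finite_measure_mono) (auto simp: cyl_def)
    also have "\<dots> \<le> dist E (cyl N B) + dist E' (cyl N' B')"
      unfolding dist_def B2 by (intro measure_Un_le) measurable
    also have "\<dots> < \<epsilon>" using * by simp
    finally show "\<exists>N B. dist (E \<union> E') (cyl N B) < \<epsilon>" by blast
  qed
  have path: "(\<lambda>\<omega> n. Z n \<omega>) \<in> \<Omega> \<rightarrow>\<^sub>M Pi\<^sub>M UNIV (\<lambda>_. count_space UNIV)"
    by (intro measurable_PiM_single') auto
  let ?E = "\<lambda>A. {\<omega>\<in>space \<Omega>. (\<lambda>n. Z n \<omega>) \<in> A}"
  have "A \<in> sigma_sets (\<Pi>\<^sub>E i\<in>UNIV. space (count_space UNIV))
      {{f\<in>\<Pi>\<^sub>E i\<in>UNIV. space (count_space UNIV). f i \<in> A} | i A. i \<in> (UNIV :: int set) \<and> A \<in> sets (count_space (UNIV :: (nat \<times> nat) set))}"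
    using assms(3) by (simp only: sets_PiM_single)
  then have "approx (?E A)"
  proof induction
    case (Basic a)
    then obtain i B where a: "a = {f. f i \<in> B}" by auto
    have "?E a = cyl (nat \<bar>i\<bar>) {l. l ! nat (i + \<bar>i\<bar>) \<in> B}"
      by (auto simp: a cyl_def nth_window)
    then show ?case
      using approx_cyl[of "nat \<bar>i\<bar>" "{l. l ! nat (i + \<bar>i\<bar>) \<in> B}"] by (simp only:)
  next
    case Empty
    show ?case using approx_cyl[of 0 "{}"] by (simp add: cyl_empty)
  next
    case (Compl a)
    have eq: "?E (Pi\<^sub>E UNIV (\<lambda>i. space (count_space UNIV)) - a) = space \<Omega> - ?E a" by auto
    have dist: "dist (space \<Omega> - ?E a) (cyl N (- B)) = dist (?E a) (cyl N B)" for N B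
      unfolding dist_def by (intro arg_cong[where f="measure \<Omega>"]) (auto simp: cyl_def)
    show ?case
      unfolding approx_def eq
    proof (intro conjI allI impI)
      show "space \<Omega> - ?E a \<in> sets \<Omega>"
        using Compl.IH by (intro sets.compl_sets) (simp add: approx_def)
      fix \<epsilon> :: real assume "\<epsilon> > 0"
      then obtain N B where "dist (?E a) (cyl N B) < \<epsilon>"
        using Compl.IH unfolding approx_def by blast
      then show "\<exists>N B. dist (space \<Omega> - ?E a) (cyl N B) < \<epsilon>"
        using dist[of N B] by (intro exI[of _ N] exI[of _ "- B"]) simp
    qed
  next
    case (Union a)
    have [measurable]: "?E (a i) \<in> sets \<Omega>" for i
      using Union.IH by (simp add: approx_def)
    have fin: "approx (\<Union>i<n. ?E (a i))" for n
    proof (induction n)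
      case 0
      show ?case using approx_cyl[of 0 "{}"] by (simp add: cyl_empty)
    next
      case (Suc n)
      then show ?case using approx_Un[OF Suc Union.IH[of n]] by (simp add: lessThan_Suc Un_commute)
    qed
    have U: "?E (\<Union>i. a i) = (\<Union>n. \<Union>i<n. ?E (a i))" by auto
    show ?case
      unfolding approx_def
    proof (intro conjI allI impI)
      show "?E (\<Union>i. a i) \<in> sets \<Omega>" unfolding U by measurable
      fix \<epsilon> :: real assume \<epsilon>: "\<epsilon> > 0"
      \<comment> \<open>Continuity from below reduces a countable union to a finite one at the cost
        of half the error; the other half goes to the approximation of the finite union.\<close>
      have "(\<lambda>n. measure \<Omega> (\<Union>i<n. ?E (a i))) \<longlonglongrightarrow> measure \<Omega> (\<Union>n. \<Union>i<n. ?E (a i))"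
      proof (rule finite_Lim_measure_incseq)
        show "range (\<lambda>n. \<Union>i<n. ?E (a i)) \<subseteq> sets \<Omega>"
          by (intro image_subsetI sets.finite_UN) auto
        show "incseq (\<lambda>n. \<Union>i<n. ?E (a i))"
          unfolding incseq_def by (intro allI impI UN_mono) auto
      qed
      from LIMSEQ_D[OF this, of "\<epsilon> / 2"] \<epsilon>
      obtain n where n: "\<bar>measure \<Omega> (\<Union>i<n. ?E (a i)) - measure \<Omega> (?E (\<Union>i. a i))\<bar> < \<epsilon> / 2"
        unfolding U real_norm_def by auto
      have "\<epsilon> / 2 > 0" using \<epsilon> by simp
      then obtain N B where B: "dist (\<Union>i<n. ?E (a i)) (cyl N B) < \<epsilon> / 2"
        using fin[of n] unfolding approx_def by blast
      have "dist (?E (\<Union>i. a i)) (cyl N B) \<le>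
          measure \<Omega> ((?E (\<Union>i. a i) - (\<Union>i<n. ?E (a i))) \<union> {\<omega>\<in>space \<Omega>. (\<omega> \<in> (\<Union>i<n. ?E (a i))) \<noteq> (\<omega> \<in> cyl N B)})"
        unfolding dist_def U by (intro finite_measure_mono) auto
      also have "\<dots> \<le> measure \<Omega> (?E (\<Union>i. a i) - (\<Union>i<n. ?E (a i))) + dist (\<Union>i<n. ?E (a i)) (cyl N B)"
        unfolding dist_def U by (intro measure_Un_le) measurable
      also have "measure \<Omega> (?E (\<Union>i. a i) - (\<Union>i<n. ?E (a i))) = measure \<Omega> (?E (\<Union>i. a i)) - measure \<Omega> (\<Union>i<n. ?E (a i))"
        unfolding U by (intro finite_measure_Diff) auto
      finally have "dist (?E (\<Union>i. a i)) (cyl N B) < \<epsilon>"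
        using n B by linarith
      then show "\<exists>N B. dist (?E (\<Union>i. a i)) (cyl N B) < \<epsilon>" by blast
    qed
  qed
  then obtain N B where "dist (?E A) (cyl N B) < \<epsilon>"
    using \<open>0 < \<epsilon>\<close> unfolding approx_def by blast
  moreover have "{\<omega>\<in>space \<Omega>. (\<omega> \<in> ?E A) \<noteq> (\<omega> \<in> cyl N B)} =
      {\<omega>\<in>space \<Omega>. ((\<lambda>n. Z n \<omega>) \<in> A) \<noteq> (window Z (- int N) (2 * N) \<omega> \<in> B)}"
    by (auto simp: cyl_def)
  ultimately show ?thesis
    unfolding dist_def by auto
qed

lemma runs_shift_measure:
  assumes runs: "runs \<Omega> Z" and "A \<in> sets (Pi\<^sub>M UNIV (\<lambda>_. count_space UNIV))"
  shows "measure \<Omega> {\<omega>\<in>space \<Omega>. (\<lambda>n. Z (n + t) \<omega>) \<in> A} = measure \<Omega> {\<omega>\<in>space \<Omega>. (\<lambda>n. Z n \<omega>) \<in> A}"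
proof -
  have *: "measure \<Omega> {\<omega>\<in>space \<Omega>. (\<lambda>n. Z n \<omega>) \<in> A} = measure (distr \<Omega> (Pi\<^sub>M UNIV (\<lambda>_. count_space UNIV)) (\<lambda>\<omega> n. Z n \<omega>)) A"
    if "runs \<Omega> Z" for Z
  proof -
    note [measurable] = runs_measurable[OF that]
    have "(\<lambda>\<omega> n. Z n \<omega>) \<in> \<Omega> \<rightarrow>\<^sub>M Pi\<^sub>M UNIV (\<lambda>_. count_space UNIV)"
      by (intro measurable_PiM_single') auto
    then show ?thesis
      using assms by (subst measure_distr) (auto intro!: arg_cong[where f="measure \<Omega>"])
  qed
  show ?thesis
    using *[OF runs] *[OF runs_shift[OF runs, of t]] runs_path_unique[OF runs runs_shift[OF runs, of t]] by simp
qed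

lemma shift_invariant_iff:
  fixes A :: "(int \<Rightarrow> 'b) set"
  assumes "(\<lambda>z n. z (n + 1)) -` A = A"
  shows "(\<lambda>n. z (n + t)) \<in> A \<longleftrightarrow> z \<in> A"
proof -
  have 1: "(\<lambda>n. z (n + 1)) \<in> A \<longleftrightarrow> z \<in> A" for z
    using assms by auto
  show ?thesis
  proof (induction t arbitrary: z rule: int_induct[where k=0])
    case (step1 i)
    then show ?case using 1[of "\<lambda>n. z (n + i)"] by (simp add: ac_simps)
  next
    case (step2 i)
    then show ?case using 1[of "\<lambda>n. z (n + (i - 1))"] by (simp add: algebra_simps)
  qed simp
qed

text \<open>By invariance and stationarity, the intersection with a regeneration at any time
  \<open>t\<close> is as negligible as at time 0. Some regeneration occurs almost surely, so nothing
  is left of the event.\<close>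

lemma invariant_null:
  assumes runs: "runs \<Omega> Z" and A: "A \<in> sets (Pi\<^sub>M UNIV (\<lambda>_. count_space UNIV))"
    and inv: "(\<lambda>z n. z (n + 1)) -` A = A"
    and null: "measure \<Omega> {\<omega>\<in>space \<Omega>. (\<lambda>n. Z n \<omega>) \<in> A \<and> Z 0 \<omega> \<in> regen} = 0"
  shows "measure \<Omega> {\<omega>\<in>space \<Omega>. (\<lambda>n. Z n \<omega>) \<in> A} = 0"
proof -
  interpret prob_space \<Omega> using runs by (simp add: runs_def)
  note [measurable] = runs_measurable[OF runs] A
  have [measurable]: "(\<lambda>\<omega> n. Z n \<omega>) \<in> \<Omega> \<rightarrow>\<^sub>M Pi\<^sub>M UNIV (\<lambda>_. count_space UNIV)"
    by (intro measurable_PiM_single') auto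
  have "AE \<omega> in \<Omega>. \<not> ((\<lambda>n. Z n \<omega>) \<in> A \<and> Z t \<omega> \<in> regen)" for t
  proof -
    have "A \<inter> {z. z 0 \<in> regen} \<in> sets (Pi\<^sub>M UNIV (\<lambda>_. count_space UNIV))"
    proof -
      have "{z\<in>space (Pi\<^sub>M UNIV (\<lambda>_. count_space UNIV)). z (0::int) \<in> regen} \<in> sets (Pi\<^sub>M UNIV (\<lambda>_. count_space UNIV))"
        by measurable
      then show ?thesis using A by (simp add: space_PiM)
    qed
    from runs_shift_measure[OF runs this, of t]
    have "measure \<Omega> {\<omega>\<in>space \<Omega>. (\<lambda>n. Z n \<omega>) \<in> A \<and> Z t \<omega> \<in> regen} = 0"
      using null shift_invariant_iff[OF inv, of "\<lambda>n. Z n \<omega>" t for \<omega>] by simp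
    then have "emeasure \<Omega> {\<omega>\<in>space \<Omega>. (\<lambda>n. Z n \<omega>) \<in> A \<and> Z t \<omega> \<in> regen} = 0"
      by (simp add: emeasure_eq_measure)
    then show ?thesis
      by (subst AE_iff_measurable[OF _ refl]) auto
  qed
  then have "AE \<omega> in \<Omega>. \<forall>t. \<not> ((\<lambda>n. Z n \<omega>) \<in> A \<and> Z t \<omega> \<in> regen)"
    by (subst AE_all_countable) blast
  then have "AE \<omega> in \<Omega>. (\<lambda>n. Z n \<omega>) \<notin> A"
    using runs_hits_regen[OF runs] by eventually_elim blast
  then show ?thesis
    by (subst (asm) AE_iff_measurable[OF _ refl]) (auto simp: measure_def)
qed

text \<open>
  An invariant event is close both to an event of the past and to an event of the future; these are
  conditionally independent given that a regeneration is due at time 0.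
\<close>

lemma invariant_0_1:
  assumes runs: "runs \<Omega> Z" and A: "A \<in> sets (Pi\<^sub>M UNIV (\<lambda>_. count_space UNIV))"
    and inv: "(\<lambda>z n. z (n + 1)) -` A = A"
  shows "measure \<Omega> {\<omega>\<in>space \<Omega>. (\<lambda>n. Z n \<omega>) \<in> A} \<in> {0, 1}"
proof -
  interpret prob_space \<Omega> using runs by (simp add: runs_def)
  note Z [measurable] = runs_measurable[OF runs] and [measurable] = A
  have path [measurable]: "(\<lambda>\<omega> n. Z n \<omega>) \<in> \<Omega> \<rightarrow>\<^sub>M Pi\<^sub>M UNIV (\<lambda>_. count_space UNIV)"
    by (intro measurable_PiM_single') auto
  define E where "E = {\<omega>\<in>space \<Omega>. (\<lambda>n. Z n \<omega>) \<in> A}"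
  define R where "R = {\<omega>\<in>space \<Omega>. Z 0 \<omega> \<in> regen}"
  have [measurable]: "E \<in> sets \<Omega>" "R \<in> sets \<Omega>"
    unfolding E_def R_def by measurable
  define p r where "p = measure \<Omega> (E \<inter> R)" and "r = measure \<Omega> R"
  have close: "\<bar>measure \<Omega> X - measure \<Omega> Y\<bar> \<le> measure \<Omega> D"
    if "X - Y \<subseteq> D" "Y - X \<subseteq> D" "X \<in> sets \<Omega>" "Y \<in> sets \<Omega>" "D \<in> sets \<Omega>" for X Y D
  proof -
    have "measure \<Omega> X \<le> measure \<Omega> (Y \<union> D)" "measure \<Omega> Y \<le> measure \<Omega> (X \<union> D)"
      using that by (auto intro!: finite_measure_mono)
    moreover have "measure \<Omega> (Y \<union> D) \<le> measure \<Omega> Y + measure \<Omega> D" "measure \<Omega> (X \<union> D) \<le> measure \<Omega> X + measure \<Omega> D"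
      using that by (auto intro!: measure_Un_le)
    ultimately show ?thesis by linarith
  qed
  have "\<bar>p * r - p * p\<bar> \<le> 4 * \<epsilon>" if \<epsilon>: "\<epsilon> > 0" for \<epsilon>
  proof -
    obtain N B where NB: "measure \<Omega> {\<omega>\<in>space \<Omega>. ((\<lambda>n. Z n \<omega>) \<in> A) \<noteq> (window Z (- int N) (2 * N) \<omega> \<in> B)} < \<epsilon>"
      using window_approx[OF prob_space_axioms, of Z A \<epsilon>] Z A \<epsilon> by blast
    define D where "D t = {\<omega>\<in>space \<Omega>. (\<omega> \<in> E) \<noteq> (window Z (t - int N) (2 * N) \<omega> \<in> B)}" for t
    have D_meas [measurable]: "D t \<in> sets \<Omega>" for t
      unfolding D_def by measurable
    \<comment> \<open>As the event is invariant and the process stationary, the same window shifted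
      to any centre \<open>t\<close> approximates equally well.\<close>
    have D: "measure \<Omega> (D t) < \<epsilon>" for t
    proof -
      let ?D = "{z. (z \<in> A) \<noteq> (window (\<lambda>n z. z n) (- int N) (2 * N) z \<in> B)}"
      have "{z\<in>space (Pi\<^sub>M UNIV (\<lambda>_. count_space UNIV)). (z \<in> A) \<noteq> (window (\<lambda>n z. z n) (- int N) (2 * N) z \<in> B)} \<in> sets (Pi\<^sub>M UNIV (\<lambda>_. count_space UNIV))"
        by measurable
      then have "?D \<in> sets (Pi\<^sub>M UNIV (\<lambda>_. count_space UNIV))"
        by (simp add: space_PiM)
      from runs_shift_measure[OF runs this, of t]
      have "measure \<Omega> {\<omega>\<in>space \<Omega>. ((\<lambda>n. Z (n + t) \<omega>) \<in> A) \<noteq> (window (\<lambda>n z. z n) (- int N) (2 * N) (\<lambda>n. Z (n + t) \<omega>) \<in> B)} < \<epsilon>"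
        using NB by (simp add: window_def)
      moreover have "window (\<lambda>n z. z n) (- int N) (2 * N) (\<lambda>n. Z (n + t) \<omega>) = window Z (t - int N) (2 * N) \<omega>" for \<omega>
        by (rule nth_equalityI) (auto simp: nth_window algebra_simps)
      ultimately show ?thesis
        using shift_invariant_iff[OF inv, of "\<lambda>n. Z n \<omega>" t for \<omega>] by (simp add: D_def E_def cong: conj_cong)
    qed
    \<comment> \<open>The centres are \<open>- int N\<close> and \<open>1 + int N\<close>: the first
      window ends at time 0 and the second starts at time 1, so that the state at time 0 separates
      them.\<close>
    define U where "U = {\<omega>\<in>space \<Omega>. window Z (0 - int (2 * N)) (2 * N) \<omega> \<in> B}"
    define V where "V = {\<omega>\<in>space \<Omega>. window Z (0 + 1) (2 * N) \<omega> \<in> B}"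
    have [measurable]: "U \<in> sets \<Omega>" "V \<in> sets \<Omega>"
      unfolding U_def V_def by measurable
    obtain c where c: "\<And>n B'. measure \<Omega> {\<omega>\<in>space \<Omega>. window Z (0 - int n) n \<omega> \<in> B' \<and> Z 0 \<omega> \<in> regen \<and> window Z (0 + 1) (2 * N) \<omega> \<in> B} =
        c * measure \<Omega> {\<omega>\<in>space \<Omega>. window Z (0 - int n) n \<omega> \<in> B' \<and> Z 0 \<omega> \<in> regen}"
      using runs_regen_split[OF runs, where lo=0 and m="2 * N" and B'=B] by blast
    have "measure \<Omega> (U \<inter> R \<inter> V) = c * measure \<Omega> (U \<inter> R)"
      using c[of "2 * N" B] by (simp add: U_def R_def V_def Int_def conj_ac cong: conj_cong)
    \<comment> \<open>The same \<open>c\<close> with a trivial past gives the mass of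
      \<open>V\<close> within \<open>R\<close>, which eliminates \<open>c\<close>.\<close>
    moreover have "measure \<Omega> (R \<inter> V) = c * r"
      using c[of 0 UNIV] by (simp add: r_def R_def V_def Int_def conj_ac cong: conj_cong)
    ultimately have indep: "measure \<Omega> (U \<inter> R \<inter> V) * r = measure \<Omega> (U \<inter> R) * measure \<Omega> (R \<inter> V)"
      by simp
    have DU: "E - U \<subseteq> D (- int N)" "U - E \<subseteq> D (- int N)"
      using sets.sets_into_space[OF \<open>E \<in> sets \<Omega>\<close>] by (auto simp: D_def U_def)
    have DV: "E - V \<subseteq> D (1 + int N)" "V - E \<subseteq> D (1 + int N)"
      using sets.sets_into_space[OF \<open>E \<in> sets \<Omega>\<close>] by (auto simp: D_def V_def)
    have 1: "\<bar>measure \<Omega> (U \<inter> R) - p\<bar> \<le> \<epsilon>"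
      unfolding p_def using DU D[of "- int N"] by (intro order_trans[OF close[of _ _ "D (- int N)"]]) auto
    have 2: "\<bar>measure \<Omega> (R \<inter> V) - p\<bar> \<le> \<epsilon>"
      unfolding p_def using DV D[of "1 + int N"] by (intro order_trans[OF close[of _ _ "D (1 + int N)"]]) auto
    have 3: "\<bar>measure \<Omega> (U \<inter> R \<inter> V) - p\<bar> \<le> 2 * \<epsilon>"
    proof -
      have "\<bar>measure \<Omega> (U \<inter> R \<inter> V) - p\<bar> \<le> measure \<Omega> (D (- int N) \<union> D (1 + int N))"
        unfolding p_def using DU DV by (intro close) auto
      also have "\<dots> \<le> measure \<Omega> (D (- int N)) + measure \<Omega> (D (1 + int N))"
        by (intro measure_Un_le) auto
      finally show ?thesis using D[of "- int N"] D[of "1 + int N"] by linarith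
    qed
    have bounds: "0 \<le> r" "r \<le> 1" "0 \<le> p" "p \<le> 1" "measure \<Omega> (R \<inter> V) \<le> 1" "0 \<le> measure \<Omega> (R \<inter> V)"
      by (auto simp: r_def p_def)
    \<comment> \<open>Each of the three probabilities in the product formula is replaced in turn by
      its limit, with errors \<open>2 * \<epsilon>\<close>, \<epsilon> and \<epsilon>.\<close>
    have "p * r - p * p = (p - measure \<Omega> (U \<inter> R \<inter> V)) * r + (measure \<Omega> (U \<inter> R) - p) * measure \<Omega> (R \<inter> V) + p * (measure \<Omega> (R \<inter> V) - p)"
      using indep by (simp add: algebra_simps)
    also have "\<bar>\<dots>\<bar> \<le> \<bar>p - measure \<Omega> (U \<inter> R \<inter> V)\<bar> * r + \<bar>measure \<Omega> (U \<inter> R) - p\<bar> * measure \<Omega> (R \<inter> V) + p * \<bar>measure \<Omega> (R \<inter> V) - p\<bar>"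
      using bounds by (simp add: abs_mult order_trans[OF abs_triangle_ineq] add_mono)
    also have "\<dots> \<le> 2 * \<epsilon> * 1 + \<epsilon> * 1 + 1 * \<epsilon>"
      using 1 2 3 bounds \<epsilon> by (intro add_mono mult_mono) (auto simp: abs_minus_commute)
    finally show ?thesis by simp
  qed
  note small = this
  have "p * r = p * p"
  proof (rule ccontr)
    assume "p * r \<noteq> p * p"
    moreover have False if "0 < d / 8" "d \<le> 4 * (d / 8)" for d :: real
      using that by linarith
    ultimately show False
      using small[of "\<bar>p * r - p * p\<bar> / 8"] by simp
  qed
  \<comment> \<open>The event is null or of full mass within \<open>R\<close>;
    \<open>invariant_null\<close>, for the event or for its complement, carries this over to the
    whole space.\<close>
  then consider "p = 0" | "p = r" by auto
  then show ?thesis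
  proof cases
    case 1
    then have "measure \<Omega> {\<omega>\<in>space \<Omega>. (\<lambda>n. Z n \<omega>) \<in> A \<and> Z 0 \<omega> \<in> regen} = 0"
      by (simp add: p_def E_def R_def Int_def conj_ac cong: conj_cong)
    then show ?thesis using invariant_null[OF runs A inv] by simp
  next
    case 2
    have "measure \<Omega> {\<omega>\<in>space \<Omega>. (\<lambda>n. Z n \<omega>) \<in> - A \<and> Z 0 \<omega> \<in> regen} = measure \<Omega> (R - E \<inter> R)"
      by (intro arg_cong[where f="measure \<Omega>"]) (auto simp: E_def R_def)
    also have "\<dots> = r - p"
      unfolding r_def p_def by (intro finite_measure_Diff) auto
    finally have "measure \<Omega> {\<omega>\<in>space \<Omega>. (\<lambda>n. Z n \<omega>) \<in> - A} = 0"
      using sets.compl_sets[OF A] inv 2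
      by (intro invariant_null[OF runs]) (auto simp: space_PiM Compl_eq_Diff_UNIV)
    moreover have "measure \<Omega> {\<omega>\<in>space \<Omega>. (\<lambda>n. Z n \<omega>) \<in> - A} = 1 - measure \<Omega> E"
      using prob_compl[OF \<open>E \<in> sets \<Omega>\<close>] by (simp add: E_def set_diff_eq Compl_iff cong: conj_cong)
    ultimately show ?thesis by (simp add: E_def)
  qed
qed

end

text \<open>The marked path is a coordinatewise image of the path of states and so commutes with the
  shift. An invariant event of marked paths therefore pulls back to an invariant event of
  states.\<close>

lemma (in paused_grid) ergodic:
  assumes runs: "runs \<Omega> Z"
  shows "ergodic_process \<Omega> (marked_space S) (marked (value_at Z) (moves Z))"
  unfolding ergodic_process_def
proof (intro ballI impI)
  note Z = runs_measurable[OF runs]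
  let ?\<phi> = "\<lambda>z n. (val (fst (z n)), snd (z n) = (0::nat))"
  have \<phi>: "?\<phi> \<in> Pi\<^sub>M UNIV (\<lambda>_. count_space UNIV) \<rightarrow>\<^sub>M Pi\<^sub>M (UNIV :: int set) (\<lambda>_. marked_space S)"
    by (rule measurable_PiM_single', rule measurable_compose[OF _ mark_measurable])
       (auto simp: space_pair_measure space_restrict_space)
  have path: "(\<lambda>\<omega> n. Z n \<omega>) \<in> \<Omega> \<rightarrow>\<^sub>M Pi\<^sub>M UNIV (\<lambda>_. count_space UNIV)"
    using Z by (intro measurable_PiM_single') auto
  fix A assume A: "A \<in> sets (Pi\<^sub>M UNIV (\<lambda>_::int. marked_space S))"
    and inv: "(\<lambda>z n. z (n + 1)) -` A \<inter> space (Pi\<^sub>M UNIV (\<lambda>_. marked_space S)) = A"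
  have space: "?\<phi> z \<in> space (Pi\<^sub>M UNIV (\<lambda>_. marked_space S))" for z
    by (auto simp: space_PiM space_pair_measure space_restrict_space)
  have "(\<lambda>z n. z (n + 1)) -` (?\<phi> -` A) = ?\<phi> -` A"
  proof (intro set_eqI)
    fix z
    have "?\<phi> z \<in> A \<longleftrightarrow> (\<lambda>n. ?\<phi> z (n + 1)) \<in> A"
    proof -
      have "?\<phi> z \<in> A \<longleftrightarrow> ?\<phi> z \<in> (\<lambda>z n. z (n + 1)) -` A \<inter> space (Pi\<^sub>M UNIV (\<lambda>_. marked_space S))"
        by (simp only: inv)
      then show ?thesis
        by (simp only: space vimage_eq Int_iff simp_thms)
    qed
    then show "z \<in> (\<lambda>z n. z (n + 1)) -` (?\<phi> -` A) \<longleftrightarrow> z \<in> ?\<phi> -` A" by simp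
  qed
  moreover have A': "?\<phi> -` A \<in> sets (Pi\<^sub>M UNIV (\<lambda>_. count_space UNIV))"
    using measurable_sets[OF \<phi> A] by (simp add: space_PiM)
  ultimately have "measure \<Omega> {\<omega>\<in>space \<Omega>. (\<lambda>n. Z n \<omega>) \<in> ?\<phi> -` A} \<in> {0, 1}"
    by (intro invariant_0_1[OF runs])
  also have "measure \<Omega> {\<omega>\<in>space \<Omega>. (\<lambda>n. Z n \<omega>) \<in> ?\<phi> -` A} = measure (path_law \<Omega> (marked_space S) (marked (value_at Z) (moves Z))) A"
    unfolding path_law_marked[OF runs] distr_distr[OF \<phi> path]
    by (subst measure_distr[OF measurable_comp[OF path \<phi>] A])
       (auto intro!: arg_cong[where f="measure \<Omega>"])
  finally show "measure (path_law \<Omega> (marked_space S) (marked (value_at Z) (moves Z))) A \<in> {0, 1}" .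
qed

section \<open>Two-sided stationary process\<close>

context atomic_chain begin

text \<open>States are coded as reals because the extension theorem needs a Polish space.\<close>

definition enc :: "nat \<times> nat \<Rightarrow> real" where "enc s = real (to_nat s)"

definition dec :: "real \<Rightarrow> nat \<times> nat" where "dec r = from_nat (nat \<lfloor>r\<rfloor>)"

lemma dec_enc [simp]: "dec (enc s) = s"
  by (simp add: dec_def enc_def)

lemma dec_measurable [measurable]: "dec \<in> borel \<rightarrow>\<^sub>M count_space UNIV"
  unfolding dec_def by measurable

definition radius :: "int set \<Rightarrow> nat" where
  "radius J = Max (insert 0 ((\<lambda>i. nat \<bar>i\<bar>) ` J))"

lemma radius_ge:
  assumes "finite J" "i \<in> J"
  shows "- int (radius J) \<le> i" "i \<le> int (radius J)"
proof -
  have "nat \<bar>i\<bar> \<le> radius J"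
    unfolding radius_def using assms by (intro Max_ge) auto
  then show "- int (radius J) \<le> i" "i \<le> int (radius J)"
    by auto
qed

lemma radius_mono: "J \<subseteq> H \<Longrightarrow> finite H \<Longrightarrow> radius J \<le> radius H"
  unfolding radius_def by (intro Max_mono) auto

text \<open>A trajectory of \<open>2 * r + 1\<close> states is laid over the times from
  \<open>- r\<close> to \<open>r\<close>, hence the offset \<open>r\<close> in the position.\<close>

definition marginal :: "nat \<Rightarrow> int set \<Rightarrow> (int \<Rightarrow> real) measure" where
  "marginal r J = distr (traj (2 * r)) (Pi\<^sub>M J (\<lambda>_. borel)) (\<lambda>l. \<lambda>i\<in>J. enc (l ! nat (i + int r)))"

text \<open>Cutting the longer trajectory at both ends gives the shorter one in law, so any radius
  that covers \<open>J\<close> yields the same marginal. This is the consistency required by the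
  extension theorem.\<close>

lemma marginal_eq:
  assumes "r \<le> r'" and J: "\<And>i. i \<in> J \<Longrightarrow> - int r \<le> i \<and> i \<le> int r"
  shows "marginal r J = marginal r' J"
proof -
  have "traj (2 * r) = map_pmf (take (Suc (2 * r))) (traj (2 * r + (r' - r)))"
    by (rule take_traj[symmetric])
  also have "2 * r + (r' - r) = r + r'"
    using assms by simp
  also have "traj (r + r') = map_pmf (drop (r' - r)) (traj (r' - r + (r + r')))"
    by (rule drop_traj[symmetric])
  also have "r' - r + (r + r') = 2 * r'"
    using assms by simp
  finally have "marginal r J = distr (map_pmf (\<lambda>l. take (Suc (2 * r)) (drop (r' - r) l)) (traj (2 * r'))) (Pi\<^sub>M J (\<lambda>_. borel))
      (\<lambda>l. \<lambda>i\<in>J. enc (l ! nat (i + int r)))"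
    by (simp add: marginal_def map_pmf_comp)
  also have "\<dots> = distr (traj (2 * r')) (Pi\<^sub>M J (\<lambda>_. borel))
      (\<lambda>l. \<lambda>i\<in>J. enc (take (Suc (2 * r)) (drop (r' - r) l) ! nat (i + int r)))"
    unfolding map_pmf_rep_eq by (subst distr_distr) (auto simp: space_PiM comp_def)
  also have "\<dots> = marginal r' J"
    unfolding marginal_def
  proof (rule distr_cong_AE)
    show "AE l in traj (2 * r'). (\<lambda>i\<in>J. enc (take (Suc (2 * r)) (drop (r' - r) l) ! nat (i + int r))) =
        (\<lambda>i\<in>J. enc (l ! nat (i + int r')))"
    proof (unfold AE_measure_pmf_iff, intro ballI ext)
      fix l i assume l: "l \<in> set_pmf (traj (2 * r'))"
      show "(\<lambda>i\<in>J. enc (take (Suc (2 * r)) (drop (r' - r) l) ! nat (i + int r))) i = (\<lambda>i\<in>J. enc (l ! nat (i + int r'))) i"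
      proof (cases "i \<in> J")
        case True
        with J[of i] have "nat (i + int r) < Suc (2 * r)" "r' - r + nat (i + int r) = nat (i + int r')"
          using \<open>r \<le> r'\<close> by auto
        then show ?thesis
          using True length_traj[OF l] \<open>r \<le> r'\<close> by simp
      qed simp
    qed
  qed (auto simp: space_PiM)
  finally show ?thesis .
qed

lemma two_sided:
  obtains \<nu> :: "(int \<Rightarrow> real) measure"
  where "sets \<nu> = sets (Pi\<^sub>M UNIV (\<lambda>_. borel))" and "runs \<nu> (\<lambda>n z. dec (z n))"
proof -
  define P where "P J = marginal (radius J) J" for J
  have prob: "prob_space (P J)" for J
    unfolding P_def marginal_def by (intro measure_pmf.prob_space_distr) (simp add: space_PiM)
  have consistent: "P J = distr (P H) (Pi\<^sub>M J (\<lambda>_. borel)) (\<lambda>f. restrict f J)" if "J \<subseteq> H" "finite H" for J H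
  proof -
    have "P J = marginal (radius H) J"
      unfolding P_def using that radius_mono[OF that] finite_subset[OF that]
      by (intro marginal_eq) (auto intro: radius_ge)
    also have "\<dots> = distr (P H) (Pi\<^sub>M J (\<lambda>_. borel)) (\<lambda>f. restrict f J)"
    proof -
      have "(\<lambda>f. restrict f J) \<in> Pi\<^sub>M H (\<lambda>_. borel) \<rightarrow>\<^sub>M Pi\<^sub>M J (\<lambda>_. borel)"
        using that by (intro measurable_restrict_subset) auto
      then show ?thesis
        unfolding P_def marginal_def using that
        by (subst distr_distr) (auto simp: space_PiM comp_def Int_absorb1 intro!: distr_cong)
    qed
    finally show ?thesis .
  qed
  interpret L: polish_projective "UNIV :: int set" P
    by (intro polish_projective.intro projective_family.intro prob) (rule consistent)
  have [measurable_cong]: "sets L.lim = sets (Pi\<^sub>M UNIV (\<lambda>_. borel))"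
    by (rule L.sets_lim)
  have marg: "distr L.lim (Pi\<^sub>M J (\<lambda>_. borel)) (\<lambda>z. restrict z J) = P J" if J: "finite J" for J
  proof (rule measure_eqI)
    fix X assume X: "X \<in> sets (distr L.lim (Pi\<^sub>M J (\<lambda>_. borel)) (\<lambda>z. restrict z J))"
    have "emeasure (distr L.lim (Pi\<^sub>M J (\<lambda>_. borel)) (\<lambda>z. restrict z J)) X = emeasure L.lim (prod_emb UNIV (\<lambda>_. borel) J X)"
      using X by (subst emeasure_distr) (auto simp: prod_emb_def L.space_lim space_PiM intro!: measurable_restrict)
    also have "\<dots> = emeasure (P J) X"
      using X J by (intro L.emeasure_lim_emb) auto
    finally show "emeasure (distr L.lim (Pi\<^sub>M J (\<lambda>_. borel)) (\<lambda>z. restrict z J)) X = emeasure (P J) X" .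
  qed (simp add: P_def marginal_def)
  have "runs L.lim (\<lambda>n z. dec (z n))"
  proof (rule runsI)
    show "prob_space L.lim" by (rule L.P.prob_space_axioms)
    show "(\<lambda>z. dec (z n)) \<in> L.lim \<rightarrow>\<^sub>M count_space UNIV" for n by measurable
    fix m n :: nat
    define J where "J = {- int m..int n}"
    define r where "r = m + n"
    have J: "finite J" by (simp add: J_def)
    let ?W = "window (\<lambda>n z. dec (z n)) (- int m) (m + n) :: (int \<Rightarrow> real) \<Rightarrow> _"
    have W: "?W \<in> Pi\<^sub>M J (\<lambda>_. borel) \<rightarrow>\<^sub>M count_space UNIV"
    proof -
      \<comment> \<open>The window reads only times in \<open>J\<close>. Elsewhere a dummy state is
        substituted, because measurability of a window is available for processes measurable at all
        integer times.\<close>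
      define Z where "Z i z = (if i \<in> J then dec (z i) else (0, 0))" for i and z :: "int \<Rightarrow> real"
      have "window Z (- int m) (m + n) \<in> Pi\<^sub>M J (\<lambda>_. borel) \<rightarrow>\<^sub>M count_space UNIV"
      proof (rule measurable_window)
        show "Z i \<in> Pi\<^sub>M J (\<lambda>_. borel) \<rightarrow>\<^sub>M count_space UNIV" for i
          unfolding Z_def by (cases "i \<in> J") simp_all
      qed
      moreover have "window Z (- int m) (m + n) = ?W"
        by (auto simp: window_def Z_def J_def fun_eq_iff)
      ultimately show ?thesis by simp
    qed
    have "distr L.lim (count_space UNIV) ?W = distr L.lim (count_space UNIV) (\<lambda>z. ?W (restrict z J))"
      by (intro distr_cong refl) (auto simp: window_def J_def)
    also have "\<dots> = distr (P J) (count_space UNIV) ?W"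
      unfolding marg[OF J, symmetric] using W by (subst distr_distr) (auto simp: comp_def intro!: measurable_restrict)
    also have "P J = marginal r J"
    proof -
      \<comment> \<open>The radius of \<open>J\<close> and \<open>r\<close> are compared through
        their maximum, as both cover \<open>J\<close>.\<close>
      have "P J = marginal (max r (radius J)) J"
        unfolding P_def by (rule marginal_eq) (auto intro: radius_ge[OF J])
      also have "\<dots> = marginal r J"
        by (rule marginal_eq[symmetric]) (auto simp: J_def r_def)
      finally show ?thesis .
    qed
    also have "distr (marginal r J) (count_space UNIV) ?W = distr (traj (2 * r)) (count_space UNIV) (\<lambda>l. take (Suc (m + n)) (drop n l))"
      unfolding marginal_def
    proof (subst distr_distr[OF W], simp add: space_PiM, rule distr_cong_AE)
      show "AE l in traj (2 * r). (?W \<circ> (\<lambda>l. \<lambda>i\<in>J. enc (l ! nat (i + int r)))) l = take (Suc (m + n)) (drop n l)"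
        unfolding AE_measure_pmf_iff
      proof
        fix l assume "l \<in> set_pmf (traj (2 * r))"
        from length_traj[OF this]
        show "(?W \<circ> (\<lambda>l. \<lambda>i\<in>J. enc (l ! nat (i + int r)))) l = take (Suc (m + n)) (drop n l)"
          by (intro nth_equalityI) (auto simp: nth_window J_def r_def nat_add_distrib nat_diff_distrib add.commute)
      qed
    qed simp_all
    also have "\<dots> = measure_pmf (map_pmf (\<lambda>l. take (Suc (m + n)) (drop n l)) (traj (2 * r)))"
      by (simp add: map_pmf_rep_eq)
    also have "map_pmf (\<lambda>l. take (Suc (m + n)) (drop n l)) (traj (2 * r)) = map_pmf (take (Suc (m + n))) (map_pmf (drop n) (traj (n + (m + n + m))))"
    proof -
      have "2 * r = n + (m + n + m)" by (simp add: r_def)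
      then show ?thesis by (simp only: map_pmf_comp)
    qed
    also have "\<dots> = traj (m + n)"
      by (simp only: drop_traj take_traj)
    finally show "distr L.lim (count_space UNIV) ?W = measure_pmf (traj (m + n))" .
  qed
  then show ?thesis
    using that L.sets_lim by blast
qed

end

section \<open>The law of the chain\<close>

lemma measurable_chain_path [measurable]:
  assumes P [measurable]: "P \<in> M \<rightarrow>\<^sub>M prob_algebra M"
  shows "chain_path M P n \<in> M \<rightarrow>\<^sub>M prob_algebra (Pi\<^sub>M {..n} (\<lambda>_. M))"
proof (induction n)
  case 0
  have "(\<lambda>x. \<lambda>i\<in>{..0::nat}. x) \<in> M \<rightarrow>\<^sub>M Pi\<^sub>M {..0} (\<lambda>_. M)"
    by (intro measurable_restrict) simp
  from measurable_compose[OF this measurable_return_prob_space] show ?case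
    by (simp add: fun_eq_iff[symmetric] cong: measurable_cong)
next
  case (Suc n)
  have "(\<lambda>(\<omega>, y). fun_upd \<omega> (Suc n) y) \<in> Pi\<^sub>M {..n} (\<lambda>_. M) \<Otimes>\<^sub>M M \<rightarrow>\<^sub>M Pi\<^sub>M {..Suc n} (\<lambda>_. M)"
    unfolding split_beta by (rule measurable_fun_upd[where J="{..n}"]) auto
  then have "(\<lambda>\<omega>. distr (P (\<omega> n)) (Pi\<^sub>M {..Suc n} (\<lambda>_. M)) (\<lambda>y. fun_upd \<omega> (Suc n) y))
      \<in> Pi\<^sub>M {..n} (\<lambda>_. M) \<rightarrow>\<^sub>M prob_algebra (Pi\<^sub>M {..Suc n} (\<lambda>_. M))"
    by (intro measurable_distr_prob_space2[where M=M] measurable_compose[OF _ P]) auto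
  then show ?case
    by (simp add: measurable_bind_prob_space[OF Suc])
qed

lemma
  assumes P: "P \<in> M \<rightarrow>\<^sub>M prob_algebra M" and x: "x \<in> space M"
  shows prob_space_chain_path: "prob_space (chain_path M P n x)"
    and sets_chain_path: "sets (chain_path M P n x) = sets (Pi\<^sub>M {..n} (\<lambda>_. M))"
  using measurable_space[OF measurable_chain_path[OF P] x] by (auto simp: space_prob_algebra)

lemma nn_integral_chain_path_Suc:
  assumes P [measurable]: "P \<in> M \<rightarrow>\<^sub>M prob_algebra M" and x: "x \<in> space M"
    and f [measurable]: "f \<in> borel_measurable (Pi\<^sub>M {..Suc n} (\<lambda>_. M))"
  shows "(\<integral>\<^sup>+s. f s \<partial>chain_path M P (Suc n) x) =
    (\<integral>\<^sup>+s. (\<integral>\<^sup>+y. f (s(Suc n := y)) \<partial>P (s n)) \<partial>chain_path M P n x)"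
proof -
  have upd: "(\<lambda>(\<omega>, y). fun_upd \<omega> (Suc n) y) \<in> Pi\<^sub>M {..n} (\<lambda>_. M) \<Otimes>\<^sub>M M \<rightarrow>\<^sub>M Pi\<^sub>M {..Suc n} (\<lambda>_. M)"
    unfolding split_beta by (rule measurable_fun_upd[where J="{..n}"]) auto
  have "(\<lambda>\<omega>. distr (P (\<omega> n)) (Pi\<^sub>M {..Suc n} (\<lambda>_. M)) (\<lambda>y. fun_upd \<omega> (Suc n) y))
      \<in> Pi\<^sub>M {..n} (\<lambda>_. M) \<rightarrow>\<^sub>M prob_algebra (Pi\<^sub>M {..Suc n} (\<lambda>_. M))"
    using upd by (intro measurable_distr_prob_space2[where M=M] measurable_compose[OF _ P]) auto
  then have K: "(\<lambda>\<omega>. distr (P (\<omega> n)) (Pi\<^sub>M {..Suc n} (\<lambda>_. M)) (\<lambda>y. fun_upd \<omega> (Suc n) y))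
      \<in> chain_path M P n x \<rightarrow>\<^sub>M subprob_algebra (Pi\<^sub>M {..Suc n} (\<lambda>_. M))"
    by (subst measurable_cong_sets[OF sets_chain_path[OF P x] refl]) (rule measurable_prob_algebraD)
  have "(\<integral>\<^sup>+s. f s \<partial>chain_path M P (Suc n) x) =
      (\<integral>\<^sup>+s. (\<integral>\<^sup>+y. f y \<partial>distr (P (s n)) (Pi\<^sub>M {..Suc n} (\<lambda>_. M)) (\<lambda>y. fun_upd s (Suc n) y)) \<partial>chain_path M P n x)"
    by (simp add: nn_integral_bind[OF f K])
  also have "\<dots> = (\<integral>\<^sup>+s. (\<integral>\<^sup>+y. f (s(Suc n := y)) \<partial>P (s n)) \<partial>chain_path M P n x)"
  proof (intro nn_integral_cong nn_integral_distr f)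
    fix s assume "s \<in> space (chain_path M P n x)"
    then have s: "s \<in> space (Pi\<^sub>M {..n} (\<lambda>_. M))"
      using sets_eq_imp_space_eq[OF sets_chain_path[OF P x]] by auto
    then have "sets (P (s n)) = sets M"
      using measurable_space[OF P, of "s n"] by (auto simp: space_PiM space_prob_algebra)
    then show "(\<lambda>y. s(Suc n := y)) \<in> P (s n) \<rightarrow>\<^sub>M Pi\<^sub>M {..Suc n} (\<lambda>_. M)"
      using measurable_compose[OF measurable_Pair1'[OF s] upd] by (simp cong: measurable_cong_sets)
  qed (simp add: f)
  finally show ?thesis .
qed

text \<open>The last clause is the Markov property for whole segments, starting with the current
  state. The form of a disintegration is chosen since it combines with other independent variables
  by Fubini.\<close>

definition chain_process :: "'a measure \<Rightarrow> 'a measure \<Rightarrow> ('a \<Rightarrow> 'a measure) \<Rightarrow> (nat \<Rightarrow> 'a) measure \<Rightarrow> bool" where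
  "chain_process M \<mu> P \<X> \<longleftrightarrow> prob_space \<X> \<and> sets \<X> = sets (Pi\<^sub>M UNIV (\<lambda>_. M)) \<and>
     distr \<X> M (\<lambda>x. x 0) = \<mu> \<and>
     (\<forall>m k. \<forall>f\<in>borel_measurable (Pi\<^sub>M {..m} (\<lambda>_. M) \<Otimes>\<^sub>M Pi\<^sub>M {..k} (\<lambda>_. M)).
        (\<integral>\<^sup>+x. f (restrict x {..m}, \<lambda>i\<in>{..k}. x (m + i)) \<partial>\<X>) =
        (\<integral>\<^sup>+x. (\<integral>\<^sup>+s. f (restrict x {..m}, s) \<partial>chain_path M P k (x m)) \<partial>\<X>))"

text \<open>Induction on the length of the segment, peeling off its last step: \<open>h\<close> is
  \<open>f\<close> with that step integrated out, and the induction hypothesis is applied to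
  \<open>h\<close>.\<close>

lemma segment_property:
  assumes P [measurable]: "P \<in> M \<rightarrow>\<^sub>M prob_algebra M"
    and X [measurable_cong]: "sets \<X> = sets (Pi\<^sub>M UNIV (\<lambda>_. M))"
    and step: "\<And>n f. f \<in> borel_measurable (Pi\<^sub>M {..Suc n} (\<lambda>_. M)) \<Longrightarrow>
      (\<integral>\<^sup>+x. f (restrict x {..Suc n}) \<partial>\<X>) = (\<integral>\<^sup>+x. (\<integral>\<^sup>+y. f ((restrict x {..n})(Suc n := y)) \<partial>P (x n)) \<partial>\<X>)"
    and f [measurable]: "f \<in> borel_measurable (Pi\<^sub>M {..m} (\<lambda>_. M) \<Otimes>\<^sub>M Pi\<^sub>M {..k} (\<lambda>_. M))"
  shows "(\<integral>\<^sup>+x. f (restrict x {..m}, \<lambda>i\<in>{..k}. x (m + i)) \<partial>\<X>) =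
    (\<integral>\<^sup>+x. (\<integral>\<^sup>+s. f (restrict x {..m}, s) \<partial>chain_path M P k (x m)) \<partial>\<X>)"
  using f
proof (induction k arbitrary: f)
  case (0 f)
  note [measurable] = 0
  have space: "x i \<in> space M" if "x \<in> space \<X>" for x i
    using that sets_eq_imp_space_eq[OF X] by (auto simp: space_PiM)
  show ?case
  proof (intro nn_integral_cong)
    fix x assume x: "x \<in> space \<X>"
    have "(\<lambda>i\<in>{..0::nat}. x (m + i)) = (\<lambda>i\<in>{..0}. x m)" by auto
    moreover have "(\<lambda>i\<in>{..0::nat}. x m) \<in> space (Pi\<^sub>M {..0} (\<lambda>_. M))" "restrict x {..m} \<in> space (Pi\<^sub>M {..m} (\<lambda>_. M))"
      using space[OF x] by (auto simp: space_PiM)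
    ultimately show "f (restrict x {..m}, \<lambda>i\<in>{..0}. x (m + i)) = (\<integral>\<^sup>+s. f (restrict x {..m}, s) \<partial>chain_path M P 0 (x m))"
      unfolding chain_path.simps by (subst nn_integral_return) (simp_all only: measurable_compose[OF measurable_Pair1' 0])
  qed
next
  case (Suc k f)
  note f [measurable] = Suc.prems
  have upd [measurable]: "(\<lambda>(s, y). s(Suc k := y)) \<in> Pi\<^sub>M {..k} (\<lambda>_. M) \<Otimes>\<^sub>M M \<rightarrow>\<^sub>M Pi\<^sub>M {..Suc k} (\<lambda>_. M)"
    unfolding split_beta by (rule measurable_fun_upd[where J="{..k}"]) auto
  define g where "g z = f (restrict z {..m}, \<lambda>i\<in>{..Suc k}. z (m + i))" for z
  have g [measurable]: "g \<in> borel_measurable (Pi\<^sub>M {..Suc (m + k)} (\<lambda>_. M))"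
  proof -
    have "(\<lambda>z. restrict z {..m}) \<in> Pi\<^sub>M {..Suc (m + k)} (\<lambda>_. M) \<rightarrow>\<^sub>M Pi\<^sub>M {..m} (\<lambda>_. M)"
      by (rule measurable_restrict_subset) auto
    moreover have "(\<lambda>z. \<lambda>i\<in>{..Suc k}. z (m + i)) \<in> Pi\<^sub>M {..Suc (m + k)} (\<lambda>_. M) \<rightarrow>\<^sub>M Pi\<^sub>M {..Suc k} (\<lambda>_. M)"
      by (intro measurable_restrict measurable_component_singleton) auto
    ultimately show ?thesis
      unfolding g_def by (intro measurable_compose[OF _ f] measurable_Pair)
  qed
  define h where "h p = (\<integral>\<^sup>+y. f (fst p, (snd p)(Suc k := y)) \<partial>P (snd p k))" for p
  have h: "h \<in> borel_measurable (Pi\<^sub>M {..m} (\<lambda>_. M) \<Otimes>\<^sub>M Pi\<^sub>M {..k} (\<lambda>_. M))"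
  proof -
    have "(\<lambda>(p, y). f (fst p, (snd p)(Suc k := y))) \<in> borel_measurable ((Pi\<^sub>M {..m} (\<lambda>_. M) \<Otimes>\<^sub>M Pi\<^sub>M {..k} (\<lambda>_. M)) \<Otimes>\<^sub>M M)"
    proof -
      have "(\<lambda>p. (\<lambda>(s, y). s(Suc k := y)) (snd (fst p), snd p)) \<in> (Pi\<^sub>M {..m} (\<lambda>_. M) \<Otimes>\<^sub>M Pi\<^sub>M {..k} (\<lambda>_. M)) \<Otimes>\<^sub>M M \<rightarrow>\<^sub>M Pi\<^sub>M {..Suc k} (\<lambda>_. M)"
        by (rule measurable_compose[OF _ upd]) measurable
      then show ?thesis
        unfolding split_beta by (intro measurable_compose[OF _ f] measurable_Pair) simp_all
    qed
    moreover have "(\<lambda>p. P (snd p k)) \<in> Pi\<^sub>M {..m} (\<lambda>_. M) \<Otimes>\<^sub>M Pi\<^sub>M {..k} (\<lambda>_. M) \<rightarrow>\<^sub>M subprob_algebra M"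
      by (rule measurable_prob_algebraD, rule measurable_compose[OF _ P]) measurable
    ultimately show ?thesis
      unfolding h_def by (rule nn_integral_measurable_subprob_algebra2)
  qed
  have "(\<integral>\<^sup>+x. f (restrict x {..m}, \<lambda>i\<in>{..Suc k}. x (m + i)) \<partial>\<X>) = (\<integral>\<^sup>+x. g (restrict x {..Suc (m + k)}) \<partial>\<X>)"
  proof (intro nn_integral_cong)
    fix x :: "nat \<Rightarrow> 'a"
    have "restrict (restrict x {..Suc (m + k)}) {..m} = restrict x {..m}"
      "(\<lambda>i\<in>{..Suc k}. restrict x {..Suc (m + k)} (m + i)) = (\<lambda>i\<in>{..Suc k}. x (m + i))"
      by (auto simp: fun_eq_iff)
    then show "f (restrict x {..m}, \<lambda>i\<in>{..Suc k}. x (m + i)) = g (restrict x {..Suc (m + k)})"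
      by (simp only: g_def)
  qed
  also have "\<dots> = (\<integral>\<^sup>+x. (\<integral>\<^sup>+y. g ((restrict x {..m + k})(Suc (m + k) := y)) \<partial>P (x (m + k))) \<partial>\<X>)"
    by (rule step) simp
  also have "\<dots> = (\<integral>\<^sup>+x. h (restrict x {..m}, \<lambda>i\<in>{..k}. x (m + i)) \<partial>\<X>)"
  proof (intro nn_integral_cong)
    fix x :: "nat \<Rightarrow> 'a"
    have "restrict ((restrict x {..m + k})(Suc (m + k) := y)) {..m} = restrict x {..m}"
      "(\<lambda>i\<in>{..Suc k}. ((restrict x {..m + k})(Suc (m + k) := y)) (m + i)) = (\<lambda>i\<in>{..k}. x (m + i))(Suc k := y)" for y
      by (auto simp: fun_eq_iff)
    then show "(\<integral>\<^sup>+y. g ((restrict x {..m + k})(Suc (m + k) := y)) \<partial>P (x (m + k))) = h (restrict x {..m}, \<lambda>i\<in>{..k}. x (m + i))"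
      by (simp only: g_def h_def fst_conv snd_conv) simp
  qed
  also have "\<dots> = (\<integral>\<^sup>+x. (\<integral>\<^sup>+s. h (restrict x {..m}, s) \<partial>chain_path M P k (x m)) \<partial>\<X>)"
    by (rule Suc.IH[OF h])
  also have "\<dots> = (\<integral>\<^sup>+x. (\<integral>\<^sup>+s. f (restrict x {..m}, s) \<partial>chain_path M P (Suc k) (x m)) \<partial>\<X>)"
  proof (intro nn_integral_cong)
    fix x assume "x \<in> space \<X>"
    then have x: "x \<in> space (Pi\<^sub>M UNIV (\<lambda>_. M))"
      using sets_eq_imp_space_eq[OF X] by simp
    have "restrict x {..m} \<in> space (Pi\<^sub>M {..m} (\<lambda>_. M))" "x m \<in> space M"
      using x by (auto simp: space_PiM)
    then show "(\<integral>\<^sup>+s. h (restrict x {..m}, s) \<partial>chain_path M P k (x m)) = (\<integral>\<^sup>+s. f (restrict x {..m}, s) \<partial>chain_path M P (Suc k) (x m))"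
      by (subst nn_integral_chain_path_Suc[OF P]) (simp_all add: h_def)
  qed
  finally show ?case .
qed

lemma chain_process_exists:
  assumes P: "P \<in> M \<rightarrow>\<^sub>M prob_algebra M" and \<mu>: "\<mu> \<in> space (prob_algebra M)"
  obtains \<X> where "chain_process M \<mu> P \<X>"
proof -
  have \<mu>_prob: "prob_space \<mu>" and \<mu>_sets: "sets \<mu> = sets M"
    using \<mu> by (auto simp: space_prob_algebra)
  \<comment> \<open>Stage 0 draws the initial state; every later stage sees the whole past but uses
    its last coordinate only.\<close>
  define K where "K i \<omega> = (if i = 0 then \<mu> else P (\<omega> (i - 1)))" for i :: nat and \<omega> :: "nat \<Rightarrow> 'a"
  have K: "K i \<in> Pi\<^sub>M {0..<i} (\<lambda>_. M) \<rightarrow>\<^sub>M prob_algebra M" for i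
  proof (cases i)
    case 0
    then have "K i = (\<lambda>_. \<mu>)" by (simp add: K_def fun_eq_iff)
    then show ?thesis using \<mu> by (simp only: measurable_const)
  next
    case (Suc n)
    then have "(\<lambda>\<omega>. \<omega> n) \<in> Pi\<^sub>M {0..<i} (\<lambda>_. M) \<rightarrow>\<^sub>M M" by (intro measurable_component_singleton) auto
    moreover have "K i = (\<lambda>\<omega>. P (\<omega> n))" using Suc by (simp add: K_def fun_eq_iff)
    ultimately show ?thesis using measurable_compose[OF _ P] by simp
  qed
  interpret IT: Ionescu_Tulcea K "\<lambda>_. M"
  proof (rule Ionescu_Tulcea.intro)
    show "K i \<in> Pi\<^sub>M {0..<i} (\<lambda>_. M) \<rightarrow>\<^sub>M subprob_algebra M" for i
      using K by (rule measurable_prob_algebraD)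
    show "prob_space (K i x)" if "x \<in> space (Pi\<^sub>M {0..<i} (\<lambda>_. M))" for i x
      using measurable_space[OF K that] by (simp add: space_prob_algebra)
  qed
  \<comment> \<open>\<open>?u\<close> is the only point of the empty product, the trivial history
    from which the construction starts.\<close>
  let ?X = "IT.PF.lim" and ?u = "\<lambda>_ :: nat. undefined :: 'a"
  have X [measurable_cong]: "sets ?X = sets (Pi\<^sub>M UNIV (\<lambda>_. M))" by simp
  have up_to: "IT.up_to {0..<n} = n" for n
  proof (rule antisym)
    show "IT.up_to {0..<n} \<le> n" by (simp add: IT.up_to_iff)
    show "n \<le> IT.up_to {0..<n}"
      using IT.up_to_less[of "{0..<n}" "n - 1"] by (cases n) auto
  qed
  have u: "?u \<in> space (Pi\<^sub>M {0..<0} (\<lambda>_. M))" by (auto simp: space_PiM)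
  have marg: "distr ?X (Pi\<^sub>M {0..<n} (\<lambda>_. M)) (\<lambda>x. restrict x {0..<n}) = IT.C 0 n ?u" for n
  proof -
    have "distr ?X (Pi\<^sub>M {0..<n} (\<lambda>_. M)) (\<lambda>x. restrict x {0..<n}) = IT.CI {0..<n}"
      by (rule IT.distr_lim) simp
    also have "\<dots> = distr (IT.C 0 n ?u) (Pi\<^sub>M {0..<n} (\<lambda>_. M)) (\<lambda>x. restrict x {0..<n})"
      by (simp add: IT.CI_def up_to)
    also have "\<dots> = IT.C 0 n ?u"
      using IT.distr_C[OF le_refl u, of n] by simp
    finally show ?thesis .
  qed
  have int: "(\<integral>\<^sup>+x. f (restrict x {0..<n}) \<partial>?X) = (\<integral>\<^sup>+z. f z \<partial>IT.C 0 n ?u)"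
    if "f \<in> borel_measurable (Pi\<^sub>M {0..<n} (\<lambda>_. M))" for f :: "_ \<Rightarrow> ennreal" and n
    unfolding marg[symmetric] using that
    by (subst nn_integral_distr) (auto intro!: measurable_restrict_subset)
  have step: "(\<integral>\<^sup>+x. f (restrict x {..Suc n}) \<partial>?X) = (\<integral>\<^sup>+x. (\<integral>\<^sup>+y. f ((restrict x {..n})(Suc n := y)) \<partial>P (x n)) \<partial>?X)"
    if f: "f \<in> borel_measurable (Pi\<^sub>M {..Suc n} (\<lambda>_. M))" for f n
  proof -
    have Ico: "{..Suc n} = {0..<Suc (Suc n)}" "{..n} = {0..<Suc n}" by auto
    have f': "f \<in> borel_measurable (Pi\<^sub>M {0..<Suc (Suc n)} (\<lambda>_. M))" using f by (simp only: Ico)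
    have g: "(\<lambda>z. \<integral>\<^sup>+y. f y \<partial>IT.eP (Suc n) z) \<in> borel_measurable (Pi\<^sub>M {0..<Suc n} (\<lambda>_. M))"
      using nn_integral_measurable_subprob_algebra[OF f'] IT.measurable_eP by (rule measurable_compose[rotated])
    have "(\<integral>\<^sup>+x. f (restrict x {..Suc n}) \<partial>?X) = (\<integral>\<^sup>+z. f z \<partial>IT.C 0 (Suc (Suc n)) ?u)"
      unfolding Ico by (rule int[OF f'])
    also have "\<dots> = (\<integral>\<^sup>+z. (\<integral>\<^sup>+y. f y \<partial>IT.eP (Suc n) z) \<partial>IT.C 0 (Suc n) ?u)"
    proof -
      have "IT.eP (Suc n) \<in> IT.C 0 (Suc n) ?u \<rightarrow>\<^sub>M subprob_algebra (Pi\<^sub>M {0..<Suc (Suc n)} (\<lambda>_. M))"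
        using IT.measurable_eP[of "Suc n"] IT.sets_C[OF u, of "Suc n"] by (simp cong: measurable_cong_sets)
      from nn_integral_bind[OF f' this] show ?thesis
        by (simp only: IT.C.simps add_0)
    qed
    also have "\<dots> = (\<integral>\<^sup>+x. (\<integral>\<^sup>+y. f y \<partial>IT.eP (Suc n) (restrict x {0..<Suc n})) \<partial>?X)"
      by (rule int[OF g, symmetric])
    also have "\<dots> = (\<integral>\<^sup>+x. (\<integral>\<^sup>+y. f ((restrict x {..n})(Suc n := y)) \<partial>P (x n)) \<partial>?X)"
    proof (intro nn_integral_cong)
      fix x assume "x \<in> space ?X"
      then have "restrict x {0..<Suc n} \<in> space (Pi\<^sub>M {0..<Suc n} (\<lambda>_. M))"
        by (auto simp: space_PiM)
      from IT.nn_integral_eP[OF this f']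
      show "(\<integral>\<^sup>+y. f y \<partial>IT.eP (Suc n) (restrict x {0..<Suc n})) = (\<integral>\<^sup>+y. f ((restrict x {..n})(Suc n := y)) \<partial>P (x n))"
        by (simp add: K_def Ico(2)[symmetric] del: restrict_apply) simp
    qed
    finally show ?thesis .
  qed
  have init: "distr ?X M (\<lambda>x. x 0) = \<mu>"
  proof (rule measure_eqI)
    fix A assume A: "A \<in> sets (distr ?X M (\<lambda>x. x 0))"
    then have [measurable]: "A \<in> sets M" by simp
    have f: "(\<lambda>z. indicator A (z 0) :: ennreal) \<in> borel_measurable (Pi\<^sub>M {0..<Suc 0} (\<lambda>_. M))"
      by (rule measurable_compose[OF measurable_component_singleton]) auto
    have "emeasure (distr ?X M (\<lambda>x. x 0)) A = (\<integral>\<^sup>+x. indicator A (restrict x {0..<Suc 0} 0) \<partial>?X)"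
      by (subst nn_integral_indicator[symmetric], simp, subst nn_integral_distr) simp_all
    also have "\<dots> = (\<integral>\<^sup>+z. indicator A (z 0) \<partial>IT.C 0 (Suc 0) ?u)"
      by (rule int[OF f])
    also have "\<dots> = (\<integral>\<^sup>+z. indicator A (z 0) \<partial>IT.eP 0 ?u)"
      using bind_return[OF IT.measurable_eP u] by (simp only: IT.C.simps add_0)
    also have "\<dots> = (\<integral>\<^sup>+y. indicator A y \<partial>\<mu>)"
      using IT.nn_integral_eP[OF u f] by (simp add: K_def)
    also have "\<dots> = emeasure \<mu> A" by (simp add: \<mu>_sets)
    finally show "emeasure (distr ?X M (\<lambda>x. x 0)) A = emeasure \<mu> A" .
  qed (simp add: \<mu>_sets)
  have "prob_space ?X"
    using prob_space_distrD[of "\<lambda>x. x 0" ?X M] init \<mu>_prob by simp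
  with init segment_property[OF P X step] have "chain_process M \<mu> P ?X"
    by (auto simp: chain_process_def)
  then show ?thesis ..
qed

text \<open>An independent sequence is a chain whose kernel ignores the current state, so both its
  existence and this property come from the construction of chains. For \<open>k = 0\<close> the
  variable would belong to the past.\<close>

lemma iid_future:
  fixes U :: "real measure"
  assumes U: "U \<in> space (prob_algebra borel)" and \<R>: "chain_process borel U (\<lambda>_. U) \<R>"
    and k: "0 < k" and \<phi>: "\<phi> \<in> borel_measurable (Pi\<^sub>M {..m} (\<lambda>_. borel) \<Otimes>\<^sub>M borel)"
  shows "(\<integral>\<^sup>+r. \<phi> (restrict r {..m}, r (m + k)) \<partial>\<R>) = (\<integral>\<^sup>+r. (\<integral>\<^sup>+u. \<phi> (restrict r {..m}, u) \<partial>U) \<partial>\<R>)"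
proof -
  have sets_U: "sets U = sets borel" using U by (simp add: space_prob_algebra)
  have K: "(\<lambda>_. U) \<in> borel \<rightarrow>\<^sub>M prob_algebra borel" using U by simp
  obtain j where j: "k = Suc j" using k by (cases k) auto
  have sk: "(\<lambda>s. s k) \<in> Pi\<^sub>M {..k} (\<lambda>_. borel) \<rightarrow>\<^sub>M borel"
    by (rule measurable_component_singleton) simp
  have "(\<lambda>p. \<phi> (fst p, snd p k)) \<in> borel_measurable (Pi\<^sub>M {..m} (\<lambda>_. borel) \<Otimes>\<^sub>M Pi\<^sub>M {..k} (\<lambda>_. borel))"
    by (intro measurable_compose[OF _ \<phi>] measurable_Pair measurable_fst measurable_compose[OF measurable_snd sk])
  with \<R> have "(\<integral>\<^sup>+r. \<phi> (restrict r {..m}, (\<lambda>i\<in>{..k}. r (m + i)) k) \<partial>\<R>) =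
      (\<integral>\<^sup>+r. (\<integral>\<^sup>+s. \<phi> (restrict r {..m}, s k) \<partial>chain_path borel (\<lambda>_. U) k (r m)) \<partial>\<R>)"
    unfolding chain_process_def by fastforce
  also have "\<dots> = (\<integral>\<^sup>+r. (\<integral>\<^sup>+u. \<phi> (restrict r {..m}, u) \<partial>U) \<partial>\<R>)"
  proof (rule nn_integral_cong)
    fix r :: "nat \<Rightarrow> real"
    have r: "restrict r {..m} \<in> space (Pi\<^sub>M {..m} (\<lambda>_. borel))" by (simp add: space_PiM)
    have \<phi>r: "(\<lambda>u. \<phi> (restrict r {..m}, u)) \<in> borel_measurable borel"
      by (rule measurable_compose[OF measurable_Pair1'[OF r] \<phi>])
    interpret C: prob_space "chain_path borel (\<lambda>_. U) j (r m)"
      by (rule prob_space_chain_path[OF K]) simp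
    have "(\<integral>\<^sup>+s. \<phi> (restrict r {..m}, s (Suc j)) \<partial>chain_path borel (\<lambda>_. U) (Suc j) (r m)) =
        (\<integral>\<^sup>+s. (\<integral>\<^sup>+y. \<phi> (restrict r {..m}, (s(Suc j := y)) (Suc j)) \<partial>U) \<partial>chain_path borel (\<lambda>_. U) j (r m))"
      by (rule nn_integral_chain_path_Suc[OF K]) (simp, rule measurable_compose[OF sk[unfolded j] \<phi>r])
    then show "(\<integral>\<^sup>+s. \<phi> (restrict r {..m}, s k) \<partial>chain_path borel (\<lambda>_. U) k (r m)) = (\<integral>\<^sup>+u. \<phi> (restrict r {..m}, u) \<partial>U)"
      by (simp add: j C.emeasure_space_1 del: chain_path.simps)
  qed
  finally show ?thesis by simp
qed

section \<open>Sample space of the coupling\<close>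

context atomic_chain begin

text \<open>Three independent ingredients: the chain \<open>X\<close>, the stationary process
  \<open>Zp\<close>, of which the coupling uses the times up to 0, and real variables
  \<open>R\<close> for randomisation. The disintegration says that the next segment of
  \<open>X\<close> and the variable at its end are independent of each other given the past, with
  the expected laws.\<close>

lemma coupling_space:
  fixes M :: "'a measure" and U :: "real measure"
  assumes P: "P \<in> M \<rightarrow>\<^sub>M prob_algebra M" and \<mu>: "\<mu> \<in> space (prob_algebra M)"
    and U: "U \<in> space (prob_algebra borel)"
  obtains \<Omega> :: "((nat \<Rightarrow> 'a) \<times> (int \<Rightarrow> real \<times> bool)) measure" and X Zp R
  where "\<And>n. X n \<in> \<Omega> \<rightarrow>\<^sub>M M" and "\<And>n. R n \<in> borel_measurable \<Omega>" and "runs \<Omega> Zp" and "distr \<Omega> M (X 0) = \<mu>"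
    and "\<And>m k g. 0 < k \<Longrightarrow>
      g \<in> borel_measurable ((Pi\<^sub>M {..m} (\<lambda>_. M) \<Otimes>\<^sub>M (Pi\<^sub>M UNIV (\<lambda>_. count_space UNIV) \<Otimes>\<^sub>M Pi\<^sub>M {..m} (\<lambda>_. borel)))
        \<Otimes>\<^sub>M (Pi\<^sub>M {..k} (\<lambda>_. M) \<Otimes>\<^sub>M borel)) \<Longrightarrow>
      (\<integral>\<^sup>+\<omega>. g ((\<lambda>i\<in>{..m}. X i \<omega>, (\<lambda>i. Zp i \<omega>, \<lambda>i\<in>{..m}. R i \<omega>)), (\<lambda>i\<in>{..k}. X (m + i) \<omega>, R (m + k) \<omega>)) \<partial>\<Omega>) =
      (\<integral>\<^sup>+\<omega>. (\<integral>\<^sup>+p. g ((\<lambda>i\<in>{..m}. X i \<omega>, (\<lambda>i. Zp i \<omega>, \<lambda>i\<in>{..m}. R i \<omega>)), p) \<partial>(chain_path M P k (X m \<omega>) \<Otimes>\<^sub>M U)) \<partial>\<Omega>)"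
proof -
  have U_prob: "prob_space U" and sets_U [measurable_cong]: "sets U = sets borel"
    using U by (auto simp: space_prob_algebra)
  obtain \<X> where \<X>: "chain_process M \<mu> P \<X>"
    using chain_process_exists[OF P \<mu>] .
  obtain \<R> :: "(nat \<Rightarrow> real) measure" where \<R>: "chain_process borel U (\<lambda>_. U) \<R>"
    using chain_process_exists[of "\<lambda>_. U" borel U] U by auto
  obtain \<nu> :: "(int \<Rightarrow> real) measure" where \<nu>_sets [measurable_cong]: "sets \<nu> = sets (Pi\<^sub>M UNIV (\<lambda>_. borel))"
    and \<nu>: "runs \<nu> (\<lambda>n z. dec (z n))"
    using two_sided .
  have X_sets [measurable_cong]: "sets \<X> = sets (Pi\<^sub>M UNIV (\<lambda>_. M))" and R_sets [measurable_cong]: "sets \<R> = sets (Pi\<^sub>M UNIV (\<lambda>_. borel))"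
    using \<X> \<R> by (auto simp: chain_process_def)
  interpret X: prob_space \<X> using \<X> by (simp add: chain_process_def)
  interpret R: prob_space \<R> using \<R> by (simp add: chain_process_def)
  interpret N: prob_space \<nu> using \<nu> by (simp add: runs_def)
  interpret U: prob_space U by (rule U_prob)
  interpret NR: pair_prob_space \<nu> \<R> ..
  \<comment> \<open>The type of the sample space leaves room for a single doubly infinite path
    besides that of \<open>X\<close>: even coordinates carry the coded states, odd ones the
    variables for randomisation, and the Boolean marks are dummies.\<close>
  define pack :: "(int \<Rightarrow> real) \<times> (nat \<Rightarrow> real) \<Rightarrow> int \<Rightarrow> real \<times> bool" where
    "pack p i = (if even i then fst p (i div 2) else snd p (nat (i div 2)), False)" for p i
  define z :: "(int \<Rightarrow> real \<times> bool) \<Rightarrow> int \<Rightarrow> real" where "z l i = fst (l (2 * i))" for l i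
  define r :: "(int \<Rightarrow> real \<times> bool) \<Rightarrow> nat \<Rightarrow> real" where "r l n = fst (l (2 * int n + 1))" for l n
  let ?L = "Pi\<^sub>M (UNIV :: int set) (\<lambda>_. borel \<Otimes>\<^sub>M count_space UNIV) :: (int \<Rightarrow> real \<times> bool) measure"
  define \<Lambda> where "\<Lambda> = distr (\<nu> \<Otimes>\<^sub>M \<R>) ?L pack"
  have pack [measurable]: "pack \<in> \<nu> \<Otimes>\<^sub>M \<R> \<rightarrow>\<^sub>M ?L"
  proof (rule measurable_PiM_single')
    fix i :: int
    have "(\<lambda>p. fst p (i div 2)) \<in> borel_measurable (\<nu> \<Otimes>\<^sub>M \<R>)" "(\<lambda>p. snd p (nat (i div 2))) \<in> borel_measurable (\<nu> \<Otimes>\<^sub>M \<R>)"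
      by measurable
    then show "(\<lambda>p. pack p i) \<in> \<nu> \<Otimes>\<^sub>M \<R> \<rightarrow>\<^sub>M borel \<Otimes>\<^sub>M count_space UNIV"
      by (cases "even i") (simp_all add: pack_def)
  qed (simp add: space_pair_measure)
  have \<Lambda>_sets [measurable_cong]: "sets \<Lambda> = sets ?L" by (simp add: \<Lambda>_def)
  interpret L: prob_space \<Lambda>
    unfolding \<Lambda>_def by (rule NR.prob_space_distr[OF pack])
  interpret XL: pair_prob_space \<X> \<Lambda> ..
  have z_pack: "z (pack p) = fst p" and r_pack: "r (pack p) = snd p" for p
    by (auto simp: z_def r_def pack_def)
  have z_meas: "(\<lambda>l. z l i) \<in> borel_measurable \<Lambda>" for i
    unfolding z_def by measurable
  have r_meas: "(\<lambda>l. r l n) \<in> borel_measurable \<Lambda>" for n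
    unfolding r_def by measurable
  have z': "z \<in> \<Lambda> \<rightarrow>\<^sub>M \<nu>"
    unfolding measurable_cong_sets[OF refl \<nu>_sets] by (rule measurable_PiM_single'[OF z_meas]) simp
  define X where "X n \<omega> = fst \<omega> n" for n and \<omega> :: "(nat \<Rightarrow> 'a) \<times> (int \<Rightarrow> real \<times> bool)"
  define Zp where "Zp i \<omega> = dec (z (snd \<omega>) i)" for i and \<omega> :: "(nat \<Rightarrow> 'a) \<times> (int \<Rightarrow> real \<times> bool)"
  define R where "R n \<omega> = r (snd \<omega>) n" for n and \<omega> :: "(nat \<Rightarrow> 'a) \<times> (int \<Rightarrow> real \<times> bool)"
  have X_meas: "X n \<in> \<X> \<Otimes>\<^sub>M \<Lambda> \<rightarrow>\<^sub>M M" for n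
    unfolding X_def by measurable
  have R_meas: "R n \<in> borel_measurable (\<X> \<Otimes>\<^sub>M \<Lambda>)" for n
    unfolding R_def by (rule measurable_compose[OF measurable_snd r_meas])
  have Zp_meas: "Zp i \<in> \<X> \<Otimes>\<^sub>M \<Lambda> \<rightarrow>\<^sub>M count_space UNIV" for i
    unfolding Zp_def by (rule measurable_compose[OF measurable_compose[OF measurable_snd z_meas] dec_measurable])
  have \<Lambda>_int: "(\<integral>\<^sup>+l. h (z l) (r l) \<partial>\<Lambda>) = (\<integral>\<^sup>+y. (\<integral>\<^sup>+w. h y w \<partial>\<R>) \<partial>\<nu>)"
    if "(\<lambda>l. h (z l) (r l)) \<in> borel_measurable \<Lambda>" for h :: "_ \<Rightarrow> _ \<Rightarrow> ennreal"
  proof -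
    have "(\<integral>\<^sup>+l. h (z l) (r l) \<partial>\<Lambda>) = (\<integral>\<^sup>+p. h (z (pack p)) (r (pack p)) \<partial>(\<nu> \<Otimes>\<^sub>M \<R>))"
      using that unfolding \<Lambda>_def by (intro nn_integral_distr pack) simp
    also have "\<dots> = (\<integral>\<^sup>+y. (\<integral>\<^sup>+w. h (z (pack (y, w))) (r (pack (y, w))) \<partial>\<R>) \<partial>\<nu>)"
      using that unfolding \<Lambda>_def
      by (intro R.nn_integral_fst[symmetric] measurable_compose[OF pack]) (simp cong: measurable_cong_sets)
    finally show ?thesis by (simp add: z_pack r_pack)
  qed
  have init: "distr (\<X> \<Otimes>\<^sub>M \<Lambda>) M (X 0) = \<mu>"
  proof -
    have "distr (\<X> \<Otimes>\<^sub>M \<Lambda>) M (X 0) = distr (distr (\<X> \<Otimes>\<^sub>M \<Lambda>) \<X> fst) M (\<lambda>x. x 0)"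
      by (subst distr_distr) (simp_all add: comp_def X_def[abs_def])
    also have "\<dots> = \<mu>"
      using \<X> by (subst L.distr_pair_fst) (simp add: chain_process_def)
    finally show ?thesis .
  qed
  have past: "runs (\<X> \<Otimes>\<^sub>M \<Lambda>) Zp"
  proof -
    have T: "(\<lambda>\<omega>. z (snd \<omega>)) \<in> \<X> \<Otimes>\<^sub>M \<Lambda> \<rightarrow>\<^sub>M \<nu>"
      by (rule measurable_compose[OF measurable_snd z'])
    have "distr (\<X> \<Otimes>\<^sub>M \<Lambda>) \<nu> (\<lambda>\<omega>. z (snd \<omega>)) = \<nu>"
    proof (rule measure_eqI)
      fix A assume "A \<in> sets (distr (\<X> \<Otimes>\<^sub>M \<Lambda>) \<nu> (\<lambda>\<omega>. z (snd \<omega>)))"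
      then have A: "A \<in> sets \<nu>" by simp
      have zA: "(\<lambda>l. indicator A (z l) :: ennreal) \<in> borel_measurable \<Lambda>"
        by (rule measurable_compose[OF z' borel_measurable_indicator[OF A]])
      have zA': "(\<lambda>\<omega>. indicator A (z (snd \<omega>)) :: ennreal) \<in> borel_measurable (\<X> \<Otimes>\<^sub>M \<Lambda>)"
        by (rule measurable_compose[OF measurable_snd zA])
      have "emeasure (distr (\<X> \<Otimes>\<^sub>M \<Lambda>) \<nu> (\<lambda>\<omega>. z (snd \<omega>))) A = (\<integral>\<^sup>+\<omega>. indicator A (z (snd \<omega>)) \<partial>(\<X> \<Otimes>\<^sub>M \<Lambda>))"
        using A by (subst nn_integral_indicator[symmetric], simp, subst nn_integral_distr[OF T]) simp_all
      also have "\<dots> = (\<integral>\<^sup>+x. (\<integral>\<^sup>+l. indicator A (z l) \<partial>\<Lambda>) \<partial>\<X>)"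
        using L.nn_integral_fst[OF zA'] by simp
      also have "\<dots> = (\<integral>\<^sup>+l. indicator A (z l) \<partial>\<Lambda>)"
        by (simp add: X.emeasure_space_1)
      also have "\<dots> = (\<integral>\<^sup>+y. (\<integral>\<^sup>+w. indicator A y \<partial>\<R>) \<partial>\<nu>)"
        by (rule \<Lambda>_int[OF zA])
      also have "\<dots> = emeasure \<nu> A"
        using A by (simp add: R.emeasure_space_1)
      finally show "emeasure (distr (\<X> \<Otimes>\<^sub>M \<Lambda>) \<nu> (\<lambda>\<omega>. z (snd \<omega>))) A = emeasure \<nu> A" .
    qed simp
    from runs_pullback[OF \<nu> T this] show ?thesis
      by (simp add: Zp_def[abs_def])
  qed
  have disint: "(\<integral>\<^sup>+\<omega>. g ((\<lambda>i\<in>{..m}. X i \<omega>, (\<lambda>i. Zp i \<omega>, \<lambda>i\<in>{..m}. R i \<omega>)), (\<lambda>i\<in>{..k}. X (m + i) \<omega>, R (m + k) \<omega>)) \<partial>(\<X> \<Otimes>\<^sub>M \<Lambda>)) =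
      (\<integral>\<^sup>+\<omega>. (\<integral>\<^sup>+p. g ((\<lambda>i\<in>{..m}. X i \<omega>, (\<lambda>i. Zp i \<omega>, \<lambda>i\<in>{..m}. R i \<omega>)), p) \<partial>(chain_path M P k (X m \<omega>) \<Otimes>\<^sub>M U)) \<partial>(\<X> \<Otimes>\<^sub>M \<Lambda>))"
    if k: "0 < k" and g: "g \<in> borel_measurable ((Pi\<^sub>M {..m} (\<lambda>_. M) \<Otimes>\<^sub>M (Pi\<^sub>M UNIV (\<lambda>_. count_space UNIV) \<Otimes>\<^sub>M Pi\<^sub>M {..m} (\<lambda>_. borel)))
        \<Otimes>\<^sub>M (Pi\<^sub>M {..k} (\<lambda>_. M) \<Otimes>\<^sub>M borel))" for m k g
  proof -
    let ?H = "Pi\<^sub>M {..m} (\<lambda>_. M) \<Otimes>\<^sub>M (Pi\<^sub>M (UNIV :: int set) (\<lambda>_. count_space (UNIV :: (nat \<times> nat) set)) \<Otimes>\<^sub>M Pi\<^sub>M {..m} (\<lambda>_. borel :: real measure))"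
    let ?\<Omega> = "\<X> \<Otimes>\<^sub>M \<Lambda>"
    define hist where "hist \<omega> = (\<lambda>i\<in>{..m}. X i \<omega>, (\<lambda>i. Zp i \<omega>, \<lambda>i\<in>{..m}. R i \<omega>))" for \<omega>
    have hist: "hist \<in> ?\<Omega> \<rightarrow>\<^sub>M ?H"
      unfolding hist_def[abs_def]
      by (intro measurable_Pair measurable_restrict X_meas R_meas measurable_PiM_single'[OF Zp_meas]) simp
    \<comment> \<open>The segment is integrated out while the final variable stays free, so that
      \<open>X\<close> and \<open>R\<close> can be treated one after the other.\<close>
    define \<Gamma> where "\<Gamma> p = (\<integral>\<^sup>+s. g (fst p, (s, snd p)) \<partial>chain_path M P k (fst (fst p) m))" for p
    have \<Gamma>: "\<Gamma> \<in> borel_measurable (?H \<Otimes>\<^sub>M borel)"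
      unfolding \<Gamma>_def
    proof (rule nn_integral_measurable_subprob_algebra2)
      have "(\<lambda>p. fst (fst p) m) \<in> ?H \<Otimes>\<^sub>M (borel :: real measure) \<rightarrow>\<^sub>M M"
        by (rule measurable_compose[OF measurable_compose[OF measurable_fst measurable_fst] measurable_component_singleton]) simp
      from measurable_prob_algebraD[OF measurable_compose[OF this measurable_chain_path[OF P]]]
      show "(\<lambda>p. chain_path M P k (fst (fst p) m)) \<in> ?H \<Otimes>\<^sub>M (borel :: real measure) \<rightarrow>\<^sub>M subprob_algebra (Pi\<^sub>M {..k} (\<lambda>_. M))" .
      have "(\<lambda>q. g (fst (fst q), (snd q, snd (fst q)))) \<in> borel_measurable ((?H \<Otimes>\<^sub>M (borel :: real measure)) \<Otimes>\<^sub>M Pi\<^sub>M {..k} (\<lambda>_. M))"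
        by (intro measurable_compose[OF _ g] measurable_Pair measurable_snd measurable_compose[OF measurable_fst measurable_fst]
          measurable_compose[OF measurable_fst measurable_snd])
      then show "(\<lambda>(p, s). g (fst p, (s, snd p))) \<in> borel_measurable ((?H \<Otimes>\<^sub>M (borel :: real measure)) \<Otimes>\<^sub>M Pi\<^sub>M {..k} (\<lambda>_. M))"
        by (simp only: case_prod_unfold)
    qed
    have x_space: "x n \<in> space M" if "x \<in> space \<X>" for x n
      using that sets_eq_imp_space_eq[OF X_sets] by (auto simp: space_PiM)
    have seg: "(\<lambda>\<omega>. \<lambda>i\<in>{..k}. X (m + i) \<omega>) \<in> ?\<Omega> \<rightarrow>\<^sub>M Pi\<^sub>M {..k} (\<lambda>_. M)"
      by (intro measurable_restrict X_meas)
    have lhs: "(\<lambda>\<omega>. g (hist \<omega>, (\<lambda>i\<in>{..k}. X (m + i) \<omega>, R (m + k) \<omega>))) \<in> borel_measurable ?\<Omega>"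
      by (intro measurable_compose[OF _ g] measurable_Pair hist seg R_meas)
    have mid: "(\<lambda>\<omega>. \<Gamma> (hist \<omega>, R (m + k) \<omega>)) \<in> borel_measurable ?\<Omega>"
      by (intro measurable_compose[OF _ \<Gamma>] measurable_Pair hist R_meas)
    \<comment> \<open>With everything but \<open>X\<close> frozen, the Markov property of
      \<open>X\<close> applies.\<close>
    have "(\<integral>\<^sup>+\<omega>. g (hist \<omega>, (\<lambda>i\<in>{..k}. X (m + i) \<omega>, R (m + k) \<omega>)) \<partial>?\<Omega>) =
        (\<integral>\<^sup>+l. (\<integral>\<^sup>+x. g (hist (x, l), (\<lambda>i\<in>{..k}. x (m + i), r l (m + k))) \<partial>\<X>) \<partial>\<Lambda>)"
      using XL.nn_integral_snd[OF lhs] by (simp add: X_def R_def)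
    also have "\<dots> = (\<integral>\<^sup>+l. (\<integral>\<^sup>+x. \<Gamma> (hist (x, l), r l (m + k)) \<partial>\<X>) \<partial>\<Lambda>)"
    proof (rule nn_integral_cong)
      fix l
      define v where "v = ((\<lambda>i. dec (z l i)), \<lambda>i\<in>{..m}. r l i)"
      have v: "v \<in> space (Pi\<^sub>M (UNIV :: int set) (\<lambda>_. count_space (UNIV :: (nat \<times> nat) set)) \<Otimes>\<^sub>M Pi\<^sub>M {..m} (\<lambda>_. borel :: real measure))"
        by (simp add: v_def space_pair_measure space_PiM)
      have hist_v: "hist (x, l) = (restrict x {..m}, v)" for x
        by (simp add: hist_def v_def X_def Zp_def R_def)
      have "(\<lambda>q. g ((fst q, v), (snd q, r l (m + k)))) \<in> borel_measurable (Pi\<^sub>M {..m} (\<lambda>_. M) \<Otimes>\<^sub>M Pi\<^sub>M {..k} (\<lambda>_. M))"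
        by (intro measurable_compose[OF _ g] measurable_Pair measurable_fst measurable_snd measurable_const v) simp
      with \<X> have "(\<integral>\<^sup>+x. g ((restrict x {..m}, v), (\<lambda>i\<in>{..k}. x (m + i), r l (m + k))) \<partial>\<X>) =
          (\<integral>\<^sup>+x. (\<integral>\<^sup>+s. g ((restrict x {..m}, v), (s, r l (m + k))) \<partial>chain_path M P k (x m)) \<partial>\<X>)"
        unfolding chain_process_def by fastforce
      then show "(\<integral>\<^sup>+x. g (hist (x, l), (\<lambda>i\<in>{..k}. x (m + i), r l (m + k))) \<partial>\<X>) = (\<integral>\<^sup>+x. \<Gamma> (hist (x, l), r l (m + k)) \<partial>\<X>)"
        by (simp add: hist_v \<Gamma>_def)
    qed
    also have "\<dots> = (\<integral>\<^sup>+\<omega>. \<Gamma> (hist \<omega>, R (m + k) \<omega>) \<partial>?\<Omega>)"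
      using XL.nn_integral_snd[OF mid] by (simp add: R_def)
    \<comment> \<open>The order of integration is exchanged: now \<open>X\<close> is frozen and the
      last variable is averaged over its law.\<close>
    also have "\<dots> = (\<integral>\<^sup>+x. (\<integral>\<^sup>+l. \<Gamma> (hist (x, l), r l (m + k)) \<partial>\<Lambda>) \<partial>\<X>)"
      using L.nn_integral_fst[OF mid] by (simp add: R_def)
    also have "\<dots> = (\<integral>\<^sup>+x. (\<integral>\<^sup>+l. (\<integral>\<^sup>+u. \<Gamma> (hist (x, l), u) \<partial>U) \<partial>\<Lambda>) \<partial>\<X>)"
    proof (rule nn_integral_cong)
      fix x assume x: "x \<in> space \<X>"
      have xm: "restrict x {..m} \<in> space (Pi\<^sub>M {..m} (\<lambda>_. M))" using x_space[OF x] by (simp add: space_PiM)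
      define H where "H y w = (restrict x {..m}, ((\<lambda>i. dec (y i)), restrict w {..m}))" for y :: "int \<Rightarrow> real" and w :: "nat \<Rightarrow> real"
      have hist_H: "hist (x, l) = H (z l) (r l)" for l
        by (simp add: hist_def H_def X_def Zp_def R_def)
      have H_meas: "(\<lambda>l. H (z l) (r l)) \<in> \<Lambda> \<rightarrow>\<^sub>M ?H"
        unfolding H_def
        by (intro measurable_Pair measurable_const xm measurable_PiM_single'[OF measurable_compose[OF z_meas dec_measurable]]
          measurable_restrict r_meas) simp
      have 1: "(\<lambda>l. \<Gamma> (H (z l) (r l), r l (m + k))) \<in> borel_measurable \<Lambda>"
        by (intro measurable_compose[OF _ \<Gamma>] measurable_Pair H_meas r_meas)
      have "(\<lambda>h. \<integral>\<^sup>+u. \<Gamma> (h, u) \<partial>U) \<in> borel_measurable ?H"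
        using \<Gamma> by (intro U.borel_measurable_nn_integral_fst) (simp cong: measurable_cong_sets)
      from measurable_compose[OF H_meas this]
      have 2: "(\<lambda>l. \<integral>\<^sup>+u. \<Gamma> (H (z l) (r l), u) \<partial>U) \<in> borel_measurable \<Lambda>" .
      have "(\<integral>\<^sup>+w. \<Gamma> (H y w, w (m + k)) \<partial>\<R>) = (\<integral>\<^sup>+w. (\<integral>\<^sup>+u. \<Gamma> (H y w, u) \<partial>U) \<partial>\<R>)" for y
      proof -
        have "(\<lambda>i. dec (y i)) \<in> space (Pi\<^sub>M (UNIV :: int set) (\<lambda>_. count_space (UNIV :: (nat \<times> nat) set)))"
          by (simp add: space_PiM)
        then have "(\<lambda>p. \<Gamma> ((restrict x {..m}, ((\<lambda>i. dec (y i)), fst p)), snd p)) \<in> borel_measurable (Pi\<^sub>M {..m} (\<lambda>_. borel) \<Otimes>\<^sub>M borel)"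
          by (intro measurable_compose[OF _ \<Gamma>] measurable_Pair measurable_const xm measurable_fst measurable_snd)
        from iid_future[OF U \<R> k this] show ?thesis
          by (simp add: H_def)
      qed
      then show "(\<integral>\<^sup>+l. \<Gamma> (hist (x, l), r l (m + k)) \<partial>\<Lambda>) = (\<integral>\<^sup>+l. (\<integral>\<^sup>+u. \<Gamma> (hist (x, l), u) \<partial>U) \<partial>\<Lambda>)"
        unfolding hist_H \<Lambda>_int[OF 1] \<Lambda>_int[OF 2] by simp
    qed
    also have "\<dots> = (\<integral>\<^sup>+\<omega>. (\<integral>\<^sup>+u. \<Gamma> (hist \<omega>, u) \<partial>U) \<partial>?\<Omega>)"
    proof -
      have "(\<lambda>h. \<integral>\<^sup>+u. \<Gamma> (h, u) \<partial>U) \<in> borel_measurable ?H"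
        using \<Gamma> by (intro U.borel_measurable_nn_integral_fst) (simp cong: measurable_cong_sets)
      from L.nn_integral_fst[OF measurable_compose[OF hist this]] show ?thesis .
    qed
    also have "\<dots> = (\<integral>\<^sup>+\<omega>. (\<integral>\<^sup>+p. g (hist \<omega>, p) \<partial>(chain_path M P k (X m \<omega>) \<Otimes>\<^sub>M U)) \<partial>?\<Omega>)"
    proof (rule nn_integral_cong)
      fix \<omega> assume \<omega>: "\<omega> \<in> space ?\<Omega>"
      then have x: "X m \<omega> \<in> space M" by (rule measurable_space[OF X_meas])
      interpret C: prob_space "chain_path M P k (X m \<omega>)" by (rule prob_space_chain_path[OF P x])
      interpret CU: pair_prob_space "chain_path M P k (X m \<omega>)" U ..
      have "sets (chain_path M P k (X m \<omega>) \<Otimes>\<^sub>M U) = sets (Pi\<^sub>M {..k} (\<lambda>_. M) \<Otimes>\<^sub>M borel)"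
        by (intro sets_pair_measure_cong sets_chain_path[OF P x] sets_U)
      moreover have "(\<lambda>p. g (hist \<omega>, p)) \<in> borel_measurable (Pi\<^sub>M {..k} (\<lambda>_. M) \<Otimes>\<^sub>M borel)"
        by (rule measurable_compose[OF measurable_Pair1'[OF measurable_space[OF hist \<omega>]] g])
      ultimately have "(\<lambda>p. g (hist \<omega>, p)) \<in> borel_measurable (chain_path M P k (X m \<omega>) \<Otimes>\<^sub>M U)"
        by (simp cong: measurable_cong_sets)
      from CU.nn_integral_snd[OF this]
      show "(\<integral>\<^sup>+u. \<Gamma> (hist \<omega>, u) \<partial>U) = (\<integral>\<^sup>+p. g (hist \<omega>, p) \<partial>(chain_path M P k (X m \<omega>) \<Otimes>\<^sub>M U))"
        by (simp add: \<Gamma>_def hist_def)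
    qed
    finally show ?thesis by (simp only: hist_def)
  qed
  show ?thesis
    by (rule that[OF X_meas R_meas past init disint])
qed

end

section \<open>Coupling\<close>

text \<open>\<open>cpl\<close> computes the next index from both ends of the segment of
  \<open>X\<close> and a random variable. \<open>fresh\<close> replaces it for a sojourn that began
  before time 0, where \<open>X\<close> has no segment to offer. Both must average to
  \<open>q k\<close>, the former for every starting point \<open>x\<close>.\<close>

locale coupling = paused_grid q f W At q0 \<gamma> K val F
  for q f W At q0 \<gamma> K val F +
  fixes M :: "'a measure" and P :: "'a \<Rightarrow> 'a measure" and \<mu> :: "'a measure" and V :: "'a \<Rightarrow> real"
    and U :: "real measure" and cpl :: "nat \<Rightarrow> 'a \<Rightarrow> 'a \<Rightarrow> real \<Rightarrow> nat" and fresh :: "nat \<Rightarrow> real \<Rightarrow> nat"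
    and \<Omega> :: "'w measure" and X :: "nat \<Rightarrow> 'w \<Rightarrow> 'a" and Zp :: "int \<Rightarrow> 'w \<Rightarrow> nat \<times> nat" and R :: "nat \<Rightarrow> 'w \<Rightarrow> real"
  assumes P [measurable]: "P \<in> M \<rightarrow>\<^sub>M prob_algebra M"
    and V [measurable]: "V \<in> borel_measurable M"
    and U: "prob_space U" and sets_U [measurable_cong]: "sets U = sets borel"
    and cpl_measurable: "(\<lambda>(x, y, u). cpl k x y u) \<in> M \<Otimes>\<^sub>M M \<Otimes>\<^sub>M borel \<rightarrow>\<^sub>M count_space UNIV"
    and fresh_measurable [measurable]: "fresh k \<in> borel \<rightarrow>\<^sub>M count_space UNIV"
    and cpl_law: "x \<in> space M \<Longrightarrow>
      distr (chain_path M P (f k) x \<Otimes>\<^sub>M U) (count_space UNIV) (\<lambda>(s, u). cpl k x (s (f k)) u) = measure_pmf (q k)"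
    and fresh_law: "distr U (count_space UNIV) (fresh k) = measure_pmf (q k)"
    and cpl_dominates: "x \<in> space M \<Longrightarrow> V x \<le> val k \<Longrightarrow>
      AE p in chain_path M P (f k) x \<Otimes>\<^sub>M U. V (fst p (f k)) \<le> val (cpl k x (fst p (f k)) (snd p))"
    and X [measurable]: "\<And>n. X n \<in> \<Omega> \<rightarrow>\<^sub>M M" and R [measurable]: "\<And>n. R n \<in> borel_measurable \<Omega>"
    and past: "runs \<Omega> Zp" and X_0: "distr \<Omega> M (X 0) = \<mu>"
    and disintegration: "\<And>m k g. 0 < k \<Longrightarrow>
      g \<in> borel_measurable ((Pi\<^sub>M {..m} (\<lambda>_. M) \<Otimes>\<^sub>M (Pi\<^sub>M UNIV (\<lambda>_. count_space UNIV) \<Otimes>\<^sub>M Pi\<^sub>M {..m} (\<lambda>_. borel)))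
        \<Otimes>\<^sub>M (Pi\<^sub>M {..k} (\<lambda>_. M) \<Otimes>\<^sub>M borel)) \<Longrightarrow>
      (\<integral>\<^sup>+\<omega>. g ((\<lambda>i\<in>{..m}. X i \<omega>, (\<lambda>i. Zp i \<omega>, \<lambda>i\<in>{..m}. R i \<omega>)), (\<lambda>i\<in>{..k}. X (m + i) \<omega>, R (m + k) \<omega>)) \<partial>\<Omega>) =
      (\<integral>\<^sup>+\<omega>. (\<integral>\<^sup>+p. g ((\<lambda>i\<in>{..m}. X i \<omega>, (\<lambda>i. Zp i \<omega>, \<lambda>i\<in>{..m}. R i \<omega>)), p) \<partial>(chain_path M P k (X m \<omega>) \<Otimes>\<^sub>M U)) \<partial>\<Omega>)"
begin

text \<open>A sojourn that is to end at time \<open>Suc n\<close> with age \<open>a\<close> began at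
  time \<open>n - a\<close>; the test \<open>a \<le> n\<close> decides whether this lies in the
  lifetime of \<open>X\<close>.\<close>

primrec zc :: "(nat \<Rightarrow> 'a) \<Rightarrow> nat \<times> nat \<Rightarrow> (nat \<Rightarrow> real) \<Rightarrow> nat \<Rightarrow> nat \<times> nat" where
  "zc x s r 0 = s"
| "zc x s r (Suc n) = (case zc x s r n of (k, a) \<Rightarrow>
     if Suc a < f k then (k, Suc a)
     else (if a \<le> n then cpl k (x (n - a)) (x (Suc n)) (r (Suc n)) else fresh k (r (Suc n)), 0))"

lemma zc_cong: "(\<And>i. i \<le> n \<Longrightarrow> x i = x' i \<and> r i = r' i) \<Longrightarrow> zc x s r n = zc x' s r' n"
proof (induction n)
  case (Suc n)
  then have "zc x s r n = zc x' s r' n" by simp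
  with Suc.prems show ?case by (simp split: prod.split)
qed simp

lemma zc_age:
  assumes "zc x s r n = (k, a)" "a \<le> n"
  shows "zc x s r (n - a) = (k, 0) \<and> a < f k"
  using assms
proof (induction a arbitrary: n)
  case 0
  then show ?case using f_pos[of k] by simp
next
  case (Suc a)
  then obtain n' where n: "n = Suc n'" by (cases n) auto
  with Suc.prems have "zc x s r n' = (k, a)" "Suc a < f k" by (auto split: prod.splits if_splits)
  with Suc.IH[of n'] Suc.prems n show ?case by simp
qed

lemma zc_pause: "zc x s r m = (k, 0) \<Longrightarrow> i < f k \<Longrightarrow> zc x s r (m + i) = (k, i)"
  by (induction i) auto

lemma zc_move:
  assumes "zc x s r m = (k, 0)"
  shows "zc x s r (m + f k) = (cpl k (x m) (x (m + f k)) (r (m + f k)), 0)"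
proof -
  obtain n where n: "f k = Suc n" using f_pos[of k] by (cases "f k") auto
  with zc_pause[OF assms, of n] show ?thesis by simp
qed

lemma zc_measurable:
  assumes "\<And>i. i \<le> n \<Longrightarrow> (\<lambda>\<omega>. x \<omega> i) \<in> L \<rightarrow>\<^sub>M M" "\<And>i. i \<le> n \<Longrightarrow> (\<lambda>\<omega>. r \<omega> i) \<in> borel_measurable L"
    and s: "s \<in> L \<rightarrow>\<^sub>M count_space UNIV"
  shows "(\<lambda>\<omega>. zc (x \<omega>) (s \<omega>) (r \<omega>) n) \<in> L \<rightarrow>\<^sub>M count_space UNIV"
  using assms(1,2)
proof (induction n)
  case (Suc n)
  define nxt where "nxt p \<omega> = (case p of (k, a) \<Rightarrow>
     if Suc a < f k then (k, Suc a)
     else (if a \<le> n then cpl k (x \<omega> (n - a)) (x \<omega> (Suc n)) (r \<omega> (Suc n)) else fresh k (r \<omega> (Suc n)), 0::nat))" for p \<omega>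
  have nxt: "nxt p \<in> L \<rightarrow>\<^sub>M count_space UNIV" for p
  proof -
    obtain k a where p: "p = (k, a)" by (cases p)
    have "(\<lambda>\<omega>. (\<lambda>(x, y, u). cpl k x y u) (x \<omega> (n - a), x \<omega> (Suc n), r \<omega> (Suc n))) \<in> L \<rightarrow>\<^sub>M count_space UNIV"
      by (rule measurable_compose[OF _ cpl_measurable]) (intro measurable_Pair Suc.prems, auto)
    from measurable_compose[OF this, of "\<lambda>j. (j, 0::nat)" "count_space UNIV"]
    have "(\<lambda>\<omega>. (cpl k (x \<omega> (n - a)) (x \<omega> (Suc n)) (r \<omega> (Suc n)), 0::nat)) \<in> L \<rightarrow>\<^sub>M count_space UNIV"
      by simp
    moreover have "(\<lambda>\<omega>. r \<omega> (Suc n)) \<in> borel_measurable L"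
      by (rule Suc.prems) simp
    from measurable_compose[OF measurable_compose[OF this fresh_measurable[of k]], of "\<lambda>j. (j, 0::nat)" "count_space UNIV"]
    have "(\<lambda>\<omega>. (fresh k (r \<omega> (Suc n)), 0::nat)) \<in> L \<rightarrow>\<^sub>M count_space UNIV"
      by simp
    ultimately show ?thesis
      by (cases "Suc a < f k"; cases "a \<le> n") (simp_all add: nxt_def[abs_def] p)
  qed
  have "(\<lambda>\<omega>. nxt (zc (x \<omega>) (s \<omega>) (r \<omega>) n) \<omega>) \<in> L \<rightarrow>\<^sub>M count_space UNIV"
    by (rule measurable_compose_countable[OF nxt Suc.IH]) (auto intro: Suc.prems)
  then show ?case
    by (simp add: nxt_def)
qed (simp add: s)

definition Z :: "int \<Rightarrow> 'w \<Rightarrow> nat \<times> nat" where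
  "Z i \<omega> = (if i \<le> 0 then Zp i \<omega> else zc (\<lambda>n. X n \<omega>) (Zp 0 \<omega>) (\<lambda>n. R n \<omega>) (nat i))"

lemma Z_int: "Z (int n) \<omega> = zc (\<lambda>n. X n \<omega>) (Zp 0 \<omega>) (\<lambda>n. R n \<omega>) n"
  by (simp add: Z_def)

lemma Zp_measurable [measurable]: "Zp i \<in> \<Omega> \<rightarrow>\<^sub>M count_space UNIV"
  using past by (rule runs_measurable)

lemma Z_measurable [measurable]: "Z i \<in> \<Omega> \<rightarrow>\<^sub>M count_space UNIV"
  unfolding Z_def[abs_def] by (cases "i \<le> 0") (simp_all add: zc_measurable)

abbreviation history_space where
  "history_space m \<equiv> Pi\<^sub>M {..m} (\<lambda>_. M) \<Otimes>\<^sub>M (Pi\<^sub>M (UNIV :: int set) (\<lambda>_. count_space (UNIV :: (nat \<times> nat) set)) \<Otimes>\<^sub>M Pi\<^sub>M {..m} (\<lambda>_. borel :: real measure))"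

text \<open>Finer than \<open>joint_history\<close>: it retains the random variables, so the coupled
  states up to time \<open>m\<close> are functions of it. Conditional laws are computed here and
  then passed to the coarser history.\<close>

definition history :: "nat \<Rightarrow> 'w \<Rightarrow> (nat \<Rightarrow> 'a) \<times> (int \<Rightarrow> nat \<times> nat) \<times> (nat \<Rightarrow> real)" where
  "history m \<omega> = (\<lambda>i\<in>{..m}. X i \<omega>, (\<lambda>i. Zp i \<omega>, \<lambda>i\<in>{..m}. R i \<omega>))"

definition Zh :: "int \<Rightarrow> (nat \<Rightarrow> 'a) \<times> (int \<Rightarrow> nat \<times> nat) \<times> (nat \<Rightarrow> real) \<Rightarrow> nat \<times> nat" where
  "Zh i h = (if i \<le> 0 then fst (snd h) i else zc (fst h) (fst (snd h) 0) (snd (snd h)) (nat i))"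

lemma Zh_history: "i \<le> int m \<Longrightarrow> Zh i (history m \<omega>) = Z i \<omega>"
  by (auto simp: Zh_def history_def Z_def intro!: zc_cong)

lemma history_measurable [measurable]: "history m \<in> \<Omega> \<rightarrow>\<^sub>M history_space m"
  unfolding history_def[abs_def]
  by (intro measurable_Pair measurable_restrict X R measurable_PiM_single') auto

lemma Zh_measurable:
  assumes "i \<le> int m"
  shows "Zh i \<in> history_space m \<rightarrow>\<^sub>M count_space UNIV"
proof (cases "i \<le> 0")
  case True
  have "(\<lambda>h. fst (snd h) i) \<in> history_space m \<rightarrow>\<^sub>M count_space UNIV"
    by (rule measurable_compose[OF measurable_compose[OF measurable_snd measurable_fst] measurable_component_singleton]) simp
  then show ?thesis using True by (simp add: Zh_def[abs_def])
next
  case False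
  have "(\<lambda>h. zc (fst h) (fst (snd h) 0) (snd (snd h)) (nat i)) \<in> history_space m \<rightarrow>\<^sub>M count_space UNIV"
  proof (rule zc_measurable)
    fix j assume "j \<le> nat i"
    then have j: "j \<in> {..m}" using assms by auto
    show "(\<lambda>h. fst h j) \<in> history_space m \<rightarrow>\<^sub>M M"
      by (rule measurable_compose[OF measurable_fst measurable_component_singleton[OF j]])
    show "(\<lambda>h. snd (snd h) j) \<in> borel_measurable (history_space m)"
      by (rule measurable_compose[OF measurable_compose[OF measurable_snd measurable_snd] measurable_component_singleton[OF j]])
  next
    show "(\<lambda>h. fst (snd h) 0) \<in> history_space m \<rightarrow>\<^sub>M count_space UNIV"
      by (rule measurable_compose[OF measurable_compose[OF measurable_snd measurable_fst] measurable_component_singleton]) simp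
  qed
  then show ?thesis using False by (simp add: Zh_def[abs_def])
qed

lemma disintegration':
  assumes "0 < k" and "g \<in> borel_measurable (history_space m \<Otimes>\<^sub>M (Pi\<^sub>M {..k} (\<lambda>_. M) \<Otimes>\<^sub>M borel))"
  shows "(\<integral>\<^sup>+\<omega>. g (history m \<omega>, (\<lambda>i\<in>{..k}. X (m + i) \<omega>, R (m + k) \<omega>)) \<partial>\<Omega>) =
    (\<integral>\<^sup>+\<omega>. (\<integral>\<^sup>+p. g (history m \<omega>, p) \<partial>(chain_path M P k (X m \<omega>) \<Otimes>\<^sub>M U)) \<partial>\<Omega>)"
  unfolding history_def by (rule disintegration[OF assms])

lemma X_space: "\<omega> \<in> space \<Omega> \<Longrightarrow> X n \<omega> \<in> space M"
  using measurable_space[OF X] .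

lemma sets_path_U: "x \<in> space M \<Longrightarrow> sets (chain_path M P k x \<Otimes>\<^sub>M U) = sets (Pi\<^sub>M {..k} (\<lambda>_. M) \<Otimes>\<^sub>M borel)"
  by (intro sets_pair_measure_cong sets_chain_path[OF P] sets_U)

lemma cpl_path_measurable:
  assumes "x \<in> space M"
  shows "(\<lambda>(s, u). cpl k x (s (f k)) u) \<in> chain_path M P (f k) x \<Otimes>\<^sub>M U \<rightarrow>\<^sub>M count_space UNIV"
proof -
  have "(\<lambda>p. (\<lambda>(x, y, u). cpl k x y u) (x, fst p (f k), snd p)) \<in> Pi\<^sub>M {..f k} (\<lambda>_. M) \<Otimes>\<^sub>M borel \<rightarrow>\<^sub>M count_space UNIV"
    by (rule measurable_compose[OF _ cpl_measurable])
       (intro measurable_Pair measurable_const assms measurable_compose[OF measurable_fst measurable_component_singleton], auto)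
  then show ?thesis
    by (simp add: split_beta measurable_cong_sets[OF sets_path_U[OF assms] refl])
qed

text \<open>When the segment and its variable are integrated out, \<open>cpl_law\<close> produces
  the same mass for every starting point. Hence the next index is independent of the history,
  although it is a function of the future of \<open>X\<close>.\<close>

lemma cpl_event:
  assumes A [measurable]: "A \<in> sets (history_space m)"
  shows "emeasure \<Omega> {\<omega>\<in>space \<Omega>. history m \<omega> \<in> A \<and> cpl k (X m \<omega>) (X (m + f k) \<omega>) (R (m + f k) \<omega>) \<in> B} =
    emeasure (q k) B * emeasure \<Omega> {\<omega>\<in>space \<Omega>. history m \<omega> \<in> A}"
proof -
  define g where "g p = (indicator A (fst p) * indicator B (cpl k (fst (fst p) m) (fst (snd p) (f k)) (snd (snd p))) :: ennreal)" for p
  have c: "(\<lambda>p. cpl k (fst (fst p) m) (fst (snd p) (f k)) (snd (snd p))) \<in> history_space m \<Otimes>\<^sub>M (Pi\<^sub>M {..f k} (\<lambda>_. M) \<Otimes>\<^sub>M borel) \<rightarrow>\<^sub>M count_space UNIV"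
  proof -
    have "(\<lambda>p. (\<lambda>(x, y, u). cpl k x y u) (fst (fst p) m, fst (snd p) (f k), snd (snd p))) \<in> history_space m \<Otimes>\<^sub>M (Pi\<^sub>M {..f k} (\<lambda>_. M) \<Otimes>\<^sub>M borel) \<rightarrow>\<^sub>M count_space UNIV"
      by (rule measurable_compose[OF _ cpl_measurable])
         (intro measurable_Pair measurable_compose[OF measurable_compose[OF measurable_fst measurable_fst] measurable_component_singleton]
           measurable_compose[OF measurable_compose[OF measurable_snd measurable_fst] measurable_component_singleton]
           measurable_compose[OF measurable_snd measurable_snd], auto)
    then show ?thesis by simp
  qed
  have g: "g \<in> borel_measurable (history_space m \<Otimes>\<^sub>M (Pi\<^sub>M {..f k} (\<lambda>_. M) \<Otimes>\<^sub>M borel))"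
    unfolding g_def
    by (intro borel_measurable_times_ennreal measurable_compose[OF measurable_fst borel_measurable_indicator[OF A]]
      measurable_compose[OF c]) simp
  have c': "(\<lambda>\<omega>. cpl k (X m \<omega>) (X (m + f k) \<omega>) (R (m + f k) \<omega>)) \<in> \<Omega> \<rightarrow>\<^sub>M count_space UNIV"
  proof -
    have "(\<lambda>\<omega>. (\<lambda>(x, y, u). cpl k x y u) (X m \<omega>, X (m + f k) \<omega>, R (m + f k) \<omega>)) \<in> \<Omega> \<rightarrow>\<^sub>M count_space UNIV"
      by (rule measurable_compose[OF _ cpl_measurable]) measurable
    then show ?thesis by simp
  qed
  note [measurable] = c'
  have "emeasure \<Omega> {\<omega>\<in>space \<Omega>. history m \<omega> \<in> A \<and> cpl k (X m \<omega>) (X (m + f k) \<omega>) (R (m + f k) \<omega>) \<in> B} =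
      (\<integral>\<^sup>+\<omega>. indicator {\<omega>\<in>space \<Omega>. history m \<omega> \<in> A \<and> cpl k (X m \<omega>) (X (m + f k) \<omega>) (R (m + f k) \<omega>) \<in> B} \<omega> \<partial>\<Omega>)"
    by (rule nn_integral_indicator[symmetric]) measurable
  also have "\<dots> = (\<integral>\<^sup>+\<omega>. g (history m \<omega>, (\<lambda>i\<in>{..f k}. X (m + i) \<omega>, R (m + f k) \<omega>)) \<partial>\<Omega>)"
    by (intro nn_integral_cong) (auto simp: g_def history_def split: split_indicator)
  also have "\<dots> = (\<integral>\<^sup>+\<omega>. (\<integral>\<^sup>+p. g (history m \<omega>, p) \<partial>(chain_path M P (f k) (X m \<omega>) \<Otimes>\<^sub>M U)) \<partial>\<Omega>)"
    by (rule disintegration'[OF f_pos g])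
  also have "\<dots> = (\<integral>\<^sup>+\<omega>. emeasure (q k) B * indicator {\<omega>\<in>space \<Omega>. history m \<omega> \<in> A} \<omega> \<partial>\<Omega>)"
  proof (intro nn_integral_cong)
    fix \<omega> assume \<omega>: "\<omega> \<in> space \<Omega>"
    note x = X_space[OF \<omega>, of m]
    note c = cpl_path_measurable[OF x, of k]
    have "(\<integral>\<^sup>+p. indicator B (case p of (s, u) \<Rightarrow> cpl k (X m \<omega>) (s (f k)) u) \<partial>(chain_path M P (f k) (X m \<omega>) \<Otimes>\<^sub>M U)) = emeasure (q k) B"
      unfolding cpl_law[OF x, symmetric]
      by (subst nn_integral_distr[OF c, symmetric]) simp_all
    moreover have "(\<lambda>p. indicator B (case p of (s, u) \<Rightarrow> cpl k (X m \<omega>) (s (f k)) u) :: ennreal) \<in> borel_measurable (chain_path M P (f k) (X m \<omega>) \<Otimes>\<^sub>M U)"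
      by (rule measurable_compose[OF c]) simp
    ultimately show "(\<integral>\<^sup>+p. g (history m \<omega>, p) \<partial>(chain_path M P (f k) (X m \<omega>) \<Otimes>\<^sub>M U)) =
        emeasure (q k) B * indicator {\<omega>\<in>space \<Omega>. history m \<omega> \<in> A} \<omega>"
      using \<omega> by (simp add: g_def split_beta history_def nn_integral_cmult mult.commute split: split_indicator)
  qed
  also have "\<dots> = emeasure (q k) B * emeasure \<Omega> {\<omega>\<in>space \<Omega>. history m \<omega> \<in> A}"
    by (rule nn_integral_cmult_indicator) measurable
  finally show ?thesis .
qed

lemma nn_integral_snd_path_U:
  assumes x: "x \<in> space M" and h [measurable]: "h \<in> borel_measurable borel"
  shows "(\<integral>\<^sup>+p. h (snd p) \<partial>(chain_path M P k x \<Otimes>\<^sub>M U)) = (\<integral>\<^sup>+u. h u \<partial>U)"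
proof -
  interpret U: prob_space U by (rule U)
  interpret C: prob_space "chain_path M P k x" by (rule prob_space_chain_path[OF P x])
  interpret CU: pair_sigma_finite "chain_path M P k x" U ..
  have "(\<lambda>p. h (snd p)) \<in> borel_measurable (chain_path M P k x \<Otimes>\<^sub>M U)" by measurable
  from U.nn_integral_fst[OF this] show ?thesis
    by (simp add: C.emeasure_space_1)
qed

lemma nn_integral_fst_path_U:
  assumes x: "x \<in> space M" and h [measurable]: "h \<in> borel_measurable (Pi\<^sub>M {..k} (\<lambda>_. M))"
  shows "(\<integral>\<^sup>+p. h (fst p) \<partial>(chain_path M P k x \<Otimes>\<^sub>M U)) = (\<integral>\<^sup>+s. h s \<partial>chain_path M P k x)"
proof -
  interpret U: prob_space U by (rule U)
  note [measurable_cong] = sets_chain_path[OF P x]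
  have "(\<lambda>p. h (fst p)) \<in> borel_measurable (chain_path M P k x \<Otimes>\<^sub>M U)" by measurable
  from U.nn_integral_fst[OF this] show ?thesis
    by (simp add: U.emeasure_space_1)
qed

text \<open>The disintegration with a segment of one step, of which only the variable at its end is
  used.\<close>

lemma fresh_event:
  assumes A [measurable]: "A \<in> sets (history_space m)"
  shows "emeasure \<Omega> {\<omega>\<in>space \<Omega>. history m \<omega> \<in> A \<and> fresh k (R (Suc m) \<omega>) \<in> B} =
    emeasure (q k) B * emeasure \<Omega> {\<omega>\<in>space \<Omega>. history m \<omega> \<in> A}"
proof -
  define g where "g p = (indicator A (fst p) * indicator B (fresh k (snd (snd p))) :: ennreal)"
    for p :: "((nat \<Rightarrow> 'a) \<times> (int \<Rightarrow> nat \<times> nat) \<times> (nat \<Rightarrow> real)) \<times> (nat \<Rightarrow> 'a) \<times> real"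
  have B: "(\<lambda>u. indicator B (fresh k u) :: ennreal) \<in> borel_measurable borel"
    by (rule measurable_compose[OF fresh_measurable]) simp
  have g: "g \<in> borel_measurable (history_space m \<Otimes>\<^sub>M (Pi\<^sub>M {..1} (\<lambda>_. M) \<Otimes>\<^sub>M borel))"
    unfolding g_def
    by (intro borel_measurable_times_ennreal measurable_compose[OF measurable_fst borel_measurable_indicator[OF A]]
      measurable_compose[OF measurable_compose[OF measurable_snd measurable_snd] B])
  have [measurable]: "{\<omega>\<in>space \<Omega>. fresh k (R (Suc m) \<omega>) \<in> B} \<in> sets \<Omega>"
    using measurable_sets[OF measurable_compose[OF R fresh_measurable], of B "Suc m" k] by (simp add: vimage_def Int_def conj_commute)
  have E: "{\<omega>\<in>space \<Omega>. history m \<omega> \<in> A \<and> fresh k (R (Suc m) \<omega>) \<in> B} \<in> sets \<Omega>"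
    by measurable
  have "emeasure \<Omega> {\<omega>\<in>space \<Omega>. history m \<omega> \<in> A \<and> fresh k (R (Suc m) \<omega>) \<in> B} =
      (\<integral>\<^sup>+\<omega>. indicator {\<omega>\<in>space \<Omega>. history m \<omega> \<in> A \<and> fresh k (R (Suc m) \<omega>) \<in> B} \<omega> \<partial>\<Omega>)"
    by (rule nn_integral_indicator[OF E, symmetric])
  also have "\<dots> = (\<integral>\<^sup>+\<omega>. g (history m \<omega>, (\<lambda>i\<in>{..1}. X (m + i) \<omega>, R (m + 1) \<omega>)) \<partial>\<Omega>)"
    by (intro nn_integral_cong) (auto simp: g_def split: split_indicator)
  also have "\<dots> = (\<integral>\<^sup>+\<omega>. (\<integral>\<^sup>+p. g (history m \<omega>, p) \<partial>(chain_path M P 1 (X m \<omega>) \<Otimes>\<^sub>M U)) \<partial>\<Omega>)"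
    by (rule disintegration'[OF _ g]) simp
  also have "\<dots> = (\<integral>\<^sup>+\<omega>. emeasure (q k) B * indicator {\<omega>\<in>space \<Omega>. history m \<omega> \<in> A} \<omega> \<partial>\<Omega>)"
  proof (intro nn_integral_cong)
    fix \<omega> assume \<omega>: "\<omega> \<in> space \<Omega>"
    have "(\<integral>\<^sup>+u. indicator B (fresh k u) \<partial>U) = emeasure (q k) B"
    proof -
      have "fresh k \<in> U \<rightarrow>\<^sub>M count_space UNIV" by measurable
      from nn_integral_distr[OF this, of "indicator B"] show ?thesis
        by (simp add: fresh_law)
    qed
    moreover have "(\<integral>\<^sup>+p. g (history m \<omega>, p) \<partial>(chain_path M P 1 (X m \<omega>) \<Otimes>\<^sub>M U)) =
        (\<integral>\<^sup>+u. indicator A (history m \<omega>) * indicator B (fresh k u) \<partial>U)"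
      unfolding g_def fst_conv snd_conv
      by (rule nn_integral_snd_path_U[OF X_space[OF \<omega>]]) (intro borel_measurable_times_ennreal B, simp)
    ultimately show "(\<integral>\<^sup>+p. g (history m \<omega>, p) \<partial>(chain_path M P 1 (X m \<omega>) \<Otimes>\<^sub>M U)) =
        emeasure (q k) B * indicator {\<omega>\<in>space \<Omega>. history m \<omega> \<in> A} \<omega>"
      using \<omega> by (auto split: split_indicator)
  qed
  also have "\<dots> = emeasure (q k) B * emeasure \<Omega> {\<omega>\<in>space \<Omega>. history m \<omega> \<in> A}"
    by (rule nn_integral_cmult_indicator) measurable
  finally show ?thesis .
qed

end

section \<open>Law of the coupled process\<close>

context coupling begin

lemma Z_age: "Z (int n) \<omega> = (k, a) \<Longrightarrow> a \<le> n \<Longrightarrow> Z (int (n - a)) \<omega> = (k, 0) \<and> a < f k"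
  unfolding Z_int by (rule zc_age)

lemma Z_pause: "Z (int m) \<omega> = (k, 0) \<Longrightarrow> i < f k \<Longrightarrow> Z (int (m + i)) \<omega> = (k, i)"
  using zc_pause by (simp only: Z_int)

lemma Z_move:
  "Z (int m) \<omega> = (k, 0) \<Longrightarrow> Z (int (m + f k)) \<omega> = (cpl k (X m \<omega>) (X (m + f k) \<omega>) (R (m + f k) \<omega>), 0)"
  using zc_move by (simp only: Z_int)

lemma Z_Suc:
  "Z (int (Suc n)) \<omega> = (case Z (int n) \<omega> of (k, a) \<Rightarrow>
     if Suc a < f k then (k, Suc a)
     else (if a \<le> n then cpl k (X (n - a) \<omega>) (X (Suc n) \<omega>) (R (Suc n) \<omega>) else fresh k (R (Suc n) \<omega>), 0))"
  unfolding Z_int by simp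

definition window_event :: "nat \<Rightarrow> nat \<Rightarrow> (nat \<times> nat) list \<Rightarrow> ((nat \<Rightarrow> 'a) \<times> (int \<Rightarrow> nat \<times> nat) \<times> (nat \<Rightarrow> real)) set" where
  "window_event m n l = {h\<in>space (history_space n). \<forall>i\<le>m + n. Zh (- int m + int i) h = l ! i}"

lemma window_event_sets: "window_event m n l \<in> sets (history_space n)"
proof -
  have "{h\<in>space (history_space n). Zh (- int m + int i) h = l ! i} \<in> sets (history_space n)" if "i \<le> m + n" for i
    using that measurable_sets[OF Zh_measurable[of "- int m + int i" n], of "{l ! i}"]
    by (simp add: vimage_def Int_def conj_commute)
  then have "{h\<in>space (history_space n). \<forall>i\<in>{..m + n}. Zh (- int m + int i) h = l ! i} \<in> sets (history_space n)"
    by (intro sets.sets_Collect_finite_All') auto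
  then show ?thesis
    by (simp only: window_event_def atMost_iff Ball_def)
qed

lemma window_event_history:
  assumes "length l = Suc (m + n)" "\<omega> \<in> space \<Omega>"
  shows "history n \<omega> \<in> window_event m n l \<longleftrightarrow> window Z (- int m) (m + n) \<omega> = l"
  using assms measurable_space[OF history_measurable, of \<omega> n]
  by (simp add: window_event_def window_eq_iff Zh_history)

text \<open>
  If the paused chain is about to move at time \<open>Suc n\<close>, its history up to time \<open>n\<close> is determined by
  the one up to its last move time, so that the coupled transition has the right conditional law.
\<close>

lemma window_extend:
  assumes l: "length l = Suc (m + n)"
  shows "emeasure \<Omega> {\<omega>\<in>space \<Omega>. window Z (- int m) (m + n) \<omega> = l \<and> Z (int (Suc n)) \<omega> = s} =
    emeasure (step (last l)) {s} * emeasure \<Omega> {\<omega>\<in>space \<Omega>. window Z (- int m) (m + n) \<omega> = l}"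
proof -
  obtain k a where ka: "last l = (k, a)" by (cases "last l")
  let ?E = "{\<omega>\<in>space \<Omega>. window Z (- int m) (m + n) \<omega> = l}"
  have Z_n: "Z (int n) \<omega> = (k, a)" if "window Z (- int m) (m + n) \<omega> = l" for \<omega>
    using last_window[of Z "- int m" "m + n" \<omega>] that ka by simp
  show ?thesis
  proof (cases "Suc a < f k")
    case True
    then have "{\<omega>\<in>space \<Omega>. window Z (- int m) (m + n) \<omega> = l \<and> Z (int (Suc n)) \<omega> = s} = (if s = (k, Suc a) then ?E else {})"
      using Z_n unfolding Z_Suc by auto
    then show ?thesis
      using True by (simp add: ka step_def)
  next
    case False
    define b where "b = (if a \<le> n then (\<lambda>\<omega>. cpl k (X (n - a) \<omega>) (X (Suc n) \<omega>) (R (Suc n) \<omega>)) else (\<lambda>\<omega>. fresh k (R (Suc n) \<omega>)))"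
    have next_Z: "Z (int (Suc n)) \<omega> = (b \<omega>, 0)" if "window Z (- int m) (m + n) \<omega> = l" for \<omega>
      using False Z_n[OF that] unfolding Z_Suc by (simp add: b_def)
    have step: "emeasure (step (last l)) {s} = emeasure (q k) {j. (j, 0) = s}"
      using False by (simp add: ka step_def vimage_def)
    have eq: "{\<omega>\<in>space \<Omega>. window Z (- int m) (m + n) \<omega> = l \<and> Z (int (Suc n)) \<omega> = s} =
        {\<omega>\<in>space \<Omega>. window Z (- int m) (m + n) \<omega> = l \<and> b \<omega> \<in> {j. (j, 0) = s}}"
      using next_Z by auto
    show ?thesis
    proof (cases "a \<le> n")
      case a: False
      have 1: "{\<omega>\<in>space \<Omega>. window Z (- int m) (m + n) \<omega> = l \<and> b \<omega> \<in> {j. (j, 0) = s}} =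
          {\<omega>\<in>space \<Omega>. history n \<omega> \<in> window_event m n l \<and> fresh k (R (Suc n) \<omega>) \<in> {j. (j, 0) = s}}"
        using a by (intro Collect_cong conj_cong refl) (simp_all add: window_event_history[OF l] b_def)
      have 2: "?E = {\<omega>\<in>space \<Omega>. history n \<omega> \<in> window_event m n l}"
        by (intro Collect_cong conj_cong refl) (simp add: window_event_history[OF l])
      show ?thesis
        unfolding eq 1 2 step by (rule fresh_event[OF window_event_sets])
    next
      case a: True
      show ?thesis
      proof (cases "?E = {}")
        case True
        then have empty: "{\<omega>\<in>space \<Omega>. window Z (- int m) (m + n) \<omega> = l \<and> Z (int (Suc n)) \<omega> = s} = {}" by blast
        show ?thesis unfolding True empty by simp
      next
        case E: False
        \<comment> \<open>A path that realises \<open>l\<close> shows what cannot be read off its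
          last entry alone: the current sojourn began at time \<open>j\<close> in state
          \<open>(k, 0)\<close>.\<close>
        then obtain \<omega>0 where \<omega>0: "\<omega>0 \<in> space \<Omega>" "window Z (- int m) (m + n) \<omega>0 = l" by blast
        define j where "j = n - a"
        have j: "Z (int j) \<omega>0 = (k, 0)" "a < f k"
          using Z_age[OF Z_n[OF \<omega>0(2)] a] by (simp_all add: j_def)
        then have fk: "f k = Suc a" using False by simp
        have jn: "n = j + a" "Suc n = j + f k" using a by (simp_all add: j_def fk)
        have E_eq: "?E = {\<omega>\<in>space \<Omega>. history j \<omega> \<in> window_event m j (take (Suc (m + j)) l)}"
        proof (intro Collect_cong conj_cong refl)
          fix \<omega> assume \<omega>: "\<omega> \<in> space \<Omega>"
          have "history j \<omega> \<in> window_event m j (take (Suc (m + j)) l) \<longleftrightarrow> window Z (- int m) (m + j) \<omega> = take (Suc (m + j)) l"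
            using l jn by (intro window_event_history \<omega>) simp
          also have "\<dots> \<longleftrightarrow> window Z (- int m) (m + n) \<omega> = l"
          proof
            assume "window Z (- int m) (m + n) \<omega> = l"
            then show "window Z (- int m) (m + j) \<omega> = take (Suc (m + j)) l"
              using take_window[of "m + j" Z "- int m" a \<omega>] jn by (simp add: add.assoc)
          next
            assume prefix: "window Z (- int m) (m + j) \<omega> = take (Suc (m + j)) l"
            have "window Z (- int m) (m + j) \<omega>0 = take (Suc (m + j)) l"
              using take_window[of "m + j" Z "- int m" a \<omega>0] jn \<omega>0 by (simp add: add.assoc)
            with prefix have same: "Z (- int m + int i) \<omega> = Z (- int m + int i) \<omega>0" if "i \<le> m + j" for i
              using nth_window[OF that, of Z "- int m"] by metis
            then have Zj: "Z (int j) \<omega> = (k, 0)"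
              using same[of "m + j"] j by simp
            \<comment> \<open>Beyond time \<open>j\<close> both paths are in the same sojourn, which
              lasts beyond time \<open>n\<close>, so agreement up to \<open>j\<close> forces
              agreement up to \<open>n\<close>.\<close>
            have "Z (- int m + int i) \<omega> = Z (- int m + int i) \<omega>0" if "i \<le> m + n" for i
            proof (cases "i \<le> m + j")
              case False
              define d where "d = i - (m + j)"
              have d: "- int m + int i = int (j + d)" "d < f k"
                using False that jn fk by (auto simp: d_def)
              show ?thesis
                unfolding d(1) using Z_pause[OF Zj d(2)] Z_pause[OF j(1) d(2)] by simp
            qed (rule same)
            then have "window Z (- int m) (m + n) \<omega> = window Z (- int m) (m + n) \<omega>0"
              by (simp add: window_eq_iff nth_window)
            then show "window Z (- int m) (m + n) \<omega> = l" using \<omega>0 by simp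
          qed
          finally show "window Z (- int m) (m + n) \<omega> = l \<longleftrightarrow> history j \<omega> \<in> window_event m j (take (Suc (m + j)) l)" ..
        qed
        have b: "b = (\<lambda>\<omega>. cpl k (X j \<omega>) (X (j + f k) \<omega>) (R (j + f k) \<omega>))"
          using a by (simp add: b_def j_def jn(2)[unfolded j_def, symmetric])
        have 1: "{\<omega>\<in>space \<Omega>. window Z (- int m) (m + n) \<omega> = l \<and> b \<omega> \<in> {j. (j, 0) = s}} =
            {\<omega>\<in>space \<Omega>. history j \<omega> \<in> window_event m j (take (Suc (m + j)) l) \<and> cpl k (X j \<omega>) (X (j + f k) \<omega>) (R (j + f k) \<omega>) \<in> {j. (j, 0) = s}}"
          using E_eq unfolding b by blast
        show ?thesis
          unfolding eq 1 step unfolding E_eq by (rule cpl_event[OF window_event_sets])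
      qed
    qed
  qed
qed

text \<open>Up to time 0 the process coincides with \<open>Zp\<close>. Each further time is supplied
  by \<open>window_extend\<close>, which matches the recursion \<open>traj_Suc\<close>; lists form a
  countable space, so singletons suffice.\<close>

lemma runs_Z: "runs \<Omega> Z"
proof (rule runsI)
  show "prob_space \<Omega>" using past by (simp add: runs_def)
  fix m n
  show "distr \<Omega> (count_space UNIV) (window Z (- int m) (m + n)) = measure_pmf (traj (m + n))"
  proof (induction n)
    case 0
    have "window Z (- int m) (m + 0) = window Zp (- int m) m"
      by (auto simp: window_def Z_def fun_eq_iff)
    then show ?case using past by (simp add: runs_def)
  next
    case (Suc n)
    have sing: "emeasure \<Omega> {\<omega>\<in>space \<Omega>. window Z (- int m) (m + n) \<omega> = l} = emeasure (traj (m + n)) {l}" for l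
    proof -
      have "emeasure (traj (m + n)) {l} = emeasure \<Omega> (window Z (- int m) (m + n) -` {l} \<inter> space \<Omega>)"
        unfolding Suc.IH[symmetric] by (rule emeasure_distr) simp_all
      then show ?thesis by (simp add: vimage_def Int_def conj_commute)
    qed
    show ?case
    proof (rule measure_eqI_countable[of _ UNIV])
      fix L :: "(nat \<times> nat) list"
      have W: "emeasure (distr \<Omega> (count_space UNIV) (window Z (- int m) (m + Suc n))) {L} =
          emeasure \<Omega> {\<omega>\<in>space \<Omega>. window Z (- int m) (m + Suc n) \<omega> = L}"
        by (subst emeasure_distr) (simp_all add: vimage_def Int_def conj_commute)
      show "emeasure (distr \<Omega> (count_space UNIV) (window Z (- int m) (m + Suc n))) {L} = emeasure (traj (m + Suc n)) {L}"
      proof (cases "length L = Suc (Suc (m + n))")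
        case False
        have empty: "{\<omega>\<in>space \<Omega>. window Z (- int m) (m + Suc n) \<omega> = L} = {}"
          using False by (auto simp: window_eq_iff)
        have "L \<notin> set_pmf (traj (m + Suc n))"
          using False length_traj[of L "m + Suc n"] by auto
        then show ?thesis
          unfolding W empty by (simp add: emeasure_pmf_single set_pmf_iff)
      next
        case True
        then obtain l s where L: "L = l @ [s]" "length l = Suc (m + n)"
          by (cases L rule: rev_cases) auto
        have "{\<omega>\<in>space \<Omega>. window Z (- int m) (m + Suc n) \<omega> = L} =
            {\<omega>\<in>space \<Omega>. window Z (- int m) (m + n) \<omega> = l \<and> Z (int (Suc n)) \<omega> = s}"
        proof -
          have "window Z (- int m) (m + Suc n) \<omega> = window Z (- int m) (m + n) \<omega> @ [Z (int (Suc n)) \<omega>]" for \<omega>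
            by (simp add: window_def)
          then show ?thesis by (simp add: L)
        qed
        then have "emeasure (distr \<Omega> (count_space UNIV) (window Z (- int m) (m + Suc n))) {L} =
            emeasure (step (last l)) {s} * emeasure (traj (m + n)) {l}"
          unfolding W by (simp only: window_extend[OF L(2)] sing)
        also have "\<dots> = (\<integral>\<^sup>+l'. emeasure (step (last l)) {s} * indicator {l} l' \<partial>traj (m + n))"
          by (simp add: nn_integral_cmult_indicator)
        also have "\<dots> = (\<integral>\<^sup>+l'. emeasure (step (last l')) {s'. l' @ [s'] = l @ [s]} \<partial>traj (m + n))"
          by (intro nn_integral_cong) (auto split: split_indicator)
        also have "\<dots> = emeasure (traj (m + Suc n)) {L}"
          by (simp add: traj_Suc L vimage_def)
        finally show ?thesis .
      qed
    qed simp_all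
  qed
qed (rule Z_measurable)

section \<open>Conditional laws given the joint history\<close>

definition observed :: "nat \<Rightarrow> (nat \<Rightarrow> 'a) \<times> (int \<Rightarrow> nat \<times> nat) \<times> (nat \<Rightarrow> real) \<Rightarrow> (nat \<Rightarrow> 'a) \<times> (int \<Rightarrow> real \<times> bool)" where
  "observed m h = (fst h, \<lambda>i\<in>{..int m}. (val (fst (Zh i h)), snd (Zh i h) = 0))"

lemma observed_history: "observed m (history m \<omega>) = joint_history X (value_at Z) (moves Z) m \<omega>"
proof -
  have "(\<lambda>i\<in>{..int m}. (val (fst (Zh i (history m \<omega>))), snd (Zh i (history m \<omega>)) = 0)) = (\<lambda>i\<in>{..int m}. marked (value_at Z) (moves Z) i \<omega>)"
    by (rule restrict_ext) (simp add: Zh_history value_at_def moves_def)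
  then show ?thesis
    by (simp add: observed_def joint_history_def) (simp add: history_def)
qed

lemma observed_measurable [measurable]: "observed m \<in> history_space m \<rightarrow>\<^sub>M joint_history_space M S m"
  unfolding observed_def[abs_def] joint_history_space_def
  by (intro measurable_Pair measurable_fst measurable_restrict measurable_compose[OF Zh_measurable mark_measurable]) simp

lemma joint_history_measurable: "joint_history X (value_at Z) (moves Z) m \<in> \<Omega> \<rightarrow>\<^sub>M joint_history_space M S m"
  using measurable_compose[OF history_measurable observed_measurable] by (simp add: observed_history)

text \<open>The joint history is a function of \<open>history\<close>, hence its events are events
  of the latter and \<open>cpl_event\<close> applies to them as a whole; no passage from cylinders
  is needed here.\<close>

lemma cond_law_joint:
  "cond_law \<Omega> (joint_history X (value_at Z) (moves Z) m) (joint_history_space M S m)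
    {\<omega>\<in>space \<Omega>. moves Z (int m) \<omega>} (\<lambda>\<omega>. value_at Z (int m + int (F (value_at Z (int m) \<omega>))) \<omega>)
    (restrict_space borel S) (\<lambda>\<omega>. Q (value_at Z (int m) \<omega>))"
proof -
  let ?H = "joint_history X (value_at Z) (moves Z) m"
  let ?Y = "\<lambda>\<omega>. value_at Z (int m + int (F (value_at Z (int m) \<omega>))) \<omega>"
  have Y: "?Y \<in> \<Omega> \<rightarrow>\<^sub>M restrict_space borel S"
  proof -
    have "(\<lambda>\<omega>. (\<lambda>k \<omega>. value_at Z (int m + int (f k)) \<omega>) (fst (Z (int m) \<omega>)) \<omega>) \<in> \<Omega> \<rightarrow>\<^sub>M restrict_space borel S"
      by (rule measurable_compose_countable[where f="\<lambda>k \<omega>. value_at Z (int m + int (f k)) \<omega>" and g="\<lambda>\<omega>. fst (Z (int m) \<omega>)"])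
         (rule value_at_measurable[OF Z_measurable], rule measurable_compose[OF Z_measurable], simp)
    then show ?thesis
      by (simp add: value_at_def F_val)
  qed
  have "cond_law \<Omega> ?H (joint_history_space M S m) {\<omega>\<in>space \<Omega>. Z (int m) \<omega> = (k, 0)} ?Y
      (restrict_space borel S) (\<lambda>\<omega>. Q (value_at Z (int m) \<omega>))" for k
  proof (rule cond_lawI[where E'="{h\<in>space (joint_history_space M S m). snd h (int m) = (val k, True)}" and \<kappa>'="\<lambda>_. Q (val k)"])
    have mk: "{(val k, True)} \<in> sets (marked_space S)"
      using pair_measureI[of "{val k}" "restrict_space borel S" "{True}" "count_space UNIV"] by (simp add: sets_S)
    have "(\<lambda>h. snd h (int m)) \<in> joint_history_space M S m \<rightarrow>\<^sub>M marked_space S"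
      unfolding joint_history_space_def
      by (rule measurable_compose[OF measurable_snd measurable_component_singleton]) simp
    from measurable_sets[OF this mk]
    show "{h\<in>space (joint_history_space M S m). snd h (int m) = (val k, True)} \<in> sets (joint_history_space M S m)"
      by (simp add: vimage_def Int_def conj_commute)
    have H_iff: "snd (?H \<omega>) (int m) = (val k, True) \<longleftrightarrow> Z (int m) \<omega> = (k, 0)" for \<omega>
      by (simp add: joint_history_def state_iff)
    show "{\<omega>\<in>space \<Omega>. Z (int m) \<omega> = (k, 0)} = ?H -` {h\<in>space (joint_history_space M S m). snd h (int m) = (val k, True)} \<inter> space \<Omega>"
      using measurable_space[OF joint_history_measurable] H_iff by auto
    fix A B assume A: "A \<in> sets (joint_history_space M S m)"
      and A_sub: "A \<subseteq> {h\<in>space (joint_history_space M S m). snd h (int m) = (val k, True)}"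
      and B: "B \<in> sets (restrict_space borel S)"
    define A' where "A' = observed m -` A \<inter> space (history_space m)"
    have A': "A' \<in> sets (history_space m)"
      unfolding A'_def by (rule measurable_sets[OF observed_measurable A])
    have A'_iff: "history m \<omega> \<in> A' \<longleftrightarrow> ?H \<omega> \<in> A" if "\<omega> \<in> space \<Omega>" for \<omega>
      using measurable_space[OF history_measurable that] by (simp add: A'_def observed_history)
    have Z_m: "Z (int m) \<omega> = (k, 0)" if "?H \<omega> \<in> A" for \<omega>
      using A_sub that H_iff[of \<omega>] by blast
    have Y_eq: "?Y \<omega> = val (cpl k (X m \<omega>) (X (m + f k) \<omega>) (R (m + f k) \<omega>))" if "?H \<omega> \<in> A" for \<omega>
      using Z_move[OF Z_m[OF that]] Z_m[OF that] by (simp add: value_at_def F_val)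
    have "{\<omega>\<in>space \<Omega>. ?H \<omega> \<in> A \<and> ?Y \<omega> \<in> B} =
        {\<omega>\<in>space \<Omega>. history m \<omega> \<in> A' \<and> cpl k (X m \<omega>) (X (m + f k) \<omega>) (R (m + f k) \<omega>) \<in> {j. val j \<in> B}}"
      using Y_eq by (auto simp: A'_iff)
    then have "emeasure \<Omega> {\<omega>\<in>space \<Omega>. ?H \<omega> \<in> A \<and> ?Y \<omega> \<in> B} =
        emeasure (q k) {j. val j \<in> B} * emeasure \<Omega> {\<omega>\<in>space \<Omega>. history m \<omega> \<in> A'}"
      by (simp only: cpl_event[OF A'])
    also have "\<dots> = (\<integral>\<^sup>+\<omega>. emeasure (q k) {j. val j \<in> B} * indicator {\<omega>\<in>space \<Omega>. history m \<omega> \<in> A'} \<omega> \<partial>\<Omega>)"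
      using measurable_sets[OF history_measurable A']
      by (intro nn_integral_cmult_indicator[symmetric]) (simp add: vimage_def Int_def conj_commute)
    also have "\<dots> = (\<integral>\<^sup>+\<omega>. indicator A (?H \<omega>) * emeasure (Q (value_at Z (int m) \<omega>)) B \<partial>\<Omega>)"
    proof (intro nn_integral_cong)
      fix \<omega> assume "\<omega> \<in> space \<Omega>"
      then show "emeasure (q k) {j. val j \<in> B} * indicator {\<omega>\<in>space \<Omega>. history m \<omega> \<in> A'} \<omega> =
          indicator A (?H \<omega>) * emeasure (Q (value_at Z (int m) \<omega>)) B"
        using A'_iff[of \<omega>] Z_m[of \<omega>] emeasure_Q_val[OF B, of k]
        by (auto simp: value_at_def split: split_indicator)
    qed
    finally show "emeasure \<Omega> {\<omega>\<in>space \<Omega>. ?H \<omega> \<in> A \<and> ?Y \<omega> \<in> B} =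
      (\<integral>\<^sup>+\<omega>. indicator A (?H \<omega>) * emeasure (Q (value_at Z (int m) \<omega>)) B \<partial>\<Omega>)" .
  next
    show "prob_space \<Omega>" using past by (simp add: runs_def)
  qed (use joint_history_measurable Y prob_space_Q in \<open>auto simp: state_iff\<close>)
  from cond_law_UN[of \<Omega> ?H _ _ ?Y, OF this]
  have "cond_law \<Omega> ?H (joint_history_space M S m) (\<Union>k. {\<omega>\<in>space \<Omega>. Z (int m) \<omega> = (k, 0)}) ?Y
      (restrict_space borel S) (\<lambda>\<omega>. Q (value_at Z (int m) \<omega>))" .
  also have "(\<Union>k. {\<omega>\<in>space \<Omega>. Z (int m) \<omega> = (k, 0)}) = {\<omega>\<in>space \<Omega>. moves Z (int m) \<omega>}"
    by (auto simp: moves_def prod_eq_iff)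
  finally show ?thesis .
qed

text \<open>The disintegration with the random variable averaged out: the history includes the
  randomisation used so far, and \<open>X\<close> is still Markov with respect to it.\<close>

lemma segment_event:
  assumes k: "0 < k" and A: "A \<in> sets (history_space m)" and B: "B \<in> sets (Pi\<^sub>M {..k} (\<lambda>_. M))"
  shows "emeasure \<Omega> {\<omega>\<in>space \<Omega>. history m \<omega> \<in> A \<and> (\<lambda>i\<in>{..k}. X (m + i) \<omega>) \<in> B} =
    (\<integral>\<^sup>+\<omega>. indicator A (history m \<omega>) * emeasure (chain_path M P k (X m \<omega>)) B \<partial>\<Omega>)"
proof -
  define g where "g p = (indicator A (fst p) * indicator B (fst (snd p)) :: ennreal)"
    for p :: "((nat \<Rightarrow> 'a) \<times> (int \<Rightarrow> nat \<times> nat) \<times> (nat \<Rightarrow> real)) \<times> (nat \<Rightarrow> 'a) \<times> real"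
  have g: "g \<in> borel_measurable (history_space m \<Otimes>\<^sub>M (Pi\<^sub>M {..k} (\<lambda>_. M) \<Otimes>\<^sub>M borel))"
    unfolding g_def
    by (intro borel_measurable_times_ennreal measurable_compose[OF measurable_fst borel_measurable_indicator[OF A]]
      measurable_compose[OF measurable_compose[OF measurable_snd measurable_fst] borel_measurable_indicator[OF B]])
  have seg: "(\<lambda>\<omega>. \<lambda>i\<in>{..k}. X (m + i) \<omega>) \<in> \<Omega> \<rightarrow>\<^sub>M Pi\<^sub>M {..k} (\<lambda>_. M)"
    by (intro measurable_restrict X)
  have E: "{\<omega>\<in>space \<Omega>. history m \<omega> \<in> A \<and> (\<lambda>i\<in>{..k}. X (m + i) \<omega>) \<in> B} \<in> sets \<Omega>"
  proof -
    have "{\<omega>\<in>space \<Omega>. history m \<omega> \<in> A \<and> (\<lambda>i\<in>{..k}. X (m + i) \<omega>) \<in> B} =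
        (history m -` A \<inter> space \<Omega>) \<inter> ((\<lambda>\<omega>. \<lambda>i\<in>{..k}. X (m + i) \<omega>) -` B \<inter> space \<Omega>)"
      by auto
    then show ?thesis
      using measurable_sets[OF history_measurable A] measurable_sets[OF seg B] by simp
  qed
  have "emeasure \<Omega> {\<omega>\<in>space \<Omega>. history m \<omega> \<in> A \<and> (\<lambda>i\<in>{..k}. X (m + i) \<omega>) \<in> B} =
      (\<integral>\<^sup>+\<omega>. g (history m \<omega>, (\<lambda>i\<in>{..k}. X (m + i) \<omega>, R (m + k) \<omega>)) \<partial>\<Omega>)"
    by (subst nn_integral_indicator[OF E, symmetric], intro nn_integral_cong) (auto simp: g_def split: split_indicator)
  also have "\<dots> = (\<integral>\<^sup>+\<omega>. (\<integral>\<^sup>+p. g (history m \<omega>, p) \<partial>(chain_path M P k (X m \<omega>) \<Otimes>\<^sub>M U)) \<partial>\<Omega>)"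
    by (rule disintegration'[OF k g])
  also have "\<dots> = (\<integral>\<^sup>+\<omega>. indicator A (history m \<omega>) * emeasure (chain_path M P k (X m \<omega>)) B \<partial>\<Omega>)"
  proof (intro nn_integral_cong)
    fix \<omega> assume \<omega>: "\<omega> \<in> space \<Omega>"
    have "(\<integral>\<^sup>+p. g (history m \<omega>, p) \<partial>(chain_path M P k (X m \<omega>) \<Otimes>\<^sub>M U)) =
        (\<integral>\<^sup>+s. indicator A (history m \<omega>) * indicator B s \<partial>chain_path M P k (X m \<omega>))"
      unfolding g_def fst_conv snd_conv
      using B by (intro nn_integral_fst_path_U[OF X_space[OF \<omega>]]) simp
    also have "\<dots> = indicator A (history m \<omega>) * emeasure (chain_path M P k (X m \<omega>)) B"
      using B by (intro nn_integral_cmult_indicator) (simp add: sets_chain_path[OF P X_space[OF \<omega>]])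
    finally show "(\<integral>\<^sup>+p. g (history m \<omega>, p) \<partial>(chain_path M P k (X m \<omega>) \<Otimes>\<^sub>M U)) =
        indicator A (history m \<omega>) * emeasure (chain_path M P k (X m \<omega>)) B" .
  qed
  finally show ?thesis .
qed

lemma cond_law_segment:
  "cond_law \<Omega> (joint_history X (value_at Z) (moves Z) m) (joint_history_space M S m)
    {\<omega>\<in>space \<Omega>. moves Z (int m) \<omega> \<and> F (value_at Z (int m) \<omega>) = k}
    (\<lambda>\<omega>. \<lambda>i\<in>{..k}. X (m + i) \<omega>) (Pi\<^sub>M {..k} (\<lambda>_. M)) (\<lambda>\<omega>. chain_path M P k (X m \<omega>))"
proof (cases "k = 0")
  case True
  \<comment> \<open>A sojourn has positive length on the grid, so this event cannot occur; for
    positive lengths the disintegration is available.\<close>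
  have empty: "{\<omega>\<in>space \<Omega>. moves Z (int m) \<omega> \<and> F (value_at Z (int m) \<omega>) = k} = {}"
    using True f_pos by (auto simp: value_at_def F_val)
  show ?thesis unfolding cond_law_def empty by simp
next
  case False
  let ?H = "joint_history X (value_at Z) (moves Z) m"
  let ?E = "{h\<in>space (joint_history_space M S m). snd h (int m) \<in> {z. F (fst z) = k \<and> snd z}}"
  show ?thesis
  proof (rule cond_lawI[where E'="?E" and \<kappa>'="\<lambda>h. chain_path M P k (fst h m)"])
    have mk: "{z\<in>space (marked_space S). F (fst z) = k \<and> snd z} \<in> sets (marked_space S)"
    proof -
      have "{z\<in>space (marked_space S). F (fst z) = k \<and> snd z} = {z\<in>S. F z = k} \<times> {True}"
        by (auto simp: space_pair_measure space_restrict_space)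
      also have "\<dots> \<in> sets (marked_space S)"
        by (rule pair_measureI) (auto simp: sets_S)
      finally show ?thesis .
    qed
    have "(\<lambda>h. snd h (int m)) \<in> joint_history_space M S m \<rightarrow>\<^sub>M marked_space S"
      unfolding joint_history_space_def
      by (rule measurable_compose[OF measurable_snd measurable_component_singleton]) simp
    note sm = this
    have "?E = (\<lambda>h. snd h (int m)) -` {z\<in>space (marked_space S). F (fst z) = k \<and> snd z} \<inter> space (joint_history_space M S m)"
      using measurable_space[OF sm] by auto
    then show E: "?E \<in> sets (joint_history_space M S m)"
      using measurable_sets[OF sm mk] by simp
    show "{\<omega>\<in>space \<Omega>. moves Z (int m) \<omega> \<and> F (value_at Z (int m) \<omega>) = k} = ?H -` ?E \<inter> space \<Omega>"
      using measurable_space[OF joint_history_measurable] by (auto simp: joint_history_def)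
    have fm: "(\<lambda>h. fst h m) \<in> joint_history_space M S m \<rightarrow>\<^sub>M M"
      unfolding joint_history_space_def
      by (rule measurable_compose[OF measurable_fst measurable_component_singleton]) simp
    show "(\<lambda>h. measure (chain_path M P k (fst h m)) B) \<in> borel_measurable (joint_history_space M S m)"
      if "B \<in> sets (Pi\<^sub>M {..k} (\<lambda>_. M))" for B
      by (rule measurable_compose[OF measurable_compose[OF fm measurable_chain_path[OF P]] measurable_measure_prob_algebra[OF that]])
    show "chain_path M P k (X m \<omega>) = chain_path M P k (fst (?H \<omega>) m)" for \<omega>
      by (simp add: joint_history_def)
    show "prob_space (chain_path M P k (X m \<omega>))"
      if "\<omega> \<in> {\<omega>\<in>space \<Omega>. moves Z (int m) \<omega> \<and> F (value_at Z (int m) \<omega>) = k}" for \<omega>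
      using that by (intro prob_space_chain_path[OF P] X_space) simp
    show "?H \<in> \<Omega> \<rightarrow>\<^sub>M joint_history_space M S m" by (rule joint_history_measurable)
    show "(\<lambda>\<omega>. \<lambda>i\<in>{..k}. X (m + i) \<omega>) \<in> \<Omega> \<rightarrow>\<^sub>M Pi\<^sub>M {..k} (\<lambda>_. M)"
      by (intro measurable_restrict X)
    show "prob_space \<Omega>" using past by (simp add: runs_def)
    fix A B assume A: "A \<in> sets (joint_history_space M S m)" and B: "B \<in> sets (Pi\<^sub>M {..k} (\<lambda>_. M))"
    define A' where "A' = observed m -` A \<inter> space (history_space m)"
    have A': "A' \<in> sets (history_space m)"
      unfolding A'_def by (rule measurable_sets[OF observed_measurable A])
    have A'_iff: "history m \<omega> \<in> A' \<longleftrightarrow> ?H \<omega> \<in> A" if "\<omega> \<in> space \<Omega>" for \<omega>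
      using measurable_space[OF history_measurable that] by (simp add: A'_def observed_history)
    have "{\<omega>\<in>space \<Omega>. ?H \<omega> \<in> A \<and> (\<lambda>i\<in>{..k}. X (m + i) \<omega>) \<in> B} = {\<omega>\<in>space \<Omega>. history m \<omega> \<in> A' \<and> (\<lambda>i\<in>{..k}. X (m + i) \<omega>) \<in> B}"
      using A'_iff by blast
    then have "emeasure \<Omega> {\<omega>\<in>space \<Omega>. ?H \<omega> \<in> A \<and> (\<lambda>i\<in>{..k}. X (m + i) \<omega>) \<in> B} =
        (\<integral>\<^sup>+\<omega>. indicator A' (history m \<omega>) * emeasure (chain_path M P k (X m \<omega>)) B \<partial>\<Omega>)"
      using segment_event[OF _ A' B] False by simp
    also have "\<dots> = (\<integral>\<^sup>+\<omega>. indicator A (?H \<omega>) * emeasure (chain_path M P k (X m \<omega>)) B \<partial>\<Omega>)"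
      by (intro nn_integral_cong) (simp add: A'_iff indicator_def)
    finally show "emeasure \<Omega> {\<omega>\<in>space \<Omega>. ?H \<omega> \<in> A \<and> (\<lambda>i\<in>{..k}. X (m + i) \<omega>) \<in> B} =
        (\<integral>\<^sup>+\<omega>. indicator A (?H \<omega>) * emeasure (chain_path M P k (X m \<omega>)) B \<partial>\<Omega>)" .
  qed
qed

lemma markov_chain_X: "markov_chain \<Omega> M \<mu> P X"
  unfolding markov_chain_def
proof (intro conjI allI)
  fix n
  let ?H = "\<lambda>\<omega>. \<lambda>i\<in>{..n}. X i \<omega>"
  have H: "?H \<in> \<Omega> \<rightarrow>\<^sub>M Pi\<^sub>M {..n} (\<lambda>_. M)"
    by (intro measurable_restrict X)
  show "cond_law \<Omega> ?H (Pi\<^sub>M {..n} (\<lambda>_. M)) (space \<Omega>) (X (Suc n)) M (\<lambda>\<omega>. P (X n \<omega>))"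
  proof (rule cond_lawI[where E'="space (Pi\<^sub>M {..n} (\<lambda>_. M))" and \<kappa>'="\<lambda>h. P (h n)"])
    show "prob_space \<Omega>" using past by (simp add: runs_def)
    show "space \<Omega> = ?H -` space (Pi\<^sub>M {..n} (\<lambda>_. M)) \<inter> space \<Omega>"
      using measurable_space[OF H] by auto
    show "(\<lambda>h. measure (P (h n)) B) \<in> borel_measurable (Pi\<^sub>M {..n} (\<lambda>_. M))" if "B \<in> sets M" for B
    proof -
      have "(\<lambda>h. h n) \<in> Pi\<^sub>M {..n} (\<lambda>_. M) \<rightarrow>\<^sub>M M" by (rule measurable_component_singleton) simp
      from measurable_compose[OF measurable_compose[OF this P] measurable_measure_prob_algebra[OF that]]
      show ?thesis .
    qed
    show "prob_space (P (X n \<omega>))" if "\<omega> \<in> space \<Omega>" for \<omega>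
      using measurable_space[OF P X_space[OF that]] by (simp add: space_prob_algebra)
    fix A B assume A: "A \<in> sets (Pi\<^sub>M {..n} (\<lambda>_. M))" and B: "B \<in> sets M"
    define A' where "A' = fst -` A \<inter> space (history_space n)"
    have A': "A' \<in> sets (history_space n)"
      unfolding A'_def by (rule measurable_sets[OF measurable_fst A])
    have A'_iff: "history n \<omega> \<in> A' \<longleftrightarrow> ?H \<omega> \<in> A" if "\<omega> \<in> space \<Omega>" for \<omega>
      using measurable_space[OF history_measurable that] by (simp add: A'_def) (simp add: history_def)
    \<comment> \<open>A segment of one step also contains its starting point, so the event is placed
      on coordinate 1.\<close>
    define B' where "B' = (\<lambda>s. s 1) -` B \<inter> space (Pi\<^sub>M {..1::nat} (\<lambda>_. M))"
    have s1: "(\<lambda>s. s 1) \<in> Pi\<^sub>M {..1::nat} (\<lambda>_. M) \<rightarrow>\<^sub>M M" by (rule measurable_component_singleton) simp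
    have B': "B' \<in> sets (Pi\<^sub>M {..1} (\<lambda>_. M))"
      unfolding B'_def by (rule measurable_sets[OF s1 B])
    have seg: "(\<lambda>i\<in>{..1}. X (n + i) \<omega>) \<in> B' \<longleftrightarrow> X (Suc n) \<omega> \<in> B" if "\<omega> \<in> space \<Omega>" for \<omega>
      using X_space[OF that] by (auto simp: B'_def space_PiM)
    have path: "emeasure (chain_path M P 1 x) B' = emeasure (P x) B" if x: "x \<in> space M" for x
    proof -
      have sets_P: "sets (P x) = sets M" using measurable_space[OF P x] by (simp add: space_prob_algebra)
      define c where "c = (\<lambda>i\<in>{..0::nat}. x)"
      have c: "c \<in> space (Pi\<^sub>M {..0::nat} (\<lambda>_. M))" using x by (auto simp: c_def space_PiM)
      have ind: "(\<lambda>s. \<integral>\<^sup>+y. indicator B' (s(Suc 0 := y)) \<partial>P (s 0)) c = emeasure (P x) B"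
      proof -
        have "(\<integral>\<^sup>+y. indicator B' (c(Suc 0 := y)) \<partial>P x) = (\<integral>\<^sup>+y. indicator B y \<partial>P x)"
        proof (intro nn_integral_cong)
          fix y assume "y \<in> space (P x)"
          then have "y \<in> space M" using sets_eq_imp_space_eq[OF sets_P] by simp
          then show "indicator B' (c(Suc 0 := y)) = (indicator B y :: ennreal)"
            using x by (auto simp: B'_def c_def space_PiM PiE_iff extensional_def split: split_indicator)
        qed
        then show ?thesis using B sets_P by (simp add: c_def)
      qed
      have upd: "(\<lambda>(\<omega>, y). fun_upd \<omega> (Suc 0) y) \<in> Pi\<^sub>M {..0::nat} (\<lambda>_. M) \<Otimes>\<^sub>M M \<rightarrow>\<^sub>M Pi\<^sub>M {..Suc 0} (\<lambda>_. M)"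
        unfolding split_beta by (rule measurable_fun_upd[where J="{..0}"]) auto
      have "emeasure (chain_path M P (Suc 0) x) B' = (\<integral>\<^sup>+s. indicator B' s \<partial>chain_path M P (Suc 0) x)"
        using B' sets_chain_path[OF P x, of "Suc 0"] by simp
      also have "\<dots> = (\<integral>\<^sup>+s. (\<integral>\<^sup>+y. indicator B' (s(Suc 0 := y)) \<partial>P (s 0)) \<partial>chain_path M P 0 x)"
        using B' by (intro nn_integral_chain_path_Suc[OF P x]) simp
      also have "\<dots> = emeasure (P x) B"
      proof -
        have "(\<lambda>s. \<integral>\<^sup>+y. indicator B' (s(Suc 0 := y)) \<partial>P (s 0)) \<in> borel_measurable (Pi\<^sub>M {..0::nat} (\<lambda>_. M))"
        proof (rule nn_integral_measurable_subprob_algebra2)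
          show "(\<lambda>s. P (s 0)) \<in> Pi\<^sub>M {..0::nat} (\<lambda>_. M) \<rightarrow>\<^sub>M subprob_algebra M"
            by (intro measurable_prob_algebraD measurable_compose[OF _ P] measurable_component_singleton) simp
          show "(\<lambda>(s, y). indicator B' (s(Suc 0 := y)) :: ennreal) \<in> borel_measurable (Pi\<^sub>M {..0::nat} (\<lambda>_. M) \<Otimes>\<^sub>M M)"
            using measurable_compose[OF upd borel_measurable_indicator[OF B'[unfolded One_nat_def]]]
            by (simp only: case_prod_unfold)
        qed
        from nn_integral_return[OF c this] show ?thesis
          by (simp only: chain_path.simps c_def[symmetric] ind)
      qed
      finally show ?thesis by simp
    qed
    have "{\<omega>\<in>space \<Omega>. ?H \<omega> \<in> A \<and> X (Suc n) \<omega> \<in> B} = {\<omega>\<in>space \<Omega>. history n \<omega> \<in> A' \<and> (\<lambda>i\<in>{..1}. X (n + i) \<omega>) \<in> B'}"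
      using A'_iff seg by blast
    then have "emeasure \<Omega> {\<omega>\<in>space \<Omega>. ?H \<omega> \<in> A \<and> X (Suc n) \<omega> \<in> B} =
        (\<integral>\<^sup>+\<omega>. indicator A' (history n \<omega>) * emeasure (chain_path M P 1 (X n \<omega>)) B' \<partial>\<Omega>)"
      using segment_event[OF _ A' B'] by simp
    also have "\<dots> = (\<integral>\<^sup>+\<omega>. indicator A (?H \<omega>) * emeasure (P (X n \<omega>)) B \<partial>\<Omega>)"
      by (intro nn_integral_cong) (simp only: path[OF X_space] A'_iff indicator_def)
    finally show "emeasure \<Omega> {\<omega>\<in>space \<Omega>. ?H \<omega> \<in> A \<and> X (Suc n) \<omega> \<in> B} =
        (\<integral>\<^sup>+\<omega>. indicator A (?H \<omega>) * emeasure (P (X n \<omega>)) B \<partial>\<Omega>)" .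
  qed (use H X in auto)
qed (use X X_0 in auto)

lemma move_coupling: "move_coupling \<Omega> M \<mu> P S Q F X (value_at Z) (moves Z)"
  unfolding move_coupling_def
  using markov_chain_X paused_chain[OF runs_Z] cond_law_joint cond_law_segment by blast

lemma dominates:
  "AE \<omega> in \<Omega>. \<forall>m. moves Z (int m) \<omega> \<and> V (X m \<omega>) \<le> value_at Z (int m) \<omega> \<longrightarrow>
     V (X (m + F (value_at Z (int m) \<omega>)) \<omega>) \<le> value_at Z (int (m + F (value_at Z (int m) \<omega>))) \<omega>"
proof -
  have "AE \<omega> in \<Omega>. V (X m \<omega>) \<le> val k \<longrightarrow> V (X (m + f k) \<omega>) \<le> val (cpl k (X m \<omega>) (X (m + f k) \<omega>) (R (m + f k) \<omega>))" for m k
  proof -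
    \<comment> \<open>Failure at fixed \<open>m\<close> and \<open>k\<close>, written as an event of
      the history together with the next segment and its variable. Its probability then becomes an
      average of the null probabilities in \<open>cpl_dominates\<close>; the pairs
      \<open>(m, k)\<close> are countable.\<close>
    define N where "N = {p\<in>space (history_space m \<Otimes>\<^sub>M (Pi\<^sub>M {..f k} (\<lambda>_. M) \<Otimes>\<^sub>M borel)).
      V (fst (fst p) m) \<le> val k \<and> \<not> V (fst (snd p) (f k)) \<le> val (cpl k (fst (fst p) m) (fst (snd p) (f k)) (snd (snd p)))}"
    let ?L = "history_space m \<Otimes>\<^sub>M (Pi\<^sub>M {..f k} (\<lambda>_. M) \<Otimes>\<^sub>M borel)"
    have x: "(\<lambda>p. fst (fst p) m) \<in> ?L \<rightarrow>\<^sub>M M"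
      by (rule measurable_compose[OF measurable_compose[OF measurable_fst measurable_fst] measurable_component_singleton]) simp
    have y: "(\<lambda>p. fst (snd p) (f k)) \<in> ?L \<rightarrow>\<^sub>M M"
      by (rule measurable_compose[OF measurable_compose[OF measurable_snd measurable_fst] measurable_component_singleton]) simp
    have u: "(\<lambda>p. snd (snd p)) \<in> borel_measurable ?L"
      by (rule measurable_compose[OF measurable_snd measurable_snd])
    have "(\<lambda>p. (\<lambda>(x, y, u). cpl k x y u) (fst (fst p) m, fst (snd p) (f k), snd (snd p))) \<in> ?L \<rightarrow>\<^sub>M count_space UNIV"
      by (rule measurable_compose[OF _ cpl_measurable]) (intro measurable_Pair x y u)
    from measurable_compose[OF this, of val borel]
    have vc: "(\<lambda>p. val (cpl k (fst (fst p) m) (fst (snd p) (f k)) (snd (snd p)))) \<in> borel_measurable ?L"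
      by simp
    note [measurable] = vc measurable_compose[OF x V] measurable_compose[OF y V]
    have N [measurable]: "N \<in> sets ?L"
      unfolding N_def by measurable
    have "(\<integral>\<^sup>+\<omega>. indicator N (history m \<omega>, (\<lambda>i\<in>{..f k}. X (m + i) \<omega>, R (m + f k) \<omega>)) \<partial>\<Omega>) =
        (\<integral>\<^sup>+\<omega>. (\<integral>\<^sup>+p. indicator N (history m \<omega>, p) \<partial>(chain_path M P (f k) (X m \<omega>) \<Otimes>\<^sub>M U)) \<partial>\<Omega>)"
      by (rule disintegration'[OF f_pos]) simp
    also have "\<dots> = (\<integral>\<^sup>+\<omega>. 0 \<partial>\<Omega>)"
    proof (intro nn_integral_cong)
      fix \<omega> assume \<omega>: "\<omega> \<in> space \<Omega>"
      note xs = X_space[OF \<omega>, of m]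
      have "AE p in chain_path M P (f k) (X m \<omega>) \<Otimes>\<^sub>M U. indicator N (history m \<omega>, p) = (0 :: ennreal)"
      proof (cases "V (X m \<omega>) \<le> val k")
        case True
        from cpl_dominates[OF xs this] show ?thesis
          by eventually_elim (auto simp: N_def history_def)
      next
        case False
        then show ?thesis
          by (intro AE_I2) (auto simp: N_def history_def)
      qed
      from nn_integral_cong_AE[OF this]
      show "(\<integral>\<^sup>+p. indicator N (history m \<omega>, p) \<partial>(chain_path M P (f k) (X m \<omega>) \<Otimes>\<^sub>M U)) = 0"
        by simp
    qed
    finally have "(\<integral>\<^sup>+\<omega>. indicator N (history m \<omega>, (\<lambda>i\<in>{..f k}. X (m + i) \<omega>, R (m + f k) \<omega>)) \<partial>\<Omega>) = 0"
      by simp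
    moreover have hist: "(\<lambda>\<omega>. (history m \<omega>, (\<lambda>i\<in>{..f k}. X (m + i) \<omega>, R (m + f k) \<omega>))) \<in> \<Omega> \<rightarrow>\<^sub>M ?L"
      by (intro measurable_Pair history_measurable measurable_restrict X R)
    ultimately have "AE \<omega> in \<Omega>. indicator N (history m \<omega>, (\<lambda>i\<in>{..f k}. X (m + i) \<omega>, R (m + f k) \<omega>)) = (0 :: ennreal)"
      using nn_integral_0_iff_AE[OF measurable_compose[OF hist borel_measurable_indicator[OF N]]] by blast
    with AE_space show ?thesis
    proof eventually_elim
      case (elim \<omega>)
      then show ?case
        using measurable_space[OF hist elim(1)] by (auto simp: N_def indicator_def history_def split: if_splits)
    qed
  qed
  then have "AE \<omega> in \<Omega>. \<forall>m k. V (X m \<omega>) \<le> val k \<longrightarrow> V (X (m + f k) \<omega>) \<le> val (cpl k (X m \<omega>) (X (m + f k) \<omega>) (R (m + f k) \<omega>))"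
    by (simp only: AE_all_countable) blast
  then show ?thesis
  proof eventually_elim
    case (elim \<omega>)
    show ?case
    proof (intro allI impI)
      fix m assume m: "moves Z (int m) \<omega> \<and> V (X m \<omega>) \<le> value_at Z (int m) \<omega>"
      then obtain k where k: "Z (int m) \<omega> = (k, 0)"
        by (cases "Z (int m) \<omega>") (simp add: moves_def)
      show "V (X (m + F (value_at Z (int m) \<omega>)) \<omega>) \<le> value_at Z (int (m + F (value_at Z (int m) \<omega>))) \<omega>"
        using elim[rule_format, of m k] m Z_move[OF k] by (simp add: value_at_def k F_val)
    qed
  qed
qed

end

section \<open>Monotone coupling of two laws\<close>

definition unit_law :: "real measure" where "unit_law = uniform_measure lborel {0..1}"

lemma prob_space_unit: "prob_space unit_law"
  unfolding unit_law_def by (rule prob_space_uniform_measure) auto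

lemma sets_unit [simp, measurable_cong]: "sets unit_law = sets borel"
  by (simp add: unit_law_def)

lemma space_unit [simp]: "space unit_law = UNIV"
  by (simp add: unit_law_def)

lemma emeasure_unit_atMost:
  assumes "0 \<le> a" "a \<le> 1"
  shows "emeasure unit_law {..a} = ennreal a"
proof -
  have "{0..1} \<inter> {..a} = {0..a}" using assms by auto
  then show ?thesis
    using assms divide_ennreal[of a 1] by (simp add: unit_law_def)
qed

lemma AE_unit: "AE u in unit_law. 0 \<le> u \<and> u \<le> 1"
  unfolding unit_law_def by (rule AE_uniform_measureI) auto

text \<open>The upper tail of an integer variable, evaluated at that variable, is discrete.
  Spreading each value uniformly over its jump, the interval from \<open>T (Suc l)\<close> to
  \<open>T l\<close>, of length the mass of \<open>l\<close>, produces an exactly uniform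
  variable.\<close>

lemma randomized_transform:
  assumes C: "prob_space C" and L [measurable]: "L \<in> C \<rightarrow>\<^sub>M count_space (UNIV :: nat set)"
    and t: "0 \<le> t" "t \<le> 1"
  defines "T \<equiv> \<lambda>l. measure C {s\<in>space C. l \<le> L s}"
  shows "emeasure (C \<Otimes>\<^sub>M unit_law) {p\<in>space (C \<Otimes>\<^sub>M unit_law). T (Suc (L (fst p))) + snd p * (T (L (fst p)) - T (Suc (L (fst p)))) \<le> t} = ennreal t"
proof -
  interpret C: prob_space C by fact
  interpret U: prob_space unit_law by (rule prob_space_unit)
  define w where "w l = measure C {s\<in>space C. L s = l}" for l
  have T_Suc: "T l = T (Suc l) + w l" for l
  proof -
    have "{s\<in>space C. l \<le> L s} = {s\<in>space C. Suc l \<le> L s} \<union> {s\<in>space C. L s = l}" by auto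
    then show ?thesis
      unfolding T_def w_def by (simp, subst C.finite_measure_Union) auto
  qed
  have w_nonneg: "0 \<le> w l" for l by (simp add: w_def)
  have T_le: "T l \<le> 1" and T_ge: "0 \<le> T l" for l by (simp_all add: T_def)
  have T_0: "T 0 = 1" using C.prob_space by (simp add: T_def)
  have T_lim: "T \<longlonglongrightarrow> 0"
  proof -
    have "(\<lambda>l. measure C {s\<in>space C. l \<le> L s}) \<longlonglongrightarrow> measure C (\<Inter>l. {s\<in>space C. l \<le> L s})"
      by (rule C.finite_Lim_measure_decseq) (auto simp: decseq_def)
    moreover have "(\<Inter>l. {s\<in>space C. l \<le> L s}) = {}"
    proof (rule equals0I)
      fix s assume "s \<in> (\<Inter>l. {s\<in>space C. l \<le> L s})"
      then have "Suc (L s) \<le> L s" by blast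
      then show False by simp
    qed
    ultimately show ?thesis by (simp add: T_def[abs_def])
  qed
  \<comment> \<open>The event \<open>L = l\<close> contributes the length of the part of its
    interval that lies below \<open>t\<close>; the cases are those of \<open>t\<close> below, inside
    or above the interval.\<close>
  have slice: "ennreal (w l) * emeasure unit_law {u. T (Suc l) + u * w l \<le> t} = ennreal (min t (T l) - min t (T (Suc l)))" for l
  proof (cases "w l = 0")
    case True
    then show ?thesis using T_Suc[of l] by simp
  next
    case False
    then have w: "0 < w l" using w_nonneg[of l] by simp
    have eq: "{u. T (Suc l) + u * w l \<le> t} = {..(t - T (Suc l)) / w l}"
      using w by (auto simp: field_simps)
    consider "t < T (Suc l)" | "T (Suc l) \<le> t" "t \<le> T l" | "T l < t" by linarith
    then show ?thesis
    proof cases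
      case 1
      have "AE u in unit_law. u \<notin> {..(t - T (Suc l)) / w l}"
        using AE_unit
      proof eventually_elim
        case (elim u)
        have "(t - T (Suc l)) / w l < 0" using 1 w by (simp add: divide_neg_pos)
        with elim show ?case by auto
      qed
      then have "emeasure unit_law {..(t - T (Suc l)) / w l} = 0"
        by (subst (asm) AE_iff_measurable[OF _ refl]) (auto simp: atMost_def)
      moreover have "min t (T l) - min t (T (Suc l)) = 0" using 1 T_Suc[of l] w by simp
      ultimately show ?thesis by (simp add: eq)
    next
      case 2
      then have "0 \<le> (t - T (Suc l)) / w l" "(t - T (Suc l)) / w l \<le> 1"
        using w T_Suc[of l] by (auto simp: field_simps)
      then have "emeasure unit_law {..(t - T (Suc l)) / w l} = ennreal ((t - T (Suc l)) / w l)"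
        by (rule emeasure_unit_atMost)
      then show ?thesis
        using 2 w by (simp add: eq ennreal_mult[symmetric])
    next
      case 3
      have "AE u in unit_law. u \<in> {..(t - T (Suc l)) / w l}"
        using AE_unit
      proof eventually_elim
        case (elim u)
        have "1 \<le> (t - T (Suc l)) / w l" using 3 w T_Suc[of l] by (simp add: field_simps)
        with elim show ?case by auto
      qed
      then have "emeasure unit_law {..(t - T (Suc l)) / w l} = 1"
        by (subst U.emeasure_eq_1_AE) auto
      then show ?thesis using 3 w T_Suc[of l] by (simp add: eq)
    qed
  qed
  let ?E = "{p\<in>space (C \<Otimes>\<^sub>M unit_law). T (Suc (L (fst p))) + snd p * (T (L (fst p)) - T (Suc (L (fst p)))) \<le> t}"
  have [measurable]: "(\<lambda>p. T (Suc (L (fst p)))) \<in> borel_measurable (C \<Otimes>\<^sub>M unit_law)" "(\<lambda>p. T (L (fst p))) \<in> borel_measurable (C \<Otimes>\<^sub>M unit_law)"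
    by (rule measurable_compose[OF measurable_compose[OF measurable_fst L]], simp)+
  have E: "?E \<in> sets (C \<Otimes>\<^sub>M unit_law)" by measurable
  have "emeasure (C \<Otimes>\<^sub>M unit_law) ?E = (\<integral>\<^sup>+s. emeasure unit_law (Pair s -` ?E) \<partial>C)"
    by (rule U.emeasure_pair_measure_alt[OF E])
  also have "\<dots> = (\<integral>\<^sup>+s. (\<Sum>l. emeasure unit_law {u. T (Suc l) + u * w l \<le> t} * indicator {s\<in>space C. L s = l} s) \<partial>C)"
  proof (intro nn_integral_cong)
    fix s assume s: "s \<in> space C"
    have "(\<Sum>l. emeasure unit_law {u. T (Suc l) + u * w l \<le> t} * indicator {s\<in>space C. L s = l} s) =
        (\<Sum>l\<in>{L s}. emeasure unit_law {u. T (Suc l) + u * w l \<le> t} * indicator {s\<in>space C. L s = l} s)"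
      by (rule suminf_finite) auto
    also have "\<dots> = emeasure unit_law {u. T (Suc (L s)) + u * w (L s) \<le> t}"
      using s by simp
    also have "{u. T (Suc (L s)) + u * w (L s) \<le> t} = Pair s -` ?E"
      using s T_Suc[of "L s"] by (auto simp: space_pair_measure)
    finally show "emeasure unit_law (Pair s -` ?E) = (\<Sum>l. emeasure unit_law {u. T (Suc l) + u * w l \<le> t} * indicator {s\<in>space C. L s = l} s)" ..
  qed
  also have "\<dots> = (\<Sum>l. emeasure unit_law {u. T (Suc l) + u * w l \<le> t} * emeasure C {s\<in>space C. L s = l})"
    by (subst nn_integral_suminf) (simp_all add: nn_integral_cmult_indicator)
  also have "\<dots> = (\<Sum>l. ennreal (min t (T l) - min t (T (Suc l))))"
    by (simp add: slice[symmetric] w_def C.emeasure_eq_measure mult.commute)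
  also have "\<dots> = ennreal t"
  proof (rule suminf_ennreal_eq)
    show "0 \<le> min t (T l) - min t (T (Suc l))" for l
      using T_Suc[of l] w_nonneg[of l] by simp
    \<comment> \<open>The intervals tile the range from 0 to 1, since \<open>T 0 = 1\<close> and
      \<open>T\<close> tends to 0.\<close>
    have "(\<lambda>l. min t (T l) - min t (T (Suc l))) sums (min t (T 0) - min t 0)"
      by (intro telescope_sums' tendsto_min tendsto_const T_lim)
    then show "(\<lambda>l. min t (T l) - min t (T (Suc l))) sums t"
      using t by (simp add: T_0)
  qed
  finally show ?thesis .
qed

text \<open>The quantile function of the geometric law read from its upper tail: small
  \<open>t\<close> gives a large index.\<close>

definition tail_index :: "real \<Rightarrow> real \<Rightarrow> nat" where
  "tail_index r t = nat \<lfloor>- log r t\<rfloor>"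

lemma tail_index_ge:
  assumes "1 < r" "0 < t" "t \<le> 1"
  shows "j \<le> tail_index r t \<longleftrightarrow> t \<le> (1 / r) ^ j"
proof -
  have "0 \<le> - log r t" using assms by (simp add: log_le_zero_cancel_iff)
  then have "j \<le> tail_index r t \<longleftrightarrow> real j \<le> - log r t"
    unfolding tail_index_def by (simp add: le_nat_iff le_floor_iff)
  also have "\<dots> \<longleftrightarrow> log r t \<le> - real j" by linarith
  also have "\<dots> \<longleftrightarrow> t \<le> r powr (- real j)"
    using assms by (simp add: log_le_iff)
  also have "r powr (- real j) = (1 / r) ^ j"
    using assms by (simp add: powr_minus powr_realpow power_one_over field_simps)
  finally show ?thesis .
qed

lemma tail_index_measurable [measurable]: "tail_index r \<in> borel \<rightarrow>\<^sub>M count_space UNIV"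
  unfolding tail_index_def by measurable

lemma tail_index_law:
  assumes D: "prob_space D" and T [measurable]: "T \<in> borel_measurable D" and r: "1 < r"
    and uniform: "\<And>t. 0 \<le> t \<Longrightarrow> t \<le> 1 \<Longrightarrow> emeasure D {\<omega>\<in>space D. T \<omega> \<le> t} = ennreal t"
  shows "distr D (count_space UNIV) (\<lambda>\<omega>. tail_index r (T \<omega>)) = measure_pmf (geometric_pmf (1 - 1 / r))"
proof (rule measure_eqI_countable[of _ UNIV])
  interpret D: prob_space D by fact
  \<comment> \<open>The inversion of the tail through a logarithm needs an argument in the unit
    interval and off 0, which uniformity gives almost surely.\<close>
  have pos: "AE \<omega> in D. 0 < T \<omega> \<and> T \<omega> \<le> 1"
  proof -
    have "AE \<omega> in D. \<not> T \<omega> \<le> 0"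
      using uniform[of 0] by (subst AE_iff_measurable[OF _ refl]) auto
    moreover have "AE \<omega> in D. \<omega> \<in> {\<omega>\<in>space D. T \<omega> \<le> 1}"
      using uniform[of 1] by (subst D.AE_in_set_eq_1) (simp_all add: measure_def)
    ultimately show ?thesis by eventually_elim auto
  qed
  define p where "p = 1 - 1 / r"
  have p: "0 < p" "p \<le> 1" using r by (auto simp: p_def field_simps)
  have tail: "measure D {\<omega>\<in>space D. j \<le> tail_index r (T \<omega>)} = (1 / r) ^ j" for j
  proof -
    have "emeasure D {\<omega>\<in>space D. j \<le> tail_index r (T \<omega>)} = emeasure D {\<omega>\<in>space D. T \<omega> \<le> (1 / r) ^ j}"
    proof (rule emeasure_eq_AE)
      show "AE \<omega> in D. \<omega> \<in> {\<omega>\<in>space D. j \<le> tail_index r (T \<omega>)} \<longleftrightarrow> \<omega> \<in> {\<omega>\<in>space D. T \<omega> \<le> (1 / r) ^ j}"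
        using pos by eventually_elim (simp add: tail_index_ge[OF r])
    qed measurable
    also have "\<dots> = ennreal ((1 / r) ^ j)"
      using r by (intro uniform power_le_one) auto
    finally show ?thesis using r by (simp add: measure_def)
  qed
  fix j
  have "measure D {\<omega>\<in>space D. tail_index r (T \<omega>) = j} = (1 / r) ^ j - (1 / r) ^ Suc j"
  proof -
    have "{\<omega>\<in>space D. tail_index r (T \<omega>) = j} = {\<omega>\<in>space D. j \<le> tail_index r (T \<omega>)} - {\<omega>\<in>space D. Suc j \<le> tail_index r (T \<omega>)}"
      by auto
    also have "measure D \<dots> = (1 / r) ^ j - (1 / r) ^ Suc j"
      unfolding tail[symmetric] by (rule D.finite_measure_Diff) auto
    finally show ?thesis .
  qed
  also have "(1 / r) ^ j - (1 / r) ^ Suc j = pmf (geometric_pmf p) j"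
    using p by (simp add: p_def algebra_simps)
  finally show "emeasure (distr D (count_space UNIV) (\<lambda>\<omega>. tail_index r (T \<omega>))) {j} = emeasure (geometric_pmf (1 - 1 / r)) {j}"
    by (subst emeasure_distr) (simp_all add: emeasure_pmf_single D.emeasure_eq_measure vimage_def Int_def conj_commute p_def)
qed auto

section \<open>Choice of the parameters\<close>

text \<open>
  With \<open>r\<close> close to 1 and \<open>r ^ c\<close> fixed, the moment below tends to \<open>exp (- s \<delta>) / (1 - \<delta>)\<close>, where
  \<open>exp (- s)\<close> is the limit of \<open>r ^ (- c - 1)\<close>; this is where the condition on \<open>\<beta>\<close> enters.
\<close>

lemma grid_parameters:
  fixes \<beta> \<delta> :: real
  assumes "0 < \<delta>" "\<delta> < 1" "0 < \<beta>" and "ln \<beta> < (1 / \<delta>) * ln (1 - \<delta>)"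
  obtains r :: real and c :: nat where "1 < r" and "\<beta> < (1 / r) ^ Suc c"
    and "((1 / r) ^ c) powr \<delta> * ((1 - 1 / r) / (1 - r powr \<delta> / r)) < 1" and "r powr \<delta> < r"
proof -
  \<comment> \<open>Room is kept on both sides of \<open>- s\<close>, so that both requirements are
    strict in the limit and hold for a fine enough grid.\<close>
  obtain s where s: "ln \<beta> < - s" "- s < (1 / \<delta>) * ln (1 - \<delta>)"
    using dense[OF assms(4)] by (metis minus_minus)
  have "ln (1 - \<delta>) < 0" using assms by simp
  then have "(1 / \<delta>) * ln (1 - \<delta>) < 0" using assms by (simp add: mult_pos_neg divide_neg_pos)
  then have s_pos: "s > 0" using s by linarith
  have lim1: "(\<lambda>n. exp (- s - s / real n)) \<longlonglongrightarrow> exp (- s)"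
    by real_asymp
  have "\<beta> < exp (- s)"
    using s(1) assms(3) by (metis exp_less_cancel_iff exp_ln)
  then have ev1: "eventually (\<lambda>n. \<beta> < exp (- s - s / real n)) sequentially"
    by (rule order_tendstoD(1)[OF lim1])
  have "((\<lambda>h. (1 - exp (- h)) / (1 - exp (- (1 - \<delta>) * h))) \<longlongrightarrow> inverse (1 - \<delta>)) (at_right (0::real))"
    using assms by real_asymp
  moreover have "filterlim (\<lambda>n. s / real n) (at_right 0) sequentially"
    using s_pos by real_asymp
  ultimately have "(\<lambda>n. (1 - exp (- (s / real n))) / (1 - exp (- (1 - \<delta>) * (s / real n)))) \<longlonglongrightarrow> inverse (1 - \<delta>)"
    by (rule filterlim_compose)
  then have lim2: "(\<lambda>n. exp (- s * \<delta>) * ((1 - exp (- (s / real n))) / (1 - exp (- (1 - \<delta>) * (s / real n))))) \<longlonglongrightarrow> exp (- s * \<delta>) * (1 / (1 - \<delta>))"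
    unfolding inverse_eq_divide by (intro tendsto_mult tendsto_const)
  have "exp (- s * \<delta>) < 1 - \<delta>"
  proof -
    have "- s * \<delta> < ln (1 - \<delta>)" using s(2) assms by (simp add: field_simps)
    then have "exp (- s * \<delta>) < exp (ln (1 - \<delta>))" by (simp only: exp_less_cancel_iff)
    then show ?thesis using assms by simp
  qed
  then have "exp (- s * \<delta>) * (1 / (1 - \<delta>)) < 1" using assms by (simp add: field_simps)
  then have ev2: "eventually (\<lambda>n. exp (- s * \<delta>) * ((1 - exp (- (s / real n))) / (1 - exp (- (1 - \<delta>) * (s / real n)))) < 1) sequentially"
    by (rule order_tendstoD(2)[OF lim2])
  obtain n where n: "n > 0" "\<beta> < exp (- s - s / real n)"
      "exp (- s * \<delta>) * ((1 - exp (- (s / real n))) / (1 - exp (- (1 - \<delta>) * (s / real n)))) < 1"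
    using eventually_happens[OF eventually_conj[OF eventually_gt_at_top[of 0] eventually_conj[OF ev1 ev2]]] by auto
  \<comment> \<open>With \<open>c = n\<close> the product \<open>r ^ c\<close> is
    \<open>exp s\<close> for every \<open>n\<close>; only the mesh of the grid is refined.\<close>
  define r where "r = exp (s / real n)"
  have r: "1 < r" using s_pos n(1) by (simp add: r_def)
  have inv: "1 / r = exp (- (s / real n))" by (simp add: r_def exp_minus inverse_eq_divide)
  have pow: "(1 / r) ^ n = exp (- s)"
    unfolding inv exp_of_nat_mult[symmetric] using n(1) by simp
  show ?thesis
  proof
    show "1 < r" by (rule r)
    have "(1 / r) ^ Suc n = exp (- s) * exp (- (s / real n))" by (simp add: pow[symmetric] inv[symmetric])
    also have "\<dots> = exp (- s - s / real n)" by (simp add: exp_add[symmetric])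
    finally show "\<beta> < (1 / r) ^ Suc n" using n(2) by simp
    have "r powr \<delta> / r = exp (\<delta> * (s / real n) - s / real n)"
      by (simp add: r_def powr_def exp_diff)
    also have "\<delta> * (s / real n) - s / real n = - (1 - \<delta>) * (s / real n)"
      by (simp only: minus_diff_eq left_diff_distrib mult_1 minus_mult_left[symmetric])
    finally have "r powr \<delta> / r = exp (- (1 - \<delta>) * (s / real n))" .
    moreover have "((1 / r) ^ n) powr \<delta> = exp (- s * \<delta>)"
      by (simp add: pow powr_def)
    ultimately show "((1 / r) ^ n) powr \<delta> * ((1 - 1 / r) / (1 - r powr \<delta> / r)) < 1"
      using n(3) by (simp add: inv)
    show "r powr \<delta> < r"
      using powr_less_mono[of \<delta> 1 r] r assms by simp
  qed
qed

text \<open>As \<open>\<delta> < 1\<close>, all terms besides \<open>\<beta> * z\<close> vanish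
  relative to \<open>z\<close>, and the slack between \<beta> and \<open>\<beta>'\<close> absorbs
  them from some \<open>z0\<close> on. This decides where the grid has to start.\<close>

lemma sublinear_bound:
  fixes \<beta> \<delta> lam a b :: real
  assumes "\<delta> < 1" "\<beta> < \<beta>'" "0 \<le> a" "0 \<le> b" "0 < lam" "0 < \<delta>"
  obtains z0 where "\<And>z. z0 \<le> z \<Longrightarrow> \<beta> * z + a + b * (lam * z powr \<delta> + 1) \<le> \<beta>' * z"
proof -
  have "((\<lambda>z. a / z + b * (lam * (z powr \<delta> / z) + 1 / z)) \<longlongrightarrow> 0 + b * (lam * 0 + 0)) at_top"
  proof (intro tendsto_add tendsto_mult tendsto_const)
    show "((\<lambda>z. a / z) \<longlongrightarrow> 0) at_top" by real_asymp
    show "((\<lambda>z. 1 / z :: real) \<longlongrightarrow> 0) at_top" by real_asymp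
    show "((\<lambda>z. z powr \<delta> / z) \<longlongrightarrow> 0) at_top" using assms by real_asymp
  qed
  then have "eventually (\<lambda>z. a / z + b * (lam * (z powr \<delta> / z) + 1 / z) < \<beta>' - \<beta>) at_top"
    using assms by (intro order_tendstoD(2)) auto
  then have "eventually (\<lambda>z. \<beta> * z + a + b * (lam * z powr \<delta> + 1) \<le> \<beta>' * z) at_top"
    using eventually_gt_at_top[of 0]
  proof eventually_elim
    case (elim z)
    then have "(a / z + b * (lam * (z powr \<delta> / z) + 1 / z)) * z \<le> (\<beta>' - \<beta>) * z"
      by (intro mult_right_mono) auto
    also have "(a / z + b * (lam * (z powr \<delta> / z) + 1 / z)) * z = a + b * (lam * z powr \<delta> + 1)"
      using elim by (simp add: field_simps)
    finally show ?case by (simp add: algebra_simps)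
  qed
  then show ?thesis
    using that unfolding eventually_at_top_linorder by blast
qed

lemma taming_function_pos:
  assumes "0 < lam" "1 \<le> d"
  shows "0 < taming_function lam \<delta> d z"
proof (cases "z > d")
  case True
  then have "0 < lam * z powr \<delta>" using assms by simp
  then show ?thesis using True by (simp add: taming_function_def)
qed (simp add: taming_function_def)

text \<open>Ensures that a sojourn at a value above \<open>V x\<close> outlasts the time at which
  taming is known to hold, so that only additional steps have to be estimated. Across the threshold
  \<open>d\<close> it rises from 1 to a positive integer.\<close>

lemma taming_function_mono:
  assumes "0 < lam" "1 \<le> d" "0 < \<delta>" "z \<le> z'"
  shows "taming_function lam \<delta> d z \<le> taming_function lam \<delta> d z'"
proof (cases "z > d")
  case True
  then have "lam * z powr \<delta> \<le> lam * z' powr \<delta>"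
    using assms by (intro mult_left_mono powr_mono2) auto
  then have "nat \<lceil>lam * z powr \<delta>\<rceil> \<le> nat \<lceil>lam * z' powr \<delta>\<rceil>"
    by (intro nat_mono ceiling_mono)
  then show ?thesis
    using True assms by (simp add: taming_function_def)
next
  case False
  then show ?thesis
    using taming_function_pos[OF assms(1,2), of \<delta> z'] by (simp add: taming_function_def Suc_le_eq)
qed

lemma taming_function_le:
  assumes "0 < lam" "1 \<le> d" "1 \<le> z"
  shows "real (taming_function lam \<delta> d z) \<le> lam * z powr \<delta> + 1"
proof (cases "z > d")
  case True
  have "0 \<le> lam * z powr \<delta>" using assms by simp
  then have "0 \<le> \<lceil>lam * z powr \<delta>\<rceil>" by simp
  then have "real (nat \<lceil>lam * z powr \<delta>\<rceil>) = of_int \<lceil>lam * z powr \<delta>\<rceil>" by simp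
  also have "\<dots> \<le> lam * z powr \<delta> + 1" by linarith
  finally show ?thesis using True by (simp add: taming_function_def)
qed (use assms in \<open>simp add: taming_function_def\<close>)

section \<open>The dominating grid chain\<close>

text \<open>The left-hand side of \<open>moment\<close> is the factor by which a move multiplies the
  mean of \<open>val\<close> to the power \<delta> off the atom: a descent by \<open>c\<close>
  levels, times the moment of the upward jump.\<close>

locale grid =
  fixes r \<delta> K :: real and c k0 :: nat and F :: "real \<Rightarrow> nat"
  assumes r: "1 < r" and \<delta>: "r powr \<delta> < r"
    and moment: "((1 / r) ^ c) powr \<delta> * ((1 - 1 / r) / (1 - r powr \<delta> / r)) < 1"
    and F_pos: "0 < F z" and K_pos: "0 < K" and F_le: "1 \<le> z \<Longrightarrow> real (F z) \<le> K * z powr \<delta>"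
begin

definition val :: "nat \<Rightarrow> real" where "val k = r ^ (k0 + k)"

text \<open>The failure probability is \<open>1 / r\<close>, so that the mass of
  \<open>{j..}\<close> is \<open>(1 / r) ^ j\<close>.\<close>

definition jumps :: "nat pmf" where "jumps = geometric_pmf (1 - 1 / r)"

text \<open>Truncated subtraction makes \<open>{..c}\<close> an atom.\<close>

definition q :: "nat \<Rightarrow> nat pmf" where "q k = map_pmf (\<lambda>g. k - c + g) jumps"

definition \<gamma> :: real where "\<gamma> = ((1 / r) ^ c) powr \<delta> * ((1 - 1 / r) / (1 - r powr \<delta> / r))"

lemma val_pos: "0 < val k" and val_ge_1: "1 \<le> val k"
  using r by (simp_all add: val_def)

lemma val_add: "val (k + j) = val k * r ^ j"
  by (simp add: val_def power_add)

lemma pmf_jumps: "pmf jumps g = (1 - 1 / r) * (1 / r) ^ g"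
proof -
  have "0 < 1 - 1 / r" "1 - 1 / r \<le> 1" using r by (auto simp: field_simps)
  then show ?thesis by (simp add: jumps_def)
qed

text \<open>A geometric series with ratio \<open>r powr \<delta> / r\<close>: the value grows by
  \<open>r powr \<delta>\<close> per level in the moment, while the probability falls by
  \<open>1 / r\<close>.\<close>

lemma jumps_moment:
  "(\<integral>\<^sup>+g. ennreal (val (j + g) powr \<delta>) \<partial>jumps) = ennreal (val j powr \<delta> * ((1 - 1 / r) / (1 - r powr \<delta> / r)))"
proof -
  have \<rho>: "0 \<le> r powr \<delta> / r" "r powr \<delta> / r < 1" using r \<delta> by auto
  have "(\<integral>\<^sup>+g. ennreal (val (j + g) powr \<delta>) \<partial>jumps) = (\<Sum>g. ennreal (pmf jumps g) * ennreal (val (j + g) powr \<delta>))"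
    by (simp add: nn_integral_measure_pmf nn_integral_count_space_nat)
  also have "\<dots> = (\<Sum>g. ennreal ((val j powr \<delta> * (1 - 1 / r)) * (r powr \<delta> / r) ^ g))"
  proof (rule suminf_cong)
    fix g
    have "(r ^ g) powr \<delta> = (r powr \<delta>) ^ g"
      using r by (simp add: powr_realpow[symmetric] powr_powr mult.commute)
    then have "pmf jumps g * val (j + g) powr \<delta> = (val j powr \<delta> * (1 - 1 / r)) * (r powr \<delta> / r) ^ g"
      using r val_pos[of j] by (simp add: pmf_jumps val_add powr_mult power_divide)
    then show "ennreal (pmf jumps g) * ennreal (val (j + g) powr \<delta>) = ennreal ((val j powr \<delta> * (1 - 1 / r)) * (r powr \<delta> / r) ^ g)"
      by (simp add: ennreal_mult[symmetric])
  qed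
  also have "\<dots> = ennreal ((val j powr \<delta> * (1 - 1 / r)) * (1 / (1 - r powr \<delta> / r)))"
    using r \<rho> by (intro suminf_ennreal_eq sums_mult geometric_sums) auto
  finally show ?thesis by simp
qed

lemma q_moment: "(\<integral>\<^sup>+j. ennreal (val j powr \<delta>) \<partial>q k) = ennreal (val (k - c) powr \<delta> * ((1 - 1 / r) / (1 - r powr \<delta> / r)))"
  by (simp add: q_def jumps_moment)

sublocale paused_grid q "\<lambda>k. F (val k)" "\<lambda>k. ennreal (val k powr \<delta>)" "{..c}" jumps \<gamma> K val F
proof
  show "0 < F (val k)" for k by (rule F_pos)
  show "q k = jumps" if "k \<in> {..c}" for k
    using that by (simp add: q_def map_pmf_ident)
  show "ennreal (val k powr \<delta>) < \<infinity>" for k by simp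
  show "of_nat (F (val k)) \<le> ennreal K * ennreal (val k powr \<delta>)" for k
    using F_le[OF val_ge_1[of k]] K_pos by (simp add: ennreal_mult[symmetric] ennreal_of_nat_eq_real_of_nat ennreal_leI)
  have m: "0 < (1 - 1 / r) / (1 - r powr \<delta> / r)"
    using r \<delta> by (intro divide_pos_pos) (auto simp: field_simps)
  show "0 < \<gamma>" unfolding \<gamma>_def using r by (intro mult_pos_pos m) simp
  show "\<gamma> < 1" using moment by (simp add: \<gamma>_def)
  show "0 < K" by (rule K_pos)
  show "(\<integral>\<^sup>+j. ennreal (val j powr \<delta>) \<partial>q k) \<le> ennreal \<gamma> * ennreal (val k powr \<delta>)" if "k \<notin> {..c}" for k
  proof -
    \<comment> \<open>Off the atom the subtraction is not truncated, so the descent is by exactly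
      \<open>c\<close> levels.\<close>
    have "val k = val (k - c) * r ^ c" using that val_add[of "k - c" c] by simp
    then have "val (k - c) = val k * (1 / r) ^ c" using r by (simp add: power_one_over)
    then have eq: "val (k - c) powr \<delta> = val k powr \<delta> * ((1 / r) ^ c) powr \<delta>"
      using r val_pos[of k] by (simp add: powr_mult)
    have mult: "ennreal (v * A * m0) \<le> ennreal (A * m0) * ennreal v" if "0 \<le> A" "0 \<le> m0" "0 \<le> v" for v A m0 :: real
      using that by (simp add: ennreal_mult[symmetric] mult_ac)
    show ?thesis
      unfolding q_moment \<gamma>_def eq by (rule mult) (use m in simp_all)
  qed
  show "(\<integral>\<^sup>+j. ennreal (val j powr \<delta>) \<partial>jumps) < \<infinity>"
    using jumps_moment[of 0] by simp
  show "inj val"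
    using r by (intro injI) (simp add: val_def power_inject_exp)
qed simp

lemma q_law:
  assumes "prob_space D" "T \<in> borel_measurable D"
    and "\<And>t. 0 \<le> t \<Longrightarrow> t \<le> 1 \<Longrightarrow> emeasure D {\<omega>\<in>space D. T \<omega> \<le> t} = ennreal t"
  shows "distr D (count_space UNIV) (\<lambda>\<omega>. k - c + tail_index r (T \<omega>)) = measure_pmf (q k)"
proof -
  have "distr D (count_space UNIV) (\<lambda>\<omega>. k - c + tail_index r (T \<omega>)) =
      distr (distr D (count_space UNIV) (\<lambda>\<omega>. tail_index r (T \<omega>))) (count_space UNIV) (\<lambda>g. k - c + g)"
    using measurable_compose[OF assms(2) tail_index_measurable] by (subst distr_distr) (auto simp: comp_def)
  then show ?thesis
    by (simp add: tail_index_law[OF assms(1,2) r assms(3)] q_def jumps_def map_pmf_rep_eq)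
qed

end

section \<open>Domination of the end of a segment\<close>

locale dominated_grid = grid r \<delta> K c k0 F
  for r \<delta> K c k0 F +
  fixes M :: "'a measure" and P :: "'a \<Rightarrow> 'a measure" and V :: "'a \<Rightarrow> real"
  assumes P [measurable]: "P \<in> M \<rightarrow>\<^sub>M prob_algebra M" and V [measurable]: "V \<in> borel_measurable M"
    and mean: "x \<in> space M \<Longrightarrow> V x \<le> val k \<Longrightarrow>
      (\<integral>\<^sup>+s. ennreal (V (s (F (val k)))) \<partial>chain_path M P (F (val k)) x) \<le> ennreal (val k * (1 / r) ^ Suc c)"
begin

abbreviation f :: "nat \<Rightarrow> nat" where "f k \<equiv> F (val k)"

text \<open>\<open>V y\<close> rounded up to the grid, measured from the level \<open>k - c\<close>
  at which the jump starts: the next value dominates exactly when the jump is at least this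
  number.\<close>

definition level :: "nat \<Rightarrow> 'a \<Rightarrow> nat" where
  "level k y = (LEAST l. V y \<le> val (k - c + l))"

lemma val_unbounded: "\<exists>l. v \<le> val (k - c + l)"
proof -
  obtain n where "v < r ^ n" using real_arch_pow[OF r] by blast
  also have "r ^ n \<le> val (k - c + n)" using r by (simp add: val_def power_increasing)
  finally show ?thesis by (auto intro: less_imp_le)
qed

lemma val_mono: "k \<le> j \<Longrightarrow> val k \<le> val j"
  using r by (simp add: val_def power_increasing)

lemma level_le_iff: "level k y \<le> l \<longleftrightarrow> V y \<le> val (k - c + l)"
proof
  have "V y \<le> val (k - c + level k y)"
    unfolding level_def by (rule LeastI_ex) (rule val_unbounded)
  also assume "level k y \<le> l"
  then have "val (k - c + level k y) \<le> val (k - c + l)" by (intro val_mono) simp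
  finally show "V y \<le> val (k - c + l)" .
qed (simp add: level_def Least_le)

lemma level_measurable [measurable]: "level k \<in> M \<rightarrow>\<^sub>M count_space UNIV"
  unfolding level_def by measurable

definition tail_set :: "nat \<Rightarrow> nat \<Rightarrow> (nat \<Rightarrow> 'a) set" where
  "tail_set k l = {s\<in>space (Pi\<^sub>M {..f k} (\<lambda>_. M)). l \<le> level k (s (f k))}"

definition tail :: "nat \<Rightarrow> 'a \<Rightarrow> nat \<Rightarrow> real" where
  "tail k x l = measure (chain_path M P (f k) x) (tail_set k l)"

text \<open>The randomised upper tail of the level at the end of a segment from \<open>x\<close>,
  uniform by \<open>randomized_transform\<close>. Feeding it to \<open>tail_index\<close> gives a
  jump that is large when the level is.\<close>

definition rank :: "nat \<Rightarrow> 'a \<Rightarrow> 'a \<Rightarrow> real \<Rightarrow> real" where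
  "rank k x y u = tail k x (Suc (level k y)) + u * (tail k x (level k y) - tail k x (Suc (level k y)))"

definition cpl :: "nat \<Rightarrow> 'a \<Rightarrow> 'a \<Rightarrow> real \<Rightarrow> nat" where
  "cpl k x y u = k - c + tail_index r (rank k x y u)"

lemma endpoint_measurable: "(\<lambda>s. s (f k)) \<in> Pi\<^sub>M {..f k} (\<lambda>_. M) \<rightarrow>\<^sub>M M"
  by (rule measurable_component_singleton) simp

lemma tail_set_sets: "tail_set k l \<in> sets (Pi\<^sub>M {..f k} (\<lambda>_. M))"
proof -
  note [measurable] = measurable_compose[OF endpoint_measurable level_measurable]
  show ?thesis unfolding tail_set_def by measurable
qed

lemma rank_measurable:
  "(\<lambda>p. rank k (fst p) (fst (snd p)) (snd (snd p))) \<in> borel_measurable (M \<Otimes>\<^sub>M M \<Otimes>\<^sub>M borel)"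
proof -
  have t: "(\<lambda>x. tail k x l) \<in> borel_measurable M" for l
    unfolding tail_def
    by (rule measurable_compose[OF measurable_chain_path[OF P] measurable_measure_prob_algebra[OF tail_set_sets]])
  have lv: "(\<lambda>p. level k (fst (snd p))) \<in> M \<Otimes>\<^sub>M M \<Otimes>\<^sub>M (borel :: real measure) \<rightarrow>\<^sub>M count_space UNIV"
    by measurable
  have "(\<lambda>p. (\<lambda>l p. tail k (fst p) l) (level k (fst (snd p))) p) \<in> borel_measurable (M \<Otimes>\<^sub>M M \<Otimes>\<^sub>M (borel :: real measure))"
    by (rule measurable_compose_countable[where f="\<lambda>l p. tail k (fst p) l", OF measurable_compose[OF measurable_fst t] lv])
  moreover have "(\<lambda>p. (\<lambda>l p. tail k (fst p) (Suc l)) (level k (fst (snd p))) p) \<in> borel_measurable (M \<Otimes>\<^sub>M M \<Otimes>\<^sub>M (borel :: real measure))"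
    by (rule measurable_compose_countable[where f="\<lambda>l p. tail k (fst p) (Suc l)", OF measurable_compose[OF measurable_fst t] lv])
  ultimately show ?thesis
    unfolding rank_def by measurable
qed

lemma cpl_measurable: "(\<lambda>(x, y, u). cpl k x y u) \<in> M \<Otimes>\<^sub>M M \<Otimes>\<^sub>M borel \<rightarrow>\<^sub>M count_space UNIV"
proof -
  have "(\<lambda>p. tail_index r (rank k (fst p) (fst (snd p)) (snd (snd p)))) \<in> M \<Otimes>\<^sub>M M \<Otimes>\<^sub>M borel \<rightarrow>\<^sub>M count_space UNIV"
    by (rule measurable_compose[OF rank_measurable tail_index_measurable])
  from measurable_compose[OF this, of "\<lambda>g. k - c + g" "count_space UNIV"] show ?thesis
    by (simp add: cpl_def split_beta)
qed

lemma path_rank: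
  assumes x: "x \<in> space M"
  shows "(\<lambda>p. rank k x (fst p (f k)) (snd p)) \<in> borel_measurable (chain_path M P (f k) x \<Otimes>\<^sub>M unit_law)" (is ?m)
    and "0 \<le> t \<Longrightarrow> t \<le> 1 \<Longrightarrow> emeasure (chain_path M P (f k) x \<Otimes>\<^sub>M unit_law)
      {p\<in>space (chain_path M P (f k) x \<Otimes>\<^sub>M unit_law). rank k x (fst p (f k)) (snd p) \<le> t} = ennreal t"
proof -
  note sets_C = sets_chain_path[OF P x, of "f k"]
  note space_C = sets_eq_imp_space_eq[OF sets_C]
  have end_C: "(\<lambda>s. s (f k)) \<in> chain_path M P (f k) x \<rightarrow>\<^sub>M M"
    using endpoint_measurable by (simp only: measurable_cong_sets[OF sets_C refl])
  have L: "(\<lambda>s. level k (s (f k))) \<in> chain_path M P (f k) x \<rightarrow>\<^sub>M count_space UNIV"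
    by (rule measurable_compose[OF end_C level_measurable])
  have "(\<lambda>p. (x, fst p (f k), snd p)) \<in> chain_path M P (f k) x \<Otimes>\<^sub>M unit_law \<rightarrow>\<^sub>M M \<Otimes>\<^sub>M M \<Otimes>\<^sub>M borel"
  proof (intro measurable_Pair measurable_const x)
    show "(\<lambda>p. fst p (f k)) \<in> chain_path M P (f k) x \<Otimes>\<^sub>M unit_law \<rightarrow>\<^sub>M M"
      by (rule measurable_compose[OF measurable_fst end_C])
    show "snd \<in> borel_measurable (chain_path M P (f k) x \<Otimes>\<^sub>M unit_law)"
      using measurable_snd[of "chain_path M P (f k) x" unit_law] by (simp cong: measurable_cong_sets)
  qed
  from measurable_compose[OF this rank_measurable[of k]] show ?m by simp
  assume "0 \<le> t" "t \<le> 1"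
  from randomized_transform[OF prob_space_chain_path[OF P x] L this]
  show "emeasure (chain_path M P (f k) x \<Otimes>\<^sub>M unit_law)
      {p\<in>space (chain_path M P (f k) x \<Otimes>\<^sub>M unit_law). rank k x (fst p (f k)) (snd p) \<le> t} = ennreal t"
    by (simp only: rank_def tail_def tail_set_def space_C)
qed

lemma cpl_law:
  assumes x: "x \<in> space M"
  shows "distr (chain_path M P (f k) x \<Otimes>\<^sub>M unit_law) (count_space UNIV) (\<lambda>(s, u). cpl k x (s (f k)) u) = measure_pmf (q k)"
proof -
  interpret C: prob_space "chain_path M P (f k) x" by (rule prob_space_chain_path[OF P x])
  interpret U: prob_space unit_law by (rule prob_space_unit)
  interpret CU: pair_prob_space "chain_path M P (f k) x" unit_law ..
  show ?thesis
    unfolding case_prod_unfold cpl_def by (rule q_law[OF CU.prob_space_axioms path_rank[OF x]])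
qed

text \<open>Markov's inequality bounds the tails of \<open>V\<close> at the end of a segment by those of the next value of the dominating chain.\<close>

lemma tail_le:
  assumes x: "x \<in> space M" and Vx: "V x \<le> val k"
  shows "tail k x l \<le> (1 / r) ^ l"
proof (cases l)
  case 0
  then show ?thesis
    using prob_space.prob_le_1[OF prob_space_chain_path[OF P x]] by (simp add: tail_def)
next
  case (Suc j)
  let ?C = "chain_path M P (f k) x" and ?v = "val (k - c + j)"
  interpret C: prob_space ?C by (rule prob_space_chain_path[OF P x])
  note sets_C = sets_chain_path[OF P x, of "f k"]
  note space_C = sets_eq_imp_space_eq[OF sets_C]
  have [measurable]: "(\<lambda>s. s (f k)) \<in> ?C \<rightarrow>\<^sub>M M"
    using endpoint_measurable by (simp only: measurable_cong_sets[OF sets_C refl])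
  have sub: "tail_set k l \<subseteq> {s\<in>space ?C. 1 \<le> ennreal (1 / ?v) * ennreal (V (s (f k)))}"
  proof
    fix s assume s: "s \<in> tail_set k l"
    \<comment> \<open>Reaching level \<open>Suc j\<close> means only exceeding
      \<open>val (k - c + j)\<close>, one grid step lower. This loss from rounding is compensated by
      the exponent \<open>Suc c\<close> instead of \<open>c\<close> in \<open>mean\<close>.\<close>
    then have "\<not> level k (s (f k)) \<le> j" by (simp add: tail_set_def Suc)
    then have "?v < V (s (f k))" by (simp add: level_le_iff)
    then have "1 \<le> 1 / ?v * V (s (f k))" using val_pos[of "k - c + j"] by (simp add: field_simps)
    then have "1 \<le> ennreal (1 / ?v) * ennreal (V (s (f k)))"
      using val_pos[of "k - c + j"] by (subst ennreal_mult'[symmetric]) (simp_all add: less_imp_le)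
    then show "s \<in> {s\<in>space ?C. 1 \<le> ennreal (1 / ?v) * ennreal (V (s (f k)))}"
      using s by (simp add: tail_set_def space_C)
  qed
  have v: "val k * (1 / r) ^ Suc c / ?v \<le> (1 / r) ^ l"
  proof -
    \<comment> \<open>Only an inequality, because \<open>k - c\<close> is truncated when
      \<open>k < c\<close>; it goes in the favourable direction.\<close>
    have "val k \<le> val (k - c + c)" by (rule val_mono) simp
    also have "\<dots> = val (k - c) * r ^ c" by (rule val_add)
    finally have "val k * (1 / r) ^ c \<le> val (k - c)"
      using r by (simp add: power_one_over field_simps)
    then have "val k * (1 / r) ^ Suc c / ?v \<le> val (k - c) * (1 / r) / ?v"
      using r val_pos[of "k - c + j"] by (intro divide_right_mono) (auto simp: field_simps)
    also have "\<dots> = (1 / r) ^ l"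
      using r val_pos[of "k - c"] by (simp add: val_add Suc power_one_over)
    finally show ?thesis .
  qed
  have "emeasure ?C (tail_set k l) \<le> emeasure ?C {s\<in>space ?C. 1 \<le> ennreal (1 / ?v) * ennreal (V (s (f k)))}"
    by (intro emeasure_mono sub) measurable
  also have "\<dots> \<le> ennreal (1 / ?v) * (\<integral>\<^sup>+s. ennreal (V (s (f k))) * indicator (space ?C) s \<partial>?C)"
    by (intro nn_integral_Markov_inequality) measurable
  also have "(\<integral>\<^sup>+s. ennreal (V (s (f k))) * indicator (space ?C) s \<partial>?C) = (\<integral>\<^sup>+s. ennreal (V (s (f k))) \<partial>?C)"
    by (rule nn_integral_cong) simp
  also have "ennreal (1 / ?v) * \<dots> \<le> ennreal (1 / ?v) * ennreal (val k * (1 / r) ^ Suc c)"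
    by (intro mult_left_mono mean x Vx) simp
  also have "\<dots> = ennreal (val k * (1 / r) ^ Suc c / ?v)"
    using val_pos[of "k - c + j"] r val_pos[of k] by (subst ennreal_mult[symmetric]) (simp_all add: less_imp_le)
  also have "\<dots> \<le> ennreal ((1 / r) ^ l)"
    by (rule ennreal_leI[OF v])
  finally show ?thesis
    using r by (simp add: tail_def C.emeasure_eq_measure)
qed

text \<open>A rank never exceeds the tail at the level actually reached, and this tail is at most
  that of the jump law. Inverting the latter, the jump is at least the level.\<close>

lemma cpl_dominates:
  assumes x: "x \<in> space M" and Vx: "V x \<le> val k"
  shows "AE p in chain_path M P (f k) x \<Otimes>\<^sub>M unit_law. V (fst p (f k)) \<le> val (cpl k x (fst p (f k)) (snd p))"
proof -
  let ?C = "chain_path M P (f k) x"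
  interpret C: prob_space ?C by (rule prob_space_chain_path[OF P x])
  interpret U: prob_space unit_law by (rule prob_space_unit)
  interpret CU: pair_prob_space ?C unit_law ..
  have pos: "AE p in ?C \<Otimes>\<^sub>M unit_law. 0 < rank k x (fst p (f k)) (snd p)"
  proof -
    have "{p\<in>space (?C \<Otimes>\<^sub>M unit_law). rank k x (fst p (f k)) (snd p) \<le> 0} \<in> sets (?C \<Otimes>\<^sub>M unit_law)"
      using path_rank(1)[OF x, of k] by measurable
    then show ?thesis
      using path_rank(2)[OF x, of 0 k] by (intro AE_I'[where N="{p\<in>space (?C \<Otimes>\<^sub>M unit_law). rank k x (fst p (f k)) (snd p) \<le> 0}"])
        (auto simp: null_sets_def)
  qed
  have "AE p in ?C \<Otimes>\<^sub>M unit_law. 0 \<le> snd p \<and> snd p \<le> 1"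
  proof (rule CU.AE_pair_measure)
    have [measurable]: "snd \<in> borel_measurable (?C \<Otimes>\<^sub>M unit_law)"
      using measurable_snd[of ?C unit_law] by (simp cong: measurable_cong_sets)
    show "{p\<in>space (?C \<Otimes>\<^sub>M unit_law). 0 \<le> snd p \<and> snd p \<le> 1} \<in> sets (?C \<Otimes>\<^sub>M unit_law)"
      by measurable
    show "AE s in ?C. AE u in unit_law. 0 \<le> snd (s, u) \<and> snd (s, u) \<le> 1"
      unfolding snd_conv by (rule AE_I2) (rule AE_unit)
  qed
  with pos show ?thesis
  proof eventually_elim
    case (elim p)
    let ?y = "fst p (f k)"
    let ?l = "level k ?y" and ?t = "rank k x (fst p (f k)) (snd p)"
    have mono: "tail k x (Suc ?l) \<le> tail k x ?l"
      unfolding tail_def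
      by (intro C.finite_measure_mono) (auto simp: tail_set_def sets_chain_path[OF P x] tail_set_sets[unfolded tail_set_def])
    then have "snd p * (tail k x ?l - tail k x (Suc ?l)) \<le> 1 * (tail k x ?l - tail k x (Suc ?l))"
      using elim by (intro mult_right_mono) auto
    then have "?t \<le> tail k x ?l" by (simp add: rank_def)
    also have "\<dots> \<le> (1 / r) ^ ?l" by (rule tail_le[OF x Vx])
    finally have t: "?t \<le> (1 / r) ^ ?l" .
    moreover have "(1 / r) ^ ?l \<le> 1" using r by (intro power_le_one) auto
    ultimately have "?l \<le> tail_index r ?t"
      using elim by (subst tail_index_ge[OF r]) auto
    then show ?case
      by (simp add: cpl_def level_le_iff)
  qed
qed

lemma dominates_at_moves:
  assumes "runs \<Omega> Z"
  shows "dominates_at_moves \<Omega> M P V S Q F (value_at Z) (moves Z)"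
  unfolding dominates_at_moves_def
proof
  fix \<mu> assume \<mu>: "\<mu> \<in> space (prob_algebra M)"
  have U: "unit_law \<in> space (prob_algebra borel)"
    by (simp add: space_prob_algebra prob_space_unit)
  obtain \<Omega>' :: "((nat \<Rightarrow> 'a) \<times> (int \<Rightarrow> real \<times> bool)) measure" and X Zp R
    where sp: "\<And>n. X n \<in> \<Omega>' \<rightarrow>\<^sub>M M" "\<And>n. R n \<in> borel_measurable \<Omega>'" "runs \<Omega>' Zp" "distr \<Omega>' M (X 0) = \<mu>"
      "\<And>m k g. 0 < k \<Longrightarrow>
      g \<in> borel_measurable ((Pi\<^sub>M {..m} (\<lambda>_. M) \<Otimes>\<^sub>M (Pi\<^sub>M UNIV (\<lambda>_. count_space UNIV) \<Otimes>\<^sub>M Pi\<^sub>M {..m} (\<lambda>_. borel)))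
        \<Otimes>\<^sub>M (Pi\<^sub>M {..k} (\<lambda>_. M) \<Otimes>\<^sub>M borel)) \<Longrightarrow>
      (\<integral>\<^sup>+\<omega>. g ((\<lambda>i\<in>{..m}. X i \<omega>, (\<lambda>i. Zp i \<omega>, \<lambda>i\<in>{..m}. R i \<omega>)), (\<lambda>i\<in>{..k}. X (m + i) \<omega>, R (m + k) \<omega>)) \<partial>\<Omega>') =
      (\<integral>\<^sup>+\<omega>. (\<integral>\<^sup>+p. g ((\<lambda>i\<in>{..m}. X i \<omega>, (\<lambda>i. Zp i \<omega>, \<lambda>i\<in>{..m}. R i \<omega>)), p) \<partial>(chain_path M P k (X m \<omega>) \<Otimes>\<^sub>M unit_law)) \<partial>\<Omega>')"
    by (rule coupling_space[OF P \<mu> U]) (rule that, assumption+)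
  \<comment> \<open>Where no segment of \<open>X\<close> is available, the uniform variable itself
    takes the place of the rank.\<close>
  interpret co: coupling q f "\<lambda>k. ennreal (val k powr \<delta>)" "{..c}" jumps \<gamma> K val F M P \<mu> V unit_law cpl
    "\<lambda>k u. k - c + tail_index r u" \<Omega>' X Zp R
  proof (intro coupling.intro coupling_axioms.intro)
    show "(\<lambda>u. k - c + tail_index r u) \<in> borel \<rightarrow>\<^sub>M count_space UNIV" for k
      using measurable_compose[OF tail_index_measurable, of "\<lambda>g. k - c + g" "count_space UNIV"] by simp
    show "distr unit_law (count_space UNIV) (\<lambda>u. k - c + tail_index r u) = measure_pmf (q k)" for k
      using emeasure_unit_atMost by (intro q_law prob_space_unit) (simp_all add: atMost_def)
  qed (assumption | rule paused_grid_axioms P V prob_space_unit sets_unit cpl_measurable cpl_law cpl_dominates sp)+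
  show "\<exists>(\<Omega>' :: ((nat \<Rightarrow> 'a) \<times> (int \<Rightarrow> real \<times> bool)) measure) X D' J'.
          move_coupling \<Omega>' M \<mu> P S Q F X D' J' \<and>
          path_law \<Omega>' (marked_space S) (marked D' J') = path_law \<Omega> (marked_space S) (marked (value_at Z) (moves Z)) \<and>
          (AE \<omega> in \<Omega>'. \<forall>m. J' (int m) \<omega> \<and> V (X m \<omega>) \<le> D' (int m) \<omega> \<longrightarrow>
             V (X (m + F (D' (int m) \<omega>)) \<omega>) \<le> D' (int (m + F (D' (int m) \<omega>))) \<omega>)"
    using co.move_coupling path_law_unique[OF co.runs_Z assms] co.dominates by blast
qed

end

text \<open>The weak drift bounds the growth of the mean by \<open>a\<close> per step, from any
  state. This covers the time between \<open>F (V x)\<close>, where taming applies, and the end of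
  the sojourn.\<close>

lemma end_mean_step:
  fixes a :: real
  assumes P [measurable]: "P \<in> M \<rightarrow>\<^sub>M prob_algebra M" and V [measurable]: "V \<in> borel_measurable M"
    and V_ge: "\<And>x. x \<in> space M \<Longrightarrow> 1 \<le> V x" and a: "0 \<le> a"
    and step: "\<And>x. x \<in> space M \<Longrightarrow> (\<integral>\<^sup>+y. ennreal (V y) \<partial>P x) \<le> ennreal (V x + a)"
    and x: "x \<in> space M"
  shows "(\<integral>\<^sup>+s. ennreal (V (s (n + j))) \<partial>chain_path M P (n + j) x) \<le>
    (\<integral>\<^sup>+s. ennreal (V (s n)) \<partial>chain_path M P n x) + ennreal (real j * a)"
proof (induction j)
  case (Suc j)
  let ?n = "n + j"
  interpret C: prob_space "chain_path M P ?n x" by (rule prob_space_chain_path[OF P x])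
  note sets_C = sets_chain_path[OF P x, of ?n]
  have end_C [measurable]: "(\<lambda>s. s ?n) \<in> chain_path M P ?n x \<rightarrow>\<^sub>M M"
    unfolding measurable_cong_sets[OF sets_C refl] by (rule measurable_component_singleton) simp
  have "(\<lambda>s. s (Suc ?n)) \<in> Pi\<^sub>M {..Suc ?n} (\<lambda>_. M) \<rightarrow>\<^sub>M M"
    by (rule measurable_component_singleton) simp
  then have "(\<lambda>s. ennreal (V (s (Suc ?n)))) \<in> borel_measurable (Pi\<^sub>M {..Suc ?n} (\<lambda>_. M))"
    by (rule measurable_compose) measurable
  from nn_integral_chain_path_Suc[OF P x this]
  have "(\<integral>\<^sup>+s. ennreal (V (s (Suc ?n))) \<partial>chain_path M P (Suc ?n) x) =
      (\<integral>\<^sup>+s. (\<integral>\<^sup>+y. ennreal (V y) \<partial>P (s ?n)) \<partial>chain_path M P ?n x)"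
    by simp
  also have "\<dots> \<le> (\<integral>\<^sup>+s. ennreal (V (s ?n)) + ennreal a \<partial>chain_path M P ?n x)"
  proof (rule nn_integral_mono)
    fix s assume s: "s \<in> space (chain_path M P ?n x)"
    have "s ?n \<in> space M" by (rule measurable_space[OF end_C s])
    then show "(\<integral>\<^sup>+y. ennreal (V y) \<partial>P (s ?n)) \<le> ennreal (V (s ?n)) + ennreal a"
      using step[of "s ?n"] V_ge[of "s ?n"] a by (simp add: ennreal_plus)
  qed
  also have "\<dots> = (\<integral>\<^sup>+s. ennreal (V (s ?n)) \<partial>chain_path M P ?n x) + ennreal a"
    by (subst nn_integral_add) (simp_all add: C.emeasure_space_1)
  also have "\<dots> \<le> (\<integral>\<^sup>+s. ennreal (V (s n)) \<partial>chain_path M P n x) + ennreal (real j * a) + ennreal a"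
    by (intro add_right_mono Suc)
  also have "\<dots> = (\<integral>\<^sup>+s. ennreal (V (s n)) \<partial>chain_path M P n x) + ennreal (real (Suc j) * a)"
    using a by (simp add: add.assoc ennreal_plus[symmetric] distrib_right del: ennreal_plus)
  finally show ?case by simp
qed simp

theorem theorem16:
  fixes M :: "'a measure" and P :: "'a \<Rightarrow> 'a measure" and V :: "'a \<Rightarrow> real"
    and C :: "'a set" and F :: "real \<Rightarrow> nat"
    and b b' lam \<delta> d' \<beta> :: real
  assumes "P \<in> M \<rightarrow>\<^sub>M prob_algebra M"
    and "V \<in> borel_measurable M" and "\<forall>x\<in>space M. 1 \<le> V x"
    and "C \<in> sets M"
    and "drift_condition M P V 1 b C"
    and "0 < lam" and "0 < \<delta>" and "\<delta> < 1" and "1 \<le> d'"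
    and "F = taming_function lam \<delta> d'"
    and "0 < \<beta>" and "\<beta> < 1"
    and "drift_condition M (subsampled_kernel M P V F) V \<beta> b' {x\<in>space M. V x \<le> d'}"
    and "ln \<beta> < (1 / \<delta>) * ln (1 - \<delta>)"
  shows "\<exists>S Q (\<Omega> :: (int \<Rightarrow> real \<times> bool) measure) D J.
           S \<in> sets borel \<and> S \<subseteq> {1..} \<and>
           Q \<in> restrict_space borel S \<rightarrow>\<^sub>M prob_algebra (restrict_space borel S) \<and>
           paused_chain \<Omega> S Q F D J \<and>
           stationary_process \<Omega> (marked_space S) (marked D J) \<and>
           ergodic_process \<Omega> (marked_space S) (marked D J) \<and>
           dominates_at_moves \<Omega> M P V S Q F D J"
proof -
  note P = assms(1) and V = assms(2)
  have V_ge: "1 \<le> V x" if "x \<in> space M" for x using assms(3) that by blast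
  obtain r c where r: "1 < r" and c: "\<beta> < (1 / r) ^ Suc c"
    and moment: "((1 / r) ^ c) powr \<delta> * ((1 - 1 / r) / (1 - r powr \<delta> / r)) < 1" and r_\<delta>: "r powr \<delta> < r"
    using grid_parameters[OF assms(7,8,11,14)] .
  \<comment> \<open>The slack lies between \<beta> and \<open>(1 / r) ^ Suc c\<close>; the error
    terms are \<open>|b'|\<close> from taming and at most \<open>|b|\<close> for each step of a
    sojourn.\<close>
  obtain z0 where z0: "\<And>z. z0 \<le> z \<Longrightarrow> \<beta> * z + \<bar>b'\<bar> + \<bar>b\<bar> * (lam * z powr \<delta> + 1) \<le> (1 / r) ^ Suc c * z"
    by (rule sublinear_bound[OF assms(8) c, of "\<bar>b'\<bar>" "\<bar>b\<bar>" lam]) (use assms in auto)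
  obtain k0 where k0: "z0 < r ^ k0"
    using real_arch_pow[OF r] by blast
  have F_pos: "0 < F z" for z
    using taming_function_pos[OF assms(6,9)] by (simp add: assms(10))
  have F_growth: "real (F z) \<le> lam * z powr \<delta> + 1" if "1 \<le> z" for z
    using taming_function_le[OF assms(6,9) that] by (simp add: assms(10))
  interpret grid r \<delta> "lam + 1" c k0 F
  proof
    show "real (F z) \<le> (lam + 1) * z powr \<delta>" if "1 \<le> z" for z
    proof -
      \<comment> \<open>The 1 lost in rounding up the sojourn length is absorbed by
        \<open>z powr \<delta>\<close>, hence the constant \<open>lam + 1\<close>.\<close>
      have "1 \<le> z powr \<delta>" using that assms(7) by (intro ge_one_powr_ge_zero) auto
      then show ?thesis using F_growth[OF that] by (simp add: distrib_right)
    qed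
  qed (use r r_\<delta> moment F_pos assms(6) in auto)
  have mean: "(\<integral>\<^sup>+s. ennreal (V (s (F (val k)))) \<partial>chain_path M P (F (val k)) x) \<le> ennreal (val k * (1 / r) ^ Suc c)"
    if x: "x \<in> space M" and Vx: "V x \<le> val k" for x k
  proof -
    have step: "(\<integral>\<^sup>+y. ennreal (V y) \<partial>P y') \<le> ennreal (V y' + \<bar>b\<bar>)" if "y' \<in> space M" for y'
    proof -
      have "(\<integral>\<^sup>+y. ennreal (V y) \<partial>P y') \<le> ennreal (1 * V y' + b * indicator C y')"
        using assms(5) that by (simp add: drift_condition_def)
      also have "\<dots> \<le> ennreal (V y' + \<bar>b\<bar>)"
        by (intro ennreal_leI) (auto split: split_indicator)
      finally show ?thesis .
    qed
    \<comment> \<open>The mean is controlled by taming at this earlier time, and from there to the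
      end of the sojourn by the weak drift.\<close>
    let ?n = "F (V x)"
    have n: "?n \<le> F (val k)"
      using taming_function_mono[OF assms(6,9,7) Vx] by (simp add: assms(10))
    have end_n: "(\<lambda>s. s ?n) \<in> chain_path M P ?n x \<rightarrow>\<^sub>M M"
      unfolding measurable_cong_sets[OF sets_chain_path[OF P x] refl] by (rule measurable_component_singleton) simp
    have "(\<integral>\<^sup>+s. ennreal (V (s ?n)) \<partial>chain_path M P ?n x) = (\<integral>\<^sup>+y. ennreal (V y) \<partial>subsampled_kernel M P V F x)"
      unfolding subsampled_kernel_def using V by (intro nn_integral_distr[symmetric] end_n) simp
    also have "\<dots> \<le> ennreal (\<beta> * V x + b' * indicator {x\<in>space M. V x \<le> d'} x)"
      using assms(13) x by (simp add: drift_condition_def)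
    also have "\<dots> \<le> ennreal (\<beta> * val k + \<bar>b'\<bar>)"
      using Vx assms(11) by (intro ennreal_leI add_mono mult_left_mono) (auto split: split_indicator)
    finally have sub: "(\<integral>\<^sup>+s. ennreal (V (s ?n)) \<partial>chain_path M P ?n x) \<le> ennreal (\<beta> * val k + \<bar>b'\<bar>)" .
    have "(\<integral>\<^sup>+s. ennreal (V (s (F (val k)))) \<partial>chain_path M P (F (val k)) x) \<le>
        (\<integral>\<^sup>+s. ennreal (V (s ?n)) \<partial>chain_path M P ?n x) + ennreal (real (F (val k) - ?n) * \<bar>b\<bar>)"
      using end_mean_step[OF P V V_ge _ step x, of ?n "F (val k) - ?n"] n by simp
    also have "\<dots> \<le> ennreal (\<beta> * val k + \<bar>b'\<bar>) + ennreal (real (F (val k) - ?n) * \<bar>b\<bar>)"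
      by (intro add_right_mono sub)
    also have "\<dots> = ennreal (\<beta> * val k + \<bar>b'\<bar> + real (F (val k) - ?n) * \<bar>b\<bar>)"
      using assms(11) val_pos[of k] by (subst ennreal_plus) auto
    also have "\<dots> \<le> ennreal (val k * (1 / r) ^ Suc c)"
    proof (rule ennreal_leI)
      have "real (F (val k) - ?n) * \<bar>b\<bar> \<le> (lam * val k powr \<delta> + 1) * \<bar>b\<bar>"
        using F_growth[OF val_ge_1[of k]] by (intro mult_right_mono) auto
      moreover have "z0 \<le> val k"
      proof -
        have "r ^ k0 \<le> r ^ (k0 + k)" using r by (intro power_increasing) auto
        with k0 show ?thesis unfolding val_def by linarith
      qed
      ultimately show "\<beta> * val k + \<bar>b'\<bar> + real (F (val k) - ?n) * \<bar>b\<bar> \<le> val k * (1 / r) ^ Suc c"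
        using z0[of "val k"] by (simp add: mult.commute)
    qed
    finally show ?thesis .
  qed
  interpret dominated_grid r \<delta> "lam + 1" c k0 F M P V
    by unfold_locales (use P V mean in auto)
  obtain \<nu> :: "(int \<Rightarrow> real) measure" where \<nu>_sets: "sets \<nu> = sets (Pi\<^sub>M UNIV (\<lambda>_. borel))"
    and \<nu>: "runs \<nu> (\<lambda>n z. dec (z n))"
    using two_sided .
  \<comment> \<open>The coded process is carried over to the prescribed type of sample space by
    adding dummy marks; the true marks are read from the ages.\<close>
  define \<Omega> :: "(int \<Rightarrow> real \<times> bool) measure" where
    "\<Omega> = distr \<nu> (Pi\<^sub>M UNIV (\<lambda>_. borel \<Otimes>\<^sub>M count_space UNIV)) (\<lambda>z i. (z i, False))"
  define Z where "Z n \<omega> = dec (fst (\<omega> n))" for n :: int and \<omega> :: "int \<Rightarrow> real \<times> bool"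
  have embed: "(\<lambda>z i. (z i, False)) \<in> \<nu> \<rightarrow>\<^sub>M Pi\<^sub>M UNIV (\<lambda>_. borel \<Otimes>\<^sub>M count_space UNIV)"
    unfolding measurable_cong_sets[OF \<nu>_sets refl]
    by (rule measurable_PiM_single') (auto simp: space_pair_measure)
  have proj: "(\<lambda>\<omega> i. fst (\<omega> i)) \<in> \<Omega> \<rightarrow>\<^sub>M \<nu>"
    unfolding \<Omega>_def measurable_distr_eq1 measurable_cong_sets[OF refl \<nu>_sets]
    by (rule measurable_PiM_single') auto
  have "distr \<Omega> \<nu> (\<lambda>\<omega> i. fst (\<omega> i)) = \<nu>"
    using proj unfolding \<Omega>_def by (subst distr_distr[OF _ embed]) (auto simp: comp_def distr_id)
  from runs_pullback[OF \<nu> proj this] have runs: "runs \<Omega> Z"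
    by (simp add: Z_def[abs_def])
  show ?thesis
  proof (intro exI conjI)
    show "S \<in> sets borel" by (rule S_borel)
    show "S \<subseteq> {1..}" using val_ge_1 by auto
    show "Q \<in> restrict_space borel S \<rightarrow>\<^sub>M prob_algebra (restrict_space borel S)"
      by (rule Q_measurable)
    show "paused_chain \<Omega> S Q F (value_at Z) (moves Z)"
      using runs by (rule paused_chain)
    show "stationary_process \<Omega> (marked_space S) (marked (value_at Z) (moves Z))"
      using runs by (rule stationary)
    show "ergodic_process \<Omega> (marked_space S) (marked (value_at Z) (moves Z))"
      using runs by (rule ergodic)
    show "dominates_at_moves \<Omega> M P V S Q F (value_at Z) (moves Z)"
      using runs by (rule dominates_at_moves)
  qed
qed

end
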